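(* Let $\tau>0$. Let $L:\mathbb T^d\times\mathbb R^d\to\mathbb R$ be a smooth Tonelli Lagrangian for which there is $c_0>0$ with $D^2_{qq}L(x,q)\ge c_0 I$ for all $(x,q)$. Assume one of the following. (Nonlocal case) $\mathbf F:\mathbb T^d\times\mathcal P(\mathbb T^d)\to\mathbb R$ is continuous and strictly monotone, i.e. $\int_{\mathbb T^d}(\mathbf F(x,m)-\mathbf F(x,m'))\,d(m-m')(x)>0$ for all $m\neq m'$ in $\mathcal P(\mathbb T^d)$. (Local case) $\mathbf F(x,m)=F(m(x))$, where $F:\mathbb R^+\to\mathbb R$ is smooth, concave and strictly increasing, and either $F$ is bounded below or $F(m)=\log m$. Then there exists a solution $(\rho_\tau,u_\tau,\tilde\mu_\tau)\in\mathbb R\times C(\mathbb T^d)\times\mathcal C_\tau$ of the $\tau$-discrete MFG $$\begin{cases}\tau\rho=\mathcal L_\tau u(x)-u(x)-\tau\mathbf F(x,\mu)\quad\text{for all }x\in\mathbb T^d,\\[2pt] -\rho=\displaystyle\int_{\mathbb T^d\times\mathbb R^d}\big(L(x,q)+\mathbf F(x,\mu)\big)\,d\tilde\mu(x,q),\qquad \mu=\mathrm{Pr}_{1\#}\tilde\mu.\end{cases}$$ In addition, $\rho_\tau$ and $\mu_\tau=\mathrm{Pr}_{1\#}\tilde\mu_\tau$ are unique, and $u_\tau$ is unique up to additive constants. Moreover, in the local case with $F(m)=\log m$, $$-\rho_\tau=\min_{\tilde\mu\in\mathcal C_\tau}\int_{\mathbb T^d\times\mathbb R^d}\big(L(x,q)+\log\mu(x)\big)\,d\tilde\mu(x,q)=-\log\min_{\phi\in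 C(\mathbb T^d)}\int_{\mathbb T^d}e^{(\mathcal L_\tau\phi(x)-\phi(x))/\tau}\,dx,$$ where in the first minimum $\mu$ denotes the density of $\mathrm{Pr}_{1\#}\tilde\mu$.
   Context: $\mathbb T^d=\mathbb R^d/\mathbb Z^d$; functions on $\mathbb T^d$ are identified with $\mathbb Z^d$-periodic functions on $\mathbb R^d$. $\mathcal P(X)$ denotes the Borel probability measures on $X$. A smooth Tonelli Lagrangian $L(x,q)$ is smooth, superlinear in $q$, with $D^2_{qq}L$ positive definite. Heat kernel: for $\tau>0$, $\eta^\tau(z)=(4\pi\tau)^{-d/2}\sum_{k\in\mathbb Z^d}e^{-|z+k|^2/(4\tau)}$ and $(\eta^\tau*u)(y)=\int_{\mathbb T^d}\eta^\tau(y-z)u(z)\,dz$. Lax operator $\mathcal L_\tau:C(\mathbb T^d)\to C(\mathbb T^d)$: $\mathcal L_\tau u(x)=\max_{q\in\mathbb R^d}\big((\eta^\tau*u)(x+\tau q)-\tau L(x,q)\big)$. $\mathcal P_\ell$ is the set of $\tilde\mu\in\mathcal P(\mathbb T^d\times\mathbb R^d)$ with $\int|q|\,d\tilde\mu<\infty$. $\mathrm{Pr}_1:\mathbb T^d\times\mathbb R^d\to\mathbb T^d$ is the first projection. The set $\mathcal C_\tau$ of $\tau$-holonomic measures consists of those $\tilde\mu\in\mathcal P_\ell$ whose projection $\mu=\mathrm{Pr}_{1\#}\tilde\mu$ satisfies $\mu(A)=\int_A\int_{\mathbb T^d\times\mathbb R^d}\eta^\tau(x+\tau q-z)\,d\tilde\mu(x,q)\,dz$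 for every Borel $A\subset\mathbb T^d$. Thus $\mu$ has the smooth density $z\mapsto\int\eta^\tau(x+\tau q-z)\,d\tilde\mu(x,q)$, with which it is identified; in the local case $\mathbf F(x,\mu)=F(\mu(x))$ uses this density. *)

theory Defs
  imports "HOL-Probability.Probability"
begin

definition int_lattice :: "(real ^ 'n::finite) set" where
  "int_lattice = {k. \<forall>i. k $ i \<in> \<int>}"

lemma int_lattice_0: "0 \<in> int_lattice"
  and int_lattice_add: "x \<in> int_lattice \<Longrightarrow> y \<in> int_lattice \<Longrightarrow> x + y \<in> int_lattice"
  and int_lattice_minus: "x \<in> int_lattice \<Longrightarrow> - x \<in> int_lattice"
  by (auto simp: int_lattice_def)

lemma int_lattice_diff: "x \<in> int_lattice \<Longrightarrow> y \<in> int_lattice \<Longrightarrow> x - y \<in> int_lattice"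
  by (auto simp: int_lattice_def)

definition torus_rel :: "real ^ 'n::finite \<Rightarrow> real ^ 'n \<Rightarrow> bool" where
  "torus_rel x y \<longleftrightarrow> x - y \<in> int_lattice"

quotient_type 'n torus = "real ^ 'n::finite" / torus_rel
proof (rule equivpI)
  show "reflp (torus_rel :: real ^ 'n \<Rightarrow> _)"
    by (auto simp: torus_rel_def reflp_def int_lattice_0)
  show "symp (torus_rel :: real ^ 'n \<Rightarrow> _)"
    unfolding torus_rel_def symp_def by (metis int_lattice_minus minus_diff_eq)
  show "transp (torus_rel :: real ^ 'n \<Rightarrow> _)"
    unfolding torus_rel_def transp_def by (metis int_lattice_add diff_add_cancel add_diff_eq)
qed

instantiation torus :: (finite) ab_group_add
begin

lift_definition zero_torus :: "'a torus" is 0 .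

lift_definition plus_torus :: "'a torus \<Rightarrow> 'a torus \<Rightarrow> 'a torus" is "(+)"
  unfolding torus_rel_def by (metis add_diff_add int_lattice_add)

lift_definition minus_torus :: "'a torus \<Rightarrow> 'a torus \<Rightarrow> 'a torus" is "(-)"
  unfolding torus_rel_def by (metis diff_diff_eq2 diff_add_eq diff_diff_eq add.commute int_lattice_diff)

lift_definition uminus_torus :: "'a torus \<Rightarrow> 'a torus" is uminus
  unfolding torus_rel_def by (metis int_lattice_minus minus_diff_minus)

instance
  by standard (transfer, simp add: torus_rel_def int_lattice_0 algebra_simps)+

end

instantiation torus :: (finite) topological_space
begin

definition open_torus :: "'a torus set \<Rightarrow> bool" where
  "open_torus U \<longleftrightarrow> open (abs_torus -` U)"

instance
  by standard (auto simp: open_torus_def vimage_Union vimage_Int)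

end

lemma continuous_on_abs_torus: "continuous_on UNIV (abs_torus :: real ^ 'n::finite \<Rightarrow> 'n torus)"
  by (simp add: continuous_on_open_vimage open_torus_def)

text \<open>Normalised Lebesgue measure (written \<open>dz\<close> in integrals over the torus): the image of Lebesgue
  measure on the fundamental domain \<open>[0,1)\<^sup>d\<close>.\<close>

definition torus_lebesgue :: "('n::finite torus) measure" where
  "torus_lebesgue =
     distr (restrict_space lborel {x :: real ^ 'n. \<forall>i. 0 \<le> x $ i \<and> x $ i < 1}) borel abs_torus"

text \<open>Meant for open \<open>S\<close>: \<open>f\<close> is of class \<open>C\<^sup>k\<^sup>+\<^sup>1\<close> iff it is differentiable with partial
  derivatives of class \<open>C\<^sup>k\<close>.\<close>

primrec Ck_on :: "nat \<Rightarrow> 'a::euclidean_space set \<Rightarrow> ('a \<Rightarrow> real) \<Rightarrow> bool" where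
  "Ck_on 0 S f \<longleftrightarrow> continuous_on S f"
| "Ck_on (Suc k) S f \<longleftrightarrow> (\<forall>x\<in>S. f differentiable at x) \<and>
     (\<forall>b\<in>Basis. Ck_on k S (\<lambda>x. frechet_derivative f (at x) b))"

definition smooth_on :: "'a::euclidean_space set \<Rightarrow> ('a \<Rightarrow> real) \<Rightarrow> bool" where
  "smooth_on S f \<longleftrightarrow> (\<forall>k. Ck_on k S f)"

definition hessian :: "(real ^ 'n::finite \<Rightarrow> real) \<Rightarrow> real ^ 'n \<Rightarrow> real ^ 'n ^ 'n" where
  "hessian f q = (\<chi> i j. frechet_derivative
     (\<lambda>p. frechet_derivative f (at p) (axis j 1)) (at q) (axis i 1))"

definition tonelli_lagrangian :: "('n::finite torus \<Rightarrow> real ^ 'n \<Rightarrow> real) \<Rightarrow> bool" where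
  "tonelli_lagrangian L \<longleftrightarrow>
     smooth_on UNIV (\<lambda>(x, q). L (abs_torus x) q) \<and>
     (\<forall>x. filterlim (\<lambda>q. L x q / norm q) at_top at_infinity) \<and>
     (\<forall>x q v. v \<noteq> 0 \<longrightarrow> 0 < v \<bullet> (hessian (L x) q *v v))"

lift_definition heat_kernel :: "real \<Rightarrow> 'n::finite torus \<Rightarrow> real" is
  "\<lambda>\<tau> z :: real ^ 'n. (4 * pi * \<tau>) powr (- real CARD('n) / 2) *
     (\<Sum>\<^sub>\<infinity>k\<in>int_lattice. exp (- (norm (z + k))\<^sup>2 / (4 * \<tau>)))"
proof -
  fix \<tau> :: real and z w :: "real ^ 'n"
  assume "torus_rel z w"
  then have zw: "z - w \<in> int_lattice"
    by (simp add: torus_rel_def)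
  let ?e = "\<lambda>y :: real ^ 'n. exp (- (norm y)\<^sup>2 / (4 * \<tau>))"
  have "bij_betw (\<lambda>k. (z - w) + k) int_lattice int_lattice"
  proof (rule bij_betwI[where g = "\<lambda>k. k - (z - w)"])
    show "(\<lambda>k. (z - w) + k) \<in> int_lattice \<rightarrow> int_lattice"
      using zw int_lattice_add by blast
    show "(\<lambda>k. k - (z - w)) \<in> int_lattice \<rightarrow> int_lattice"
      using zw int_lattice_diff by blast
  qed auto
  from infsum_reindex_bij_betw[OF this, of "\<lambda>k. ?e (w + k)"]
  have "(\<Sum>\<^sub>\<infinity>k\<in>int_lattice. ?e (z + k)) = (\<Sum>\<^sub>\<infinity>k\<in>int_lattice. ?e (w + k))"
    by (simp add: algebra_simps)
  then show "(4 * pi * \<tau>) powr (- real CARD('n) / 2) * (\<Sum>\<^sub>\<infinity>k\<in>int_lattice. ?e (z + k)) =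
      (4 * pi * \<tau>) powr (- real CARD('n) / 2) * (\<Sum>\<^sub>\<infinity>k\<in>int_lattice. ?e (w + k))"
    by simp
qed

definition heat_conv :: "real \<Rightarrow> ('n::finite torus \<Rightarrow> real) \<Rightarrow> 'n torus \<Rightarrow> real" where
  "heat_conv \<tau> u y = (\<integral>z. heat_kernel \<tau> (y - z) * u z \<partial>torus_lebesgue)"

text \<open>\<open>GREATEST\<close> is the maximum; it exists for continuous \<open>u\<close> and Tonelli \<open>L\<close>.\<close>

definition lax ::
  "real \<Rightarrow> ('n::finite torus \<Rightarrow> real ^ 'n \<Rightarrow> real) \<Rightarrow> ('n torus \<Rightarrow> real) \<Rightarrow> 'n torus \<Rightarrow> real" where
  "lax \<tau> L u x =
     (GREATEST r. \<exists>q. r = heat_conv \<tau> u (x + abs_torus (\<tau> *\<^sub>R q)) - \<tau> * L x q)"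

text \<open>\<open>space (prob_algebra borel)\<close> is the set of Borel probability measures.\<close>

definition P_ell :: "('n::finite torus \<times> (real ^ 'n)) measure set" where
  "P_ell = {\<nu> \<in> space (prob_algebra borel). integrable \<nu> (\<lambda>(x, q). norm q)}"

definition Pr1 :: "('n::finite torus \<times> (real ^ 'n)) measure \<Rightarrow> 'n torus measure" where
  "Pr1 \<nu> = distr \<nu> borel fst"

definition holonomic_density ::
  "real \<Rightarrow> ('n::finite torus \<times> (real ^ 'n)) measure \<Rightarrow> 'n torus \<Rightarrow> real" where
  "holonomic_density \<tau> \<nu> z = (\<integral>(x, q). heat_kernel \<tau> (x + abs_torus (\<tau> *\<^sub>R q) - z) \<partial>\<nu>)"

definition holonomic :: "real \<Rightarrow> ('n::finite torus \<times> (real ^ 'n)) measure set" where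
  "holonomic \<tau> = {\<nu> \<in> P_ell. \<forall>A\<in>sets borel.
     measure (Pr1 \<nu>) A = (LINT z:A|torus_lebesgue. holonomic_density \<tau> \<nu> z)}"

text \<open>The topology of weak convergence on the Borel probability measures of the torus: the coarsest
  one making \<open>m \<mapsto> \<integral>\<phi> dm\<close> continuous for every continuous \<open>\<phi>\<close>.\<close>

definition weak_topology :: "('n::finite torus measure) topology" where
  "weak_topology = topology_generated_by
     {{m \<in> space (prob_algebra borel). (\<integral>x. \<phi> x \<partial>m) \<in> U} | \<phi> U.
        continuous_on UNIV \<phi> \<and> open (U :: real set)}"

definition nonlocal_coupling :: "('n::finite torus \<Rightarrow> 'n torus measure \<Rightarrow> real) \<Rightarrow> bool" where
  "nonlocal_coupling F \<longleftrightarrow>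
     continuous_map (prod_topology euclidean weak_topology) euclidean (\<lambda>(x, m). F x m) \<and>
     (\<forall>m\<in>space (prob_algebra borel). \<forall>m'\<in>space (prob_algebra borel). m \<noteq> m' \<longrightarrow>
        (\<integral>x. F x m - F x m' \<partial>m) - (\<integral>x. F x m - F x m' \<partial>m') > 0)"

text \<open>The nonlinearity \<open>F\<close> is only relevant on \<open>(0,\<infinity>)\<close>: holonomic densities are positive
  because the heat kernel is.\<close>

definition log_nonlinearity :: "(real \<Rightarrow> real) \<Rightarrow> bool" where
  "log_nonlinearity F \<longleftrightarrow> (\<forall>m>0. F m = ln m)"

definition local_nonlinearity :: "(real \<Rightarrow> real) \<Rightarrow> bool" where
  "local_nonlinearity F \<longleftrightarrow>
     smooth_on {0<..} F \<and> concave_on {0<..} F \<and> strict_mono_on {0<..} F \<and>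
     (bdd_below (F ` {0<..}) \<or> log_nonlinearity F)"

text \<open>In the discrete system the coupling is only evaluated at \<open>\<mu> = Pr1 \<nu>\<close> with \<open>\<nu>\<close> holonomic, so it
  is represented as a function of \<open>(x, \<nu>)\<close>. This lets the local case use the pointwise defined
  smooth density of \<open>\<mu>\<close>.\<close>

definition nonlocal_term ::
  "('n::finite torus \<Rightarrow> 'n torus measure \<Rightarrow> real) \<Rightarrow>
     'n torus \<Rightarrow> ('n torus \<times> (real ^ 'n)) measure \<Rightarrow> real" where
  "nonlocal_term F x \<nu> = F x (Pr1 \<nu>)"

definition local_term ::
  "real \<Rightarrow> (real \<Rightarrow> real) \<Rightarrow> 'n::finite torus \<Rightarrow> ('n torus \<times> (real ^ 'n)) measure \<Rightarrow> real" where
  "local_term \<tau> F x \<nu> = F (holonomic_density \<tau> \<nu> x)"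

definition mfg_solution ::
  "real \<Rightarrow> ('n::finite torus \<Rightarrow> real ^ 'n \<Rightarrow> real) \<Rightarrow>
   ('n torus \<Rightarrow> ('n torus \<times> (real ^ 'n)) measure \<Rightarrow> real) \<Rightarrow>
   real \<Rightarrow> ('n torus \<Rightarrow> real) \<Rightarrow> ('n torus \<times> (real ^ 'n)) measure \<Rightarrow> bool" where
  "mfg_solution \<tau> L G \<rho> u \<nu> \<longleftrightarrow>
     continuous_on UNIV u \<and> \<nu> \<in> holonomic \<tau> \<and>
     (\<forall>x. \<tau> * \<rho> = lax \<tau> L u x - u x - \<tau> * G x \<nu>) \<and>
     has_bochner_integral \<nu> (\<lambda>(x, q). L x q + G x \<nu>) (- \<rho>)"

text \<open>The integral of \<open>L + log \<mu>\<close> against a holonomic measure may be \<open>+\<infinity>\<close> (the integrand is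
  bounded below), where the Bochner integral would return \<open>0\<close>; hence an extended-real integral.\<close>

definition ereal_integral :: "'a measure \<Rightarrow> ('a \<Rightarrow> real) \<Rightarrow> ereal" where
  "ereal_integral M f =
     enn2ereal (\<integral>\<^sup>+x. ennreal (f x) \<partial>M) - enn2ereal (\<integral>\<^sup>+x. ennreal (- f x) \<partial>M)"

definition log_action ::
  "real \<Rightarrow> ('n::finite torus \<Rightarrow> real ^ 'n \<Rightarrow> real) \<Rightarrow> ('n torus \<times> (real ^ 'n)) measure \<Rightarrow> ereal" where
  "log_action \<tau> L \<nu> = ereal_integral \<nu> (\<lambda>(x, q). L x q + ln (holonomic_density \<tau> \<nu> x))"

definition exp_functional ::
  "real \<Rightarrow> ('n::finite torus \<Rightarrow> real ^ 'n \<Rightarrow> real) \<Rightarrow> ('n torus \<Rightarrow> real) \<Rightarrow> real" where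
  "exp_functional \<tau> L \<phi> = (\<integral>x. exp ((lax \<tau> L \<phi> x - \<phi> x) / \<tau>) \<partial>torus_lebesgue)"

end

theory Submission
  imports Defs
begin

text \<open>
  Subtracting \<open>\<delta> \<integral> u\<close>, where \<open>\<delta> > 0\<close> is a lower bound of the heat kernel, turns the Lax operator into
  a sup-norm contraction with constant \<open>1 - \<delta>\<close>. Hence for every continuous \<open>f\<close> the ergodic equation
  \<open>lax u - u - \<tau> f = \<tau> \<rho>\<close> has a solution, and integrating it against a holonomic measure shows
  \<open>-\<rho> \<le> \<integral> (L + f) d\<nu>\<close>. Cesaro means of Markov chains driven by almost optimal controls converge weakly
  to a holonomic measure attaining equality; the controls stay in a compact set by coercivity of \<open>L\<close>.

  An equilibrium is a holonomic \<open>\<nu>\<close> that is optimal for the \<open>f\<close> it generates, that is, a solution of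
  a monotone variational inequality on the pairs (density of \<open>\<nu>\<close>, \<open>\<integral> L d\<nu>\<close>). These pairs form a compact
  convex set because the densities are smoothed by the heat kernel, which also keeps them in a compact
  subinterval of \<open>(0,\<infinity>)\<close>, so Minty's method gives existence. Strict monotonicity gives
  uniqueness of \<open>\<rho>\<close> and \<open>\<mu>\<close>, the strong maximum principle that of \<open>u\<close>. For the logarithm, the two
  duality formulas are Gibbs' and Jensen's inequalities.
\<close>

section \<open>The torus as a compact metric space\<close>

text \<open>The optimal measure for a frozen coupling need not be unique, so the best response is a
  set-valued map. Posed as a variational inequality, the problem gets existence as well as
  uniqueness from monotonicity. The order of choices matters. The coupling is bounded on the set of
  all smoothed densities; this bound gives a radius \<open>K\<close> that confines the almost
  optimal controls for every coupling that can occur; only then is the set of competitors fixed, as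
  the holonomic measures carried by |q| \<le> \<open>K\<close>. The truncation costs nothing: the
  lower bound -\<rho> holds for every holonomic measure with integrable \<open>L\<close> and is
  attained by a truncated one. Holonomy acts through one cancellation: \<integral> u and the
  integral of the heat convolution of u at the next point agree. Hence the nonnegative gap in the
  dynamic programming equation has integral \<tau> (\<integral> (L + f) d\<nu> + \<rho>), and
  optimality means that this integral vanishes. The lower bound \<delta> of the heat kernel serves
  twice: it makes the contraction strict, and it keeps all densities away from 0, where the
  logarithm is singular.\<close>

lift_definition torus_embed :: "'n::finite torus \<Rightarrow> complex ^ 'n" is
  "\<lambda>x. \<chi> i. cis (2 * pi * x $ i)"
proof -
  fix x y :: "real ^ 'n" assume "torus_rel x y"
  then have *: "x $ i - y $ i \<in> \<int>" for i
    by (simp add: torus_rel_def int_lattice_def)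
  have "cis (2 * pi * x $ i) = cis (2 * pi * y $ i)" for i
  proof -
    obtain n :: int where "x $ i - y $ i = of_int n" using *[of i] by (auto elim: Ints_cases)
    then have "2 * pi * x $ i = 2 * pi * y $ i + 2 * pi * of_int n"
      by (metis add_diff_cancel_left' diff_add_cancel distrib_left)
    then show ?thesis
      by (metis cis_mult cis_multiple_2pi Ints_of_int mult.right_neutral)
  qed
  then show "(\<chi> i. cis (2 * pi * x $ i)) = (\<chi> i. cis (2 * pi * y $ i))" by simp
qed

lemma abs_torus_eq_iff: "abs_torus x = abs_torus y \<longleftrightarrow> x - y \<in> int_lattice"
  using torus.abs_eq_iff[of x y] by (simp add: torus_rel_def)

lemma torus_exhaust: obtains y where "x = abs_torus y"
  by (metis Quotient3_abs_rep Quotient3_torus)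

lemma torus_embed_abs: "torus_embed (abs_torus x) = (\<chi> i. cis (2 * pi * x $ i))"
  by (rule torus_embed.abs_eq)

lemma inj_torus_embed: "torus_embed x = torus_embed y \<longleftrightarrow> x = y"
proof (transfer, rule iffI)
  fix x y :: "real ^ 'a"
  assume eq: "(\<chi> i. cis (2 * pi * x $ i)) = (\<chi> i. cis (2 * pi * y $ i))"
  show "torus_rel x y"
    unfolding torus_rel_def int_lattice_def
  proof (intro CollectI allI)
    fix i
    have "cis (2 * pi * x $ i) = cis (2 * pi * y $ i)"
      using eq by (simp add: vec_eq_iff)
    then have "sin (2 * pi * x $ i) = sin (2 * pi * y $ i) \<and> cos (2 * pi * x $ i) = cos (2 * pi * y $ i)"
      by (simp add: complex_eq_iff)
    then obtain n :: int where "2 * pi * x $ i = 2 * pi * y $ i + 2 * pi * of_int n"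
      using sin_cos_eq_iff by (metis mult.commute mult.left_commute)
    then have "x $ i = y $ i + of_int n"
      by (metis (no_types, opaque_lifting) distrib_left mult_cancel_left pi_neq_zero zero_neq_numeral mult_eq_0_iff)
    then show "(x - y) $ i \<in> \<int>" by simp
  qed
next
  fix x y :: "real ^ 'a"
  assume "torus_rel x y"
  then show "(\<chi> i. cis (2 * pi * x $ i)) = (\<chi> i. cis (2 * pi * y $ i))"
    by (metis torus_embed_abs torus.abs_eq_iff)
qed

lemma open_torus_iff: "open U \<longleftrightarrow> open (abs_torus -` U)"
  by (simp add: open_torus_def)

lemma continuous_on_torus_iff:
  fixes f :: "'n::finite torus \<Rightarrow> 'b::topological_space"
  shows "continuous_on UNIV f \<longleftrightarrow> continuous_on UNIV (\<lambda>x. f (abs_torus x))"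
  by (simp add: continuous_on_open_vimage open_torus_iff vimage_comp o_def)

lemma continuous_torus_embed: "continuous_on UNIV torus_embed"
  unfolding continuous_on_torus_iff torus_embed_abs
  by (intro continuous_on_vec_lambda continuous_intros)

lemma torus_exhaust_cbox: obtains y where "x = abs_torus y" "y \<in> cbox 0 1"
proof -
  obtain y where y: "x = abs_torus y" by (rule torus_exhaust)
  let ?z = "(\<chi> i. frac (y $ i)) :: real ^ 'a"
  have "x = abs_torus ?z" unfolding y abs_torus_eq_iff
    by (simp add: int_lattice_def frac_def)
  moreover have "?z \<in> cbox 0 1" by (simp add: mem_box_cart less_imp_le[OF frac_lt_1])
  ultimately show ?thesis by (rule that)
qed

lemma compact_UNIV_torus: "compact (UNIV :: 'n::finite torus set)"
proof -
  have "abs_torus ` (cbox 0 1) = (UNIV :: 'n torus set)"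
  proof (intro set_eqI iffI UNIV_I)
    fix x :: "'n torus"
    obtain y where "x = abs_torus y" "y \<in> cbox 0 1" by (rule torus_exhaust_cbox)
    then show "x \<in> abs_torus ` (cbox 0 1)" by blast
  qed
  moreover have "compact (abs_torus ` (cbox 0 (1 :: real ^ 'n)))"
    by (rule compact_continuous_image[OF continuous_on_subset[OF continuous_on_abs_torus]]) auto
  ultimately show ?thesis by simp
qed

text \<open>The quotient by a group of translations is an open map. This carries a countable base
  over to the torus and lets continuity on products be tested upstairs.\<close>

lemma open_image_abs_torus:
  fixes U :: "(real ^ 'n::finite) set"
  assumes "open U" shows "open (abs_torus ` U)"
proof -
  have "abs_torus -` (abs_torus ` U) = (\<Union>k\<in>int_lattice. (+) k ` U)"
  proof safe
    fix x y assume "abs_torus x = abs_torus y" "y \<in> U"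
    then have "x - y \<in> int_lattice" "x = (x - y) + y" by (auto simp: abs_torus_eq_iff)
    then show "x \<in> (\<Union>k\<in>int_lattice. (+) k ` U)" using \<open>y \<in> U\<close> by blast
  next
    fix k y :: "real ^ 'n" assume "k \<in> int_lattice" "y \<in> U"
    moreover have "abs_torus (k + y) = abs_torus y"
      using \<open>k \<in> int_lattice\<close> by (simp add: abs_torus_eq_iff)
    ultimately show "k + y \<in> abs_torus -` abs_torus ` U" by auto
  qed
  then show ?thesis
    using assms by (auto simp: open_torus_iff intro!: open_translation)
qed

text \<open>The metric is pulled back along \<open>torus_embed\<close>. It induces the quotient
  topology fixed earlier because a continuous injection of a compact space into a metric space is a
  homeomorphism onto its image.\<close>

instantiation torus :: (finite) metric_space
begin

definition dist_torus :: "'a torus \<Rightarrow> 'a torus \<Rightarrow> real" where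
  "dist_torus x y = dist (torus_embed x) (torus_embed y)"

definition uniformity_torus :: "('a torus \<times> 'a torus) filter" where
  "uniformity_torus = (INF e\<in>{0 <..}. principal {(x, y). dist x y < e})"

instance
proof
  show "(uniformity :: ('a torus \<times> 'a torus) filter) = (INF e\<in>{0 <..}. principal {(x, y). dist x y < e})"
    by (rule uniformity_torus_def)
  have ev: "eventually P (uniformity :: ('a torus \<times> 'a torus) filter) \<longleftrightarrow>
      (\<exists>e>0. \<forall>x y. dist x y < e \<longrightarrow> P (x, y))" for P
    unfolding uniformity_torus_def
  proof (subst eventually_INF_base)
    fix a b :: real assume "a \<in> {0<..}" "b \<in> {0<..}"
    then show "\<exists>x\<in>{0<..}. principal {(y, z :: 'a torus). dist y z < x} \<le>
        principal {(x, y). dist x y < a} \<sqinter> principal {(x, y). dist x y < b}"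
      by (intro bexI[of _ "min a b"]) auto
  qed (auto simp: eventually_principal)
  show "open U \<longleftrightarrow> (\<forall>x\<in>U. \<forall>\<^sub>F (x', y) in uniformity. x' = x \<longrightarrow> y \<in> U)" for U :: "'a torus set"
  proof
    assume "open U"
    show "\<forall>x\<in>U. \<forall>\<^sub>F (x', y) in uniformity. x' = x \<longrightarrow> y \<in> U"
    proof
      fix x assume "x \<in> U"
      \<comment> \<open>The image of the complement is compact, hence closed, and misses
        \<open>torus_embed x\<close> by injectivity; a ball avoiding it gives the radius.\<close>
      have "compact (- U)"
        using compact_UNIV_torus \<open>open U\<close> by (metis closed_Compl compact_Int_closed inf_top_left)
      then have "closed (torus_embed ` (- U))"
        by (intro compact_imp_closed compact_continuous_image
              continuous_on_subset[OF continuous_torus_embed]) auto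
      moreover have "torus_embed x \<notin> torus_embed ` (- U)"
        using \<open>x \<in> U\<close> by (auto simp: inj_torus_embed)
      ultimately obtain e where "e > 0" "\<And>z. dist z (torus_embed x) < e \<Longrightarrow> z \<notin> torus_embed ` (- U)"
        by (meson open_Compl open_dist Compl_iff)
      then show "\<forall>\<^sub>F (x', y) in uniformity. x' = x \<longrightarrow> y \<in> U"
        unfolding ev dist_torus_def by (metis (mono_tags, lifting) ComplI case_prod_conv dist_commute imageI)
    qed
  next
    assume *: "\<forall>x\<in>U. \<forall>\<^sub>F (x', y) in uniformity. x' = x \<longrightarrow> y \<in> U"
    show "open U"
    proof (subst open_subopen, intro ballI)
      fix x assume "x \<in> U"
      then obtain e where e: "e > 0" "\<And>y. dist x y < e \<Longrightarrow> y \<in> U" using * unfolding ev by auto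
      have "open (torus_embed -` ball (torus_embed x) e)"
        using continuous_torus_embed open_ball by (auto simp only: continuous_on_open_vimage[OF open_UNIV] Int_UNIV_right)
      moreover have "x \<in> torus_embed -` ball (torus_embed x) e" using e by simp
      moreover have "torus_embed -` ball (torus_embed x) e \<subseteq> U" using e by (auto simp: dist_torus_def)
      ultimately show "\<exists>T. open T \<and> x \<in> T \<and> T \<subseteq> U" by blast
    qed
  qed
  show "(dist x y = 0) = (x = y)" for x y :: "'a torus" by (simp add: dist_torus_def inj_torus_embed)
  show "dist x y \<le> dist x z + dist y z" for x y z :: "'a torus"
    unfolding dist_torus_def by (rule dist_triangle2)
qed

end

instance torus :: (finite) second_countable_topology
proof
  obtain B :: "(real ^ 'a) set set" where B: "countable B" "topological_basis B"
    using ex_countable_basis by blast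
  have "topological_basis ((`) abs_torus ` B)"
  proof (rule topological_basisI)
    fix b' assume "b' \<in> (`) abs_torus ` B"
    then show "open b'" using B by (auto intro!: open_image_abs_torus simp: topological_basis_open)
  next
    fix O' :: "'a torus set" and x assume "open O'" "x \<in> O'"
    obtain y where y: "x = abs_torus y" by (rule torus_exhaust)
    have "open (abs_torus -` O')" "y \<in> abs_torus -` O'"
      using \<open>open O'\<close> \<open>x \<in> O'\<close> y by (auto simp: open_torus_iff)
    then obtain b where "b \<in> B" "y \<in> b" "b \<subseteq> abs_torus -` O'" using topological_basisE[OF B(2)] by metis
    then show "\<exists>B'\<in>(`) abs_torus ` B. x \<in> B' \<and> B' \<subseteq> O'"
      by (intro bexI[of _ "abs_torus ` b"]) (auto simp: y)
  qed
  then show "\<exists>B::'a torus set set. countable B \<and> open = generate_topology B"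
    using B(1) by (metis countable_image topological_basis_imp_subbasis)
qed

text \<open>The product of a quotient map with an identity need not be a quotient map; here it is
  one, because \<open>abs_torus\<close> is open and so maps open rectangles to open
  rectangles.\<close>

lemma continuous_on_torus_times_iff:
  fixes f :: "'n::finite torus \<times> 'a::topological_space \<Rightarrow> 'b::topological_space"
  shows "continuous_on UNIV f \<longleftrightarrow> continuous_on UNIV (\<lambda>(x, q). f (abs_torus x, q))"
proof
  assume "continuous_on UNIV f"
  then show "continuous_on UNIV (\<lambda>(x, q). f (abs_torus x, q))"
    unfolding case_prod_beta
    by (rule continuous_on_compose2) 
       (auto intro!: continuous_intros continuous_on_compose2[OF continuous_on_abs_torus])
next
  assume c: "continuous_on UNIV (\<lambda>(x, q). f (abs_torus x, q))"
  show "continuous_on UNIV f"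
    unfolding continuous_on_open_vimage[OF open_UNIV]
  proof (intro allI impI)
    fix B :: "'b set" assume "open B"
    let ?g = "\<lambda>(x :: real ^ 'n, q). f (abs_torus x, q)"
    have o: "open (?g -` B)" using c \<open>open B\<close> by (simp add: continuous_on_open_vimage)
    have "open (f -` B)"
    proof (subst open_subopen, intro ballI)
      fix p assume p: "p \<in> f -` B"
      obtain y where y: "fst p = abs_torus y" by (rule torus_exhaust)
      have "(y, snd p) \<in> ?g -` B" using p y by (metis case_prod_conv prod.collapse vimage_eq)
      then obtain U V where UV: "open U" "open V" "(y, snd p) \<in> U \<times> V" "U \<times> V \<subseteq> ?g -` B"
        using o by (metis open_prod_elim)
      show "\<exists>T. open T \<and> p \<in> T \<and> T \<subseteq> f -` B"
      proof (intro exI conjI)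
        show "open ((abs_torus ` U) \<times> V)" using UV by (intro open_Times open_image_abs_torus)
        show "p \<in> (abs_torus ` U) \<times> V" using UV y by (cases p) auto
        show "(abs_torus ` U) \<times> V \<subseteq> f -` B" using UV(4) by auto
      qed
    qed
    then show "open (f -` B \<inter> UNIV)" by simp
  qed
qed

lemma abs_torus_add: "abs_torus (x + y) = abs_torus x + abs_torus y"
  by (simp add: plus_torus.abs_eq)

lemma abs_torus_diff: "abs_torus (x - y) = abs_torus x - abs_torus y"
  by (simp add: minus_torus.abs_eq)

lemma continuous_on_torus_shift:
  "continuous_on UNIV (\<lambda>(x, q). x + abs_torus (\<tau> *\<^sub>R q :: real ^ 'n::finite))"
  unfolding continuous_on_torus_times_iff case_prod_beta fst_conv snd_conv abs_torus_add[symmetric]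
  by (auto intro!: continuous_intros continuous_on_compose2[OF continuous_on_abs_torus])

lemma continuous_on_torus_diff:
  "continuous_on UNIV (\<lambda>(x :: 'n::finite torus, y). x - y)"
proof -
  \<comment> \<open>The product criterion descends only the first coordinate, so the two coordinates
    are treated one at a time with a swap in between.\<close>
  have s: "continuous_on UNIV (\<lambda>(y :: 'n torus, x). x - y)"
    unfolding continuous_on_torus_times_iff case_prod_beta fst_conv snd_conv
  proof -
    have "continuous_on UNIV (\<lambda>(x :: 'n torus, y). x - abs_torus y)"
      unfolding continuous_on_torus_times_iff case_prod_beta fst_conv snd_conv abs_torus_diff[symmetric]
      by (auto intro!: continuous_intros continuous_on_compose2[OF continuous_on_abs_torus])
    from continuous_on_compose2[OF this continuous_on_swap, of UNIV]
    show "continuous_on UNIV (\<lambda>x :: (real ^ 'n) \<times> 'n torus. snd x - abs_torus (fst x))"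
      by (simp add: prod.swap_def case_prod_beta)
  qed
  from continuous_on_compose2[OF this continuous_on_swap, of UNIV]
  show ?thesis by (simp add: prod.swap_def case_prod_beta)
qed

section \<open>Lebesgue measure and the heat kernel on the torus\<close>

lemma sets_torus_lebesgue [measurable_cong]: "sets torus_lebesgue = sets borel"
  by (simp add: torus_lebesgue_def)

lemma space_torus_lebesgue [simp]: "space torus_lebesgue = UNIV"
  by (simp add: torus_lebesgue_def)

definition unit_cell :: "(real ^ 'n::finite) set" where
  "unit_cell = {x. \<forall>i. 0 \<le> x $ i \<and> x $ i < 1}"

lemma borel_unit_cell [measurable]: "unit_cell \<in> sets borel"
proof -
  have "unit_cell = (\<Inter>i. {x :: real ^ 'a. 0 \<le> x $ i} - {x. 1 \<le> x $ i})"
    by (simp add: unit_cell_def set_eq_iff not_le)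
  also have "\<dots> \<in> sets borel"
    by (intro sets.finite_INT sets.Diff borel_closed closed_Collect_le continuous_intros) auto
  finally show ?thesis .
qed

lemma borel_measurable_abs_torus [measurable]: "abs_torus \<in> borel_measurable borel"
  by (rule borel_measurable_continuous_onI[OF continuous_on_abs_torus])

lemma nn_integral_torus:
  assumes [measurable]: "f \<in> borel_measurable borel"
  shows "(\<integral>\<^sup>+z. f z \<partial>torus_lebesgue) = (\<integral>\<^sup>+x. f (abs_torus x) * indicator unit_cell x \<partial>lborel)"
  unfolding torus_lebesgue_def unit_cell_def[symmetric]
  by (subst nn_integral_distr) (auto simp: nn_integral_restrict_space measurable_restrict_space1)

lemma emeasure_unit_cell: "emeasure lborel (unit_cell :: (real ^ 'n::finite) set) = 1"
proof -
  have 1: "\<forall>b\<in>Basis. (1 :: real ^ 'n) \<bullet> b = 1" by (auto simp: Basis_vec_def inner_axis)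
  have b: "emeasure lborel (box 0 (1 :: real ^ 'n)) = 1" "emeasure lborel (cbox 0 (1 :: real ^ 'n)) = 1"
    using 1 by (simp_all add: emeasure_lborel_box_eq emeasure_lborel_cbox_eq prod.neutral)
  have "box 0 (1 :: real ^ 'n) \<subseteq> unit_cell" "unit_cell \<subseteq> cbox 0 (1 :: real ^ 'n)"
    by (auto simp: mem_box_cart unit_cell_def less_imp_le)
  then have "emeasure lborel (box 0 (1 :: real ^ 'n)) \<le> emeasure lborel (unit_cell :: (real ^ 'n) set)"
    "emeasure lborel (unit_cell :: (real ^ 'n) set) \<le> emeasure lborel (cbox 0 (1 :: real ^ 'n))"
    by (intro emeasure_mono; auto)+
  then show ?thesis using b by auto
qed

lemma prob_space_torus_lebesgue: "prob_space (torus_lebesgue :: 'n::finite torus measure)"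
  by standard (use nn_integral_torus[of "\<lambda>_ :: 'n torus. 1"] in \<open>simp add: emeasure_unit_cell\<close>)

lemma countable_int_lattice: "countable (int_lattice :: (real ^ 'n::finite) set)"
proof -
  have "int_lattice \<subseteq> range (\<lambda>f :: 'n \<Rightarrow> int. \<chi> i. real_of_int (f i))"
  proof
    fix k :: "real ^ 'n" assume "k \<in> int_lattice"
    then have "k = (\<chi> i. real_of_int \<lfloor>k $ i\<rfloor>)" by (simp add: int_lattice_def vec_eq_iff)
    then show "k \<in> range (\<lambda>f :: 'n \<Rightarrow> int. \<chi> i. real_of_int (f i))" by (metis rangeI)
  qed
  then show ?thesis by (rule countable_subset) auto
qed

lemma unit_cell_translate_iff:
  assumes "k \<in> int_lattice"
  shows "x - k \<in> unit_cell \<longleftrightarrow> k = (\<chi> i. real_of_int \<lfloor>x $ i\<rfloor>)"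
proof
  assume *: "x - k \<in> unit_cell"
  have "k $ i = real_of_int \<lfloor>x $ i\<rfloor>" for i
  proof -
    obtain m :: int where m: "k $ i = of_int m" using assms by (auto simp: int_lattice_def elim: Ints_cases)
    have "0 \<le> x $ i - k $ i" "x $ i - k $ i < 1" using * by (auto simp: unit_cell_def)
    then have "\<lfloor>x $ i\<rfloor> = m" unfolding m by linarith
    then show ?thesis using m by simp
  qed
  then show "k = (\<chi> i. real_of_int \<lfloor>x $ i\<rfloor>)" by (simp add: vec_eq_iff)
next
  assume "k = (\<chi> i. real_of_int \<lfloor>x $ i\<rfloor>)"
  moreover have "x $ i < real_of_int \<lfloor>x $ i\<rfloor> + 1" for i by linarith
  ultimately show "x - k \<in> unit_cell"
    by (simp add: unit_cell_def algebra_simps)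
qed

text \<open>The lattice translates of \<open>unit_cell\<close> tile space, so summing their
  indicators inserts a factor 1; exchanging sum and integral and translating each piece back to the
  cell gives the claim. It is the bridge between lattice sums on the torus and Gaussian integrals on
  the whole space.\<close>

lemma nn_integral_unfold:
  fixes h :: "real ^ 'n::finite \<Rightarrow> ennreal"
  assumes [measurable]: "h \<in> borel_measurable borel"
  shows "(\<integral>\<^sup>+x. h x \<partial>lborel) =
    (\<integral>\<^sup>+x. (\<integral>\<^sup>+k. h (x + k) \<partial>count_space int_lattice) * indicator unit_cell x \<partial>lborel)"
proof -
  have pt: "(\<integral>\<^sup>+k. h x * indicator unit_cell (x - k) \<partial>count_space int_lattice) = h x" for x
  proof -
    let ?k = "\<chi> i. real_of_int \<lfloor>x $ i\<rfloor>"
    have k: "?k \<in> int_lattice" by (simp add: int_lattice_def)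
    have "(\<integral>\<^sup>+k. h x * indicator unit_cell (x - k) \<partial>count_space int_lattice) =
        (\<Sum>k\<in>{?k}. h x * indicator unit_cell (x - k))"
      using k by (intro nn_integral_count_space') (auto simp: unit_cell_translate_iff indicator_def)
    then show ?thesis using unit_cell_translate_iff[OF k, of x] by simp
  qed
  have "(\<integral>\<^sup>+x. h x \<partial>lborel) =
      (\<integral>\<^sup>+x. (\<integral>\<^sup>+k. h x * indicator unit_cell (x - k) \<partial>count_space int_lattice) \<partial>lborel)"
    by (simp add: pt)
  also have "\<dots> = (\<integral>\<^sup>+k. (\<integral>\<^sup>+x. h x * indicator unit_cell (x - k) \<partial>lborel) \<partial>count_space int_lattice)"
    by (intro nn_integral_count_space_nn_integral countable_int_lattice) measurable
  also have "\<dots> = (\<integral>\<^sup>+k. (\<integral>\<^sup>+x. h (x + k) * indicator unit_cell x \<partial>lborel) \<partial>count_space int_lattice)"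
  proof (rule nn_integral_cong)
    fix k :: "real ^ 'n"
    have "(\<integral>\<^sup>+x. h x * indicator unit_cell (x - k) \<partial>lborel) =
        (\<integral>\<^sup>+x. h x * indicator unit_cell (x - k) \<partial>distr lborel borel ((+) k))"
      by (simp add: lborel_distr_plus)
    also have "\<dots> = (\<integral>\<^sup>+x. h (x + k) * indicator unit_cell x \<partial>lborel)"
      by (subst nn_integral_distr) (auto simp: add.commute)
    finally show "(\<integral>\<^sup>+x. h x * indicator unit_cell (x - k) \<partial>lborel) =
        (\<integral>\<^sup>+x. h (x + k) * indicator unit_cell x \<partial>lborel)" .
  qed
  also have "\<dots> = (\<integral>\<^sup>+x. (\<integral>\<^sup>+k. h (x + k) * indicator unit_cell x \<partial>count_space int_lattice) \<partial>lborel)"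
    by (intro nn_integral_count_space_nn_integral[symmetric] countable_int_lattice) measurable
  also have "\<dots> = (\<integral>\<^sup>+x. (\<integral>\<^sup>+k. h (x + k) \<partial>count_space int_lattice) * indicator unit_cell x \<partial>lborel)"
    by (intro nn_integral_cong nn_integral_multc) auto
  finally show ?thesis .
qed

section \<open>Gaussian lattice sums and the heat kernel\<close>

definition gauss :: "real \<Rightarrow> real ^ 'n::finite \<Rightarrow> real" where
  "gauss \<tau> y = (4 * pi * \<tau>) powr (- real CARD('n) / 2) * exp (- (norm y)\<^sup>2 / (4 * \<tau>))"

lemma gauss_pos: "\<tau> > 0 \<Longrightarrow> gauss \<tau> y > 0"
  by (simp add: gauss_def)

lemma gauss_minus [simp]: "gauss \<tau> (- y) = gauss \<tau> y"
  by (simp add: gauss_def)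

lemma continuous_on_gauss [continuous_intros]: 
  "continuous_on A f \<Longrightarrow> continuous_on A (\<lambda>x. gauss \<tau> (f x))"
  unfolding gauss_def divide_inverse by (intro continuous_intros)

lemma borel_measurable_gauss [measurable]: "gauss \<tau> \<in> borel_measurable borel"
  by (rule borel_measurable_continuous_onI) (intro continuous_intros)

text \<open>In coordinates the Gaussian is a product of centred normal densities with variance
  2\<tau>.\<close>

lemma nn_integral_gauss:
  assumes "\<tau> > 0"
  shows "(\<integral>\<^sup>+y. ennreal (gauss \<tau> (y :: real ^ 'n::finite)) \<partial>lborel) = 1"
proof -
  let ?s = "sqrt (2 * \<tau>)"
  have sq: "?s\<^sup>2 = 2 * \<tau>" using assms by simp
  have "(4 * pi * \<tau>) powr (- real CARD('n) / 2) = (1 / sqrt (4 * pi * \<tau>)) ^ CARD('n)"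
    using assms
    by (simp add: powr_half_sqrt[symmetric] powr_realpow[symmetric] powr_powr powr_minus_divide
       power_divide powr_minus)
  then have "gauss \<tau> y = (\<Prod>b\<in>Basis. normal_density 0 ?s (y \<bullet> b))" for y :: "real ^ 'n"
  proof -
    have "(norm y)\<^sup>2 = (\<Sum>b\<in>Basis. (y \<bullet> b)\<^sup>2)"
      unfolding power2_norm_eq_inner euclidean_inner[of y y] by (simp add: power2_eq_square)
    then have "exp (- (norm y)\<^sup>2 / (4 * \<tau>)) = (\<Prod>b\<in>Basis. exp (- (y \<bullet> b)\<^sup>2 / (4 * \<tau>)))"
      by (simp add: exp_sum[symmetric] sum_negf sum_divide_distrib)
    moreover have "normal_density 0 ?s x = (1 / sqrt (4 * pi * \<tau>)) * exp (- x\<^sup>2 / (4 * \<tau>))" for x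
      unfolding normal_density_def sq by (simp add: mult_ac)
    ultimately show ?thesis
      unfolding gauss_def \<open>_ powr _ = _\<close> by (simp add: prod_dividef power_divide)
  qed
  then have "(\<integral>\<^sup>+y. ennreal (gauss \<tau> (y :: real ^ 'n)) \<partial>lborel) =
      (\<integral>\<^sup>+y. (\<Prod>b\<in>Basis. ennreal (normal_density 0 ?s ((y :: real ^ 'n) \<bullet> b))) \<partial>lborel)"
    by (simp add: prod_ennreal)
  also have "\<dots> = (\<Prod>b\<in>(Basis :: (real ^ 'n) set). (\<integral>\<^sup>+x. ennreal (normal_density 0 ?s x) \<partial>lborel))"
    by (rule nn_integral_lborel_prod) auto
  also have "(\<integral>\<^sup>+x. ennreal (normal_density 0 ?s x) \<partial>lborel) = 1"
    using assms by (subst nn_integral_eq_integral) auto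
  finally show ?thesis by simp
qed

lemma nn_integral_count_space_infsum:
  fixes f :: "'a \<Rightarrow> real"
  assumes "\<And>x. x \<in> A \<Longrightarrow> 0 \<le> f x" "f summable_on A"
  shows "(\<integral>\<^sup>+x. ennreal (f x) \<partial>count_space A) = ennreal (infsum f A)"
proof -
  have "Infinite_Sum.abs_summable_on f A" by (rule summable_on_iff_abs_summable_on_real[THEN iffD1, OF assms(2)])
  then have 1: "Infinite_Set_Sum.abs_summable_on f A"
    by (simp only: abs_summable_equivalent)
  have "(\<integral>\<^sup>+x. ennreal (f x) \<partial>count_space A) = ennreal (integral\<^sup>L (count_space A) f)"
    using assms 1 by (intro nn_integral_eq_integral) (auto simp: AE_count_space Infinite_Set_Sum.abs_summable_on_def)
  also have "integral\<^sup>L (count_space A) f = infsum f A"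
    using infsetsum_infsum[OF 1] by (simp only: infsetsum_def)
  finally show ?thesis .
qed

text \<open>Sum against integral: each term is dominated by a multiple of a Gaussian at x + k,
  uniformly for x in the unit cell. Averaging over x and unfolding bounds the whole sum by
  \<open>C\<close> times the total Gaussian mass.\<close>

lemma summable_on_lattice_exp:
  assumes "a > 0"
  shows "(\<lambda>k :: real ^ 'n::finite. exp (- a * (norm k)\<^sup>2)) summable_on int_lattice"
proof -
  \<comment> \<open>With this \<open>?t\<close> the Gaussian exponent at y = x + k is a |y|^2 / 2,
    at most a d^2 + a |k|^2 since |x| \<le> d on the cell; \<open>C\<close> absorbs the factor exp(a
    d^2) and the normalisation.\<close>
  let ?d = "real CARD('n)" and ?t = "1 / (2 * a)"
  define C where "C = exp (a * ?d\<^sup>2) / (4 * pi * ?t) powr (- real CARD('n) / 2)"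
  have C: "C > 0" using assms by (simp add: C_def)
  have t: "?t > 0" using assms by simp
  have le: "exp (- a * (norm k)\<^sup>2) \<le> C * gauss ?t (x + k)" if "x \<in> unit_cell" for x k :: "real ^ 'n"
  proof -
    have "norm x \<le> (\<Sum>i\<in>UNIV. \<bar>x $ i\<bar>)" by (rule norm_le_l1_cart)
    also have "\<dots> \<le> (\<Sum>i\<in>(UNIV :: 'n set). 1)"
      using that by (intro sum_mono) (auto simp: unit_cell_def intro: less_imp_le)
    finally have "norm x \<le> ?d" by simp
    moreover have "norm (x + k) \<le> norm x + norm k" by (rule norm_triangle_ineq)
    ultimately have "norm (x + k) \<le> ?d + norm k" by linarith
    then have "(norm (x + k))\<^sup>2 \<le> (?d + norm k)\<^sup>2" by (simp add: power_mono)
    also have "\<dots> \<le> 2 * ?d\<^sup>2 + 2 * (norm k)\<^sup>2"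
      using sum_squares_bound[of ?d "norm k"] by (simp add: power2_sum)
    finally have "a * (norm (x + k))\<^sup>2 \<le> a * (2 * ?d\<^sup>2 + 2 * (norm k)\<^sup>2)"
      using assms by (intro mult_left_mono) auto
    then have "- a * (norm k)\<^sup>2 \<le> a * ?d\<^sup>2 + - (norm (x + k))\<^sup>2 / (4 * ?t)"
      using assms by (simp add: field_simps)
    then have "exp (- a * (norm k)\<^sup>2) \<le> exp (a * ?d\<^sup>2) * exp (- (norm (x + k))\<^sup>2 / (4 * ?t))"
      by (simp only: exp_add[symmetric] exp_le_cancel_iff)
    also have "\<dots> = C * gauss ?t (x + k)"
      using assms by (simp add: C_def gauss_def)
    finally show ?thesis .
  qed
  define S where "S = (\<integral>\<^sup>+k. ennreal (exp (- a * (norm k)\<^sup>2)) \<partial>count_space (int_lattice :: (real ^ 'n) set))"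
  have "S * emeasure lborel (unit_cell :: (real ^ 'n) set) = (\<integral>\<^sup>+x. S * indicator (unit_cell :: (real ^ 'n) set) x \<partial>lborel)"
    by (simp add: nn_integral_cmult)
  also have "\<dots> \<le> (\<integral>\<^sup>+x. (\<integral>\<^sup>+k. ennreal (C * gauss ?t (x + k)) \<partial>count_space (int_lattice :: (real ^ 'n) set)) *
      indicator unit_cell x \<partial>lborel)"
    unfolding S_def by (intro nn_integral_mono) (use le in \<open>auto simp: indicator_def intro!: nn_integral_mono ennreal_leI\<close>)
  also have "\<dots> = (\<integral>\<^sup>+x. ennreal (C * gauss ?t (x :: real ^ 'n)) \<partial>lborel)"
    by (rule nn_integral_unfold[symmetric]) measurable
  also have "\<dots> = C"
    using C nn_integral_gauss[OF t, where 'n = 'n] by (simp add: ennreal_mult' nn_integral_cmult)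
  finally have "S < \<top>"
    by (simp add: emeasure_unit_cell)  (metis ennreal_less_top le_less_trans)
  then have "integrable (count_space int_lattice) (\<lambda>k :: real ^ 'n. exp (- a * (norm k)\<^sup>2))"
    by (intro integrableI_bounded) (simp_all add: S_def)
  then have "Infinite_Sum.abs_summable_on (\<lambda>k :: real ^ 'n. exp (- a * (norm k)\<^sup>2)) int_lattice"
    by (simp only: abs_summable_equivalent Infinite_Set_Sum.abs_summable_on_def)
  then show ?thesis by (rule abs_summable_summable)
qed

text \<open>Half of the quadratic exponent is given up to absorb the shift by y. The majorant is
  uniform on balls, which yields both summability at a point and the Weierstrass test behind
  continuity of the kernel.\<close>

lemma gauss_translate_le:
  assumes "\<tau> > 0" "norm y \<le> r"
  shows "gauss \<tau> (y + k :: real ^ 'n::finite) \<le> (4 * pi * \<tau>) powr (- real CARD('n) / 2) * exp (r\<^sup>2 / (4 * \<tau>))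
    * exp (- (1 / (8 * \<tau>)) * (norm k)\<^sup>2)"
proof -
  have "norm k \<le> norm (y + k) + norm y" using norm_triangle_ineq4[of "y + k" y] by simp
  then have "norm k \<le> norm (y + k) + r" using assms(2) by linarith
  then have "(norm k)\<^sup>2 \<le> (norm (y + k) + r)\<^sup>2" by (simp add: power_mono)
  also have "\<dots> \<le> 2 * (norm (y + k))\<^sup>2 + 2 * r\<^sup>2"
    using sum_squares_bound[of "norm (y + k)" r] by (simp add: power2_sum)
  finally have "- (norm (y + k))\<^sup>2 / (4 * \<tau>) \<le> r\<^sup>2 / (4 * \<tau>) + - (1 / (8 * \<tau>)) * (norm k)\<^sup>2"
    using assms(1) by (simp add: field_simps)
  then have "exp (- (norm (y + k))\<^sup>2 / (4 * \<tau>)) \<le> exp (r\<^sup>2 / (4 * \<tau>)) * exp (- (1 / (8 * \<tau>)) * (norm k)\<^sup>2)"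
    by (simp only: exp_add[symmetric] exp_le_cancel_iff)
  then show ?thesis unfolding gauss_def mult.assoc by (intro mult_left_mono) auto
qed

lemma summable_on_gauss:
  assumes "\<tau> > 0"
  shows "(\<lambda>k. gauss \<tau> (y + k :: real ^ 'n::finite)) summable_on int_lattice"
proof (rule summable_on_comparison_test)
  show "(\<lambda>k :: real ^ 'n. (4 * pi * \<tau>) powr (- real CARD('n) / 2) * exp ((norm y)\<^sup>2 / (4 * \<tau>))
    * exp (- (1 / (8 * \<tau>)) * (norm k)\<^sup>2)) summable_on int_lattice"
    using assms by (intro summable_on_cmult_right summable_on_lattice_exp) auto
qed (use assms gauss_translate_le[OF assms, of y "norm y"] gauss_pos[OF assms] in \<open>auto intro: less_imp_le\<close>)

lemma heat_kernel_abs: "heat_kernel \<tau> (abs_torus y) = (\<Sum>\<^sub>\<infinity>k\<in>int_lattice. gauss \<tau> (y + k))"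
  by (simp add: heat_kernel.abs_eq gauss_def infsum_cmult_right')

lemma continuous_heat_kernel:
  assumes "\<tau> > 0"
  shows "continuous_on UNIV (heat_kernel \<tau> :: 'n::finite torus \<Rightarrow> real)"
  unfolding continuous_on_torus_iff heat_kernel_abs
proof -
  have "continuous_on (ball 0 r) (\<lambda>y. \<Sum>\<^sub>\<infinity>k\<in>int_lattice. gauss \<tau> (y + k :: real ^ 'n))" for r
  proof (rule uniform_limit_theorem)
    show "uniform_limit (ball 0 r) (\<lambda>X y. \<Sum>k\<in>X. gauss \<tau> (y + k :: real ^ 'n))
        (\<lambda>y. \<Sum>\<^sub>\<infinity>k\<in>int_lattice. gauss \<tau> (y + k)) (finite_subsets_at_top int_lattice)"
    proof (rule Weierstrass_m_test_general)
      show "(\<lambda>k :: real ^ 'n. (4 * pi * \<tau>) powr (- real CARD('n) / 2) * exp (r\<^sup>2 / (4 * \<tau>))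
        * exp (- (1 / (8 * \<tau>)) * (norm k)\<^sup>2)) summable_on int_lattice"
        using assms by (intro summable_on_cmult_right summable_on_lattice_exp) auto
      fix k y :: "real ^ 'n" assume "y \<in> ball 0 r"
      then show "norm (gauss \<tau> (y + k)) \<le> (4 * pi * \<tau>) powr (- real CARD('n) / 2) * exp (r\<^sup>2 / (4 * \<tau>))
        * exp (- (1 / (8 * \<tau>)) * (norm k)\<^sup>2)"
        using gauss_translate_le[OF assms, of y r k] gauss_pos[OF assms, of "y + k"] by simp
    qed
  qed (auto intro!: always_eventually continuous_intros)
  then have "continuous_on (\<Union>r. ball 0 r) (\<lambda>y. \<Sum>\<^sub>\<infinity>k\<in>int_lattice. gauss \<tau> (y + k :: real ^ 'n))"
    by (intro continuous_on_open_UN) auto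
  moreover have "(\<Union>r. ball (0 :: real ^ 'n) r) = UNIV"
    by (auto intro: gt_ex)
  ultimately show "continuous_on UNIV (\<lambda>y. \<Sum>\<^sub>\<infinity>k\<in>int_lattice. gauss \<tau> (y + k :: real ^ 'n))" by simp
qed

lemma heat_kernel_pos:
  assumes "\<tau> > 0" shows "heat_kernel \<tau> z > 0"
proof -
  obtain y where y: "z = abs_torus y" by (rule torus_exhaust)
  have "0 < gauss \<tau> (y + 0)" by (rule gauss_pos[OF assms])
  also have "\<dots> = (\<Sum>\<^sub>\<infinity>k\<in>{0}. gauss \<tau> (y + k))" by simp
  also have "\<dots> \<le> (\<Sum>\<^sub>\<infinity>k\<in>int_lattice. gauss \<tau> (y + k))"
    by (intro infsum_mono_neutral summable_on_gauss assms)
       (auto simp: int_lattice_0 less_imp_le[OF gauss_pos[OF assms]])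
  finally show ?thesis by (simp add: y heat_kernel_abs)
qed

text \<open>Unfolding read backwards: the cell integral of the lattice sum is the integral of a
  single Gaussian over the whole space.\<close>

lemma nn_integral_heat_kernel:
  assumes "\<tau> > 0"
  shows "(\<integral>\<^sup>+z. ennreal (heat_kernel \<tau> (x - z)) \<partial>torus_lebesgue) = 1"
proof -
  obtain y where y: "x = abs_torus y" by (rule torus_exhaust)
  have m [measurable]: "(\<lambda>z. heat_kernel \<tau> (x - z)) \<in> borel_measurable borel"
    by (intro borel_measurable_continuous_onI continuous_on_compose2[OF continuous_heat_kernel[OF assms]]
       continuous_on_compose2[OF continuous_on_torus_diff, of _ "\<lambda>z. (x, z)", simplified] continuous_intros) auto
  \<comment> \<open>Replacing k by -k puts the sum into the form h (z + k) that the unfolding lemma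
    expects.\<close>
  have sym: "heat_kernel \<tau> (x - abs_torus z) = (\<Sum>\<^sub>\<infinity>k\<in>int_lattice. gauss \<tau> (y - (z + k)))" for z
  proof -
    have "bij_betw uminus (int_lattice :: (real ^ 'a) set) int_lattice"
      by (rule bij_betwI[where g = uminus]) (auto intro: int_lattice_minus)
    from infsum_reindex_bij_betw[OF this, of "\<lambda>k. gauss \<tau> (y - z + k)"]
    show ?thesis by (simp add: y abs_torus_diff[symmetric] heat_kernel_abs algebra_simps)
  qed
  have "(\<integral>\<^sup>+z. ennreal (heat_kernel \<tau> (x - z)) \<partial>torus_lebesgue) =
     (\<integral>\<^sup>+z. ennreal (heat_kernel \<tau> (x - abs_torus z)) * indicator unit_cell z \<partial>lborel)"
    by (rule nn_integral_torus) measurable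
  also have "\<dots> = (\<integral>\<^sup>+z. (\<integral>\<^sup>+k. ennreal (gauss \<tau> (y - (z + k))) \<partial>count_space int_lattice) * indicator unit_cell z \<partial>lborel)"
  proof (intro nn_integral_cong arg_cong2[where f = "(*)"] refl)
    fix z :: "real ^ 'a"
    have "gauss \<tau> (y - (z + k)) = gauss \<tau> ((z - y) + k)" for k
      using gauss_minus[of \<tau> "y - (z + k)"] by (simp add: algebra_simps)
    then have "(\<lambda>k. gauss \<tau> (y - (z + k))) summable_on int_lattice"
      using summable_on_gauss[OF assms, of "z - y"] by simp
    then show "ennreal (heat_kernel \<tau> (x - abs_torus z)) =
        (\<integral>\<^sup>+k. ennreal (gauss \<tau> (y - (z + k))) \<partial>count_space int_lattice)"
      unfolding sym by (intro nn_integral_count_space_infsum[symmetric]) (auto simp: less_imp_le[OF gauss_pos[OF assms]])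
  qed
  also have "\<dots> = (\<integral>\<^sup>+z. ennreal (gauss \<tau> (y - z)) \<partial>lborel)"
    by (rule nn_integral_unfold[symmetric]) measurable
  also have "\<dots> = (\<integral>\<^sup>+z. ennreal (gauss \<tau> (z - y)) \<partial>lborel)"
    using gauss_minus[of \<tau> "y - z" for z] by simp
  also have "\<dots> = (\<integral>\<^sup>+z. ennreal (gauss \<tau> (z - y)) \<partial>distr lborel borel ((+) y))"
    by (simp add: lborel_distr_plus)
  also have "\<dots> = 1"
    by (subst nn_integral_distr) (auto simp: nn_integral_gauss[OF assms])
  finally show ?thesis .
qed

interpretation torus_lebesgue: prob_space "torus_lebesgue :: 'n::finite torus measure"
  by (rule prob_space_torus_lebesgue)

text \<open>The preimage of a null open set is periodic and null on the cell, hence null in the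
  whole space, and an open Lebesgue null set is empty. This is what makes integrals of nontrivial
  nonnegative continuous functions strictly positive.\<close>

lemma torus_lebesgue_full_support:
  fixes U :: "'n::finite torus set"
  assumes "open U" "emeasure torus_lebesgue U = 0"
  shows "U = {}"
proof -
  let ?V = "abs_torus -` U"
  have [measurable]: "U \<in> sets borel" "?V \<in> sets borel"
    using assms by (auto simp: open_torus_iff)
  have "(\<integral>\<^sup>+z. indicator U z \<partial>torus_lebesgue) = 0"
    using assms(2) by (simp add: sets_torus_lebesgue)
  moreover have "indicator U (abs_torus x) = (indicator ?V x :: ennreal)" for x
    by (simp add: indicator_def)
  ultimately have z: "(\<integral>\<^sup>+x. indicator ?V x * indicator unit_cell x \<partial>lborel) = 0"
    using nn_integral_torus[of "indicator U"] by simp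
  have "(\<integral>\<^sup>+x. indicator ?V x \<partial>lborel) = 
    (\<integral>\<^sup>+x. (\<integral>\<^sup>+k. indicator ?V (x + k) \<partial>count_space int_lattice) * indicator unit_cell x \<partial>lborel)"
    by (rule nn_integral_unfold) measurable
  also have "\<dots> = 0"
  proof -
    have per: "indicator ?V (x + k) = (indicator ?V x :: ennreal)" if "k \<in> int_lattice" for x k
    proof -
      have "abs_torus (x + k) = abs_torus x" using that by (simp add: abs_torus_eq_iff)
      then show ?thesis by (simp add: indicator_def)
    qed
    have "(\<integral>\<^sup>+x. (\<integral>\<^sup>+k. indicator ?V (x + k) \<partial>count_space int_lattice) * indicator unit_cell x \<partial>lborel) =
      (\<integral>\<^sup>+x. (\<integral>\<^sup>+k. 1 \<partial>count_space (int_lattice :: (real ^ 'n) set)) * (indicator ?V x * indicator unit_cell x) \<partial>lborel)"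
    proof (rule nn_integral_cong)
      fix x
      have "(\<integral>\<^sup>+k. indicator ?V (x + k) \<partial>count_space int_lattice) =
          (\<integral>\<^sup>+k. 1 * indicator ?V x \<partial>count_space (int_lattice :: (real ^ 'n) set))"
        by (rule nn_integral_cong) (simp add: per)
      also have "\<dots> = (\<integral>\<^sup>+k. 1 \<partial>count_space (int_lattice :: (real ^ 'n) set)) * indicator ?V x"
        by (rule nn_integral_multc) simp
      finally show "(\<integral>\<^sup>+k. indicator ?V (x + k) \<partial>count_space int_lattice) * indicator unit_cell x =
          (\<integral>\<^sup>+k. 1 \<partial>count_space (int_lattice :: (real ^ 'n) set)) * (indicator ?V x * indicator unit_cell x)"
        by (simp add: mult.assoc)
    qed
    \<comment> \<open>The count of lattice points is infinite; the product is 0 by the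
      \<open>ennreal\<close> convention for infinity times 0.\<close>
    also have "\<dots> = (\<integral>\<^sup>+k. 1 \<partial>count_space (int_lattice :: (real ^ 'n) set)) * 0"
      by (subst nn_integral_cmult) (auto simp: z simp del: nn_integral_const)
    finally show ?thesis by simp
  qed
  finally have "emeasure lborel ?V = 0" by simp
  moreover have "open ?V" using assms by (simp add: open_torus_iff)
  moreover have "?V \<in> null_sets lebesgue"
    by (rule null_sets_completionI) (use \<open>emeasure lborel ?V = 0\<close> in \<open>auto intro: null_setsI\<close>)
  ultimately have V: "?V = {}"
    using open_not_negligible[of ?V] by (auto simp: negligible_iff_null_sets)
  show ?thesis
  proof (rule equals0I)
    fix x assume "x \<in> U"
    obtain y where "x = abs_torus y" by (rule torus_exhaust)
    then show False using V \<open>x \<in> U\<close> by auto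
  qed
qed

lemma measure_torus_lebesgue_UNIV [simp]: "measure torus_lebesgue UNIV = 1"
  using torus_lebesgue.prob_space by simp

lemma torus_bounded:
  fixes f :: "'n::finite torus \<Rightarrow> real"
  assumes "continuous_on UNIV f"
  obtains B where "B > 0" "\<And>x. \<bar>f x\<bar> \<le> B"
proof -
  have "bounded (range f)"
    using compact_continuous_image[OF assms compact_UNIV_torus] by (rule compact_imp_bounded)
  then show ?thesis using that unfolding bounded_pos by auto
qed

lemma integrable_bounded_real:
  fixes f :: "'a \<Rightarrow> real"
  assumes "prob_space M" "f \<in> borel_measurable M" "\<And>x. \<bar>f x\<bar> \<le> B"
  shows "integrable M f"
proof -
  interpret prob_space M by fact
  show ?thesis using assms by (intro integrable_const_bound[of _ B]) auto
qed

lemma integrable_torus: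
  fixes f :: "'n::finite torus \<Rightarrow> real"
  assumes "prob_space M" "sets M = sets borel" "continuous_on UNIV f"
  shows "integrable M f"
proof -
  obtain B where "\<And>x. \<bar>f x\<bar> \<le> B" using torus_bounded[OF assms(3)] by blast
  moreover have "f \<in> borel_measurable M"
    using borel_measurable_continuous_onI[OF assms(3)] by (simp add: measurable_cong_sets[OF assms(2) refl])
  ultimately show ?thesis using assms(1) by (intro integrable_bounded_real)
qed

lemma heat_kernel_diff_uniform:
  assumes "\<tau> > 0" "e > 0"
  obtains d where "d > 0" "\<And>x y z w :: 'n::finite torus. dist x y < d \<Longrightarrow> dist z w < d \<Longrightarrow>
    \<bar>heat_kernel \<tau> (x - z) - heat_kernel \<tau> (y - w)\<bar> < e"
proof -
  have "continuous_on UNIV (\<lambda>(x :: 'n torus, z). heat_kernel \<tau> (x - z))"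
    unfolding case_prod_beta
    by (rule continuous_on_compose2[OF continuous_heat_kernel[OF assms(1)]])
       (use continuous_on_torus_diff in \<open>auto simp: case_prod_beta\<close>)
  moreover have "compact (UNIV :: ('n torus \<times> 'n torus) set)"
    using compact_Times[OF compact_UNIV_torus compact_UNIV_torus] by simp
  ultimately have "uniformly_continuous_on UNIV (\<lambda>(x :: 'n torus, z). heat_kernel \<tau> (x - z))"
    by (rule compact_uniformly_continuous)
  then obtain d where d: "d > 0" and D: "\<And>p p' :: 'n torus \<times> 'n torus. dist p' p < d \<Longrightarrow>
      dist (case p' of (x, z) \<Rightarrow> heat_kernel \<tau> (x - z)) (case p of (x, z) \<Rightarrow> heat_kernel \<tau> (x - z)) < e"
    using assms(2) unfolding uniformly_continuous_on_def by (metis UNIV_I)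
  show ?thesis
  proof (rule that[of "d / 2"])
    fix x y z w :: "'n torus"
    assume "dist x y < d / 2" "dist z w < d / 2"
    then have "dist (x, z) (y, w) < d"
      using sqrt_sum_squares_le_sum[of "dist x y" "dist z w"] by (simp add: dist_Pair_Pair)
    from D[OF this] show "\<bar>heat_kernel \<tau> (x - z) - heat_kernel \<tau> (y - w)\<bar> < e"
      by (simp add: dist_real_def)
  qed (use d in simp)
qed

lemma continuous_on_heat_kernel_diff:
  assumes "\<tau> > 0"
  shows "continuous_on UNIV (\<lambda>x. heat_kernel \<tau> (x - z))" "continuous_on UNIV (\<lambda>x. heat_kernel \<tau> (z - x))"
  by (auto intro!: continuous_on_compose2[OF continuous_heat_kernel[OF assms]]
     continuous_on_compose2[OF continuous_on_torus_diff, of _ "\<lambda>x. (x, z)", simplified]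
     continuous_on_compose2[OF continuous_on_torus_diff, of _ "\<lambda>x. (z, x)", simplified] continuous_intros)

lemma heat_kernel_bounds:
  assumes "\<tau> > 0"
  obtains \<delta> M where "\<delta> > 0" "\<delta> \<le> 1" "M > 0" "\<And>z :: 'n::finite torus. \<delta> \<le> heat_kernel \<tau> z" "\<And>z :: 'n torus. heat_kernel \<tau> z \<le> M"
proof -
  have "\<exists>x\<in>UNIV. \<forall>z\<in>UNIV. heat_kernel \<tau> (x :: 'n torus) \<le> heat_kernel \<tau> (z :: 'n torus)"
    by (rule continuous_attains_inf[OF compact_UNIV_torus UNIV_not_empty continuous_heat_kernel[OF assms]])
  then obtain x :: "'n torus" where x: "\<And>z :: 'n torus. heat_kernel \<tau> x \<le> heat_kernel \<tau> z" by blast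
  obtain M where "M > 0" "\<And>z :: 'n torus. \<bar>heat_kernel \<tau> z\<bar> \<le> M"
    using torus_bounded[OF continuous_heat_kernel[OF assms, where 'n = 'n]] by blast
  then have "M > 0" "\<And>z :: 'n torus. heat_kernel \<tau> z \<le> M" by (auto simp: abs_le_iff)
  \<comment> \<open>The cap at 1 gives \<open>\<delta> \<le> 1\<close> at once, so that the
    contraction factor 1 - \<delta> is nonnegative.\<close>
  moreover have "min 1 (heat_kernel \<tau> x) > 0" using heat_kernel_pos[OF assms] by simp
  ultimately show ?thesis using that[of "min 1 (heat_kernel \<tau> x)" M] x by (meson min.cobounded1 min.cobounded2 order_trans)
qed

lemma integral_heat_kernel:
  assumes "\<tau> > 0"
  shows "(\<integral>z. heat_kernel \<tau> (x - z) \<partial>torus_lebesgue) = 1"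
proof -
  have "ennreal (\<integral>z. heat_kernel \<tau> (x - z) \<partial>torus_lebesgue) = (\<integral>\<^sup>+z. ennreal (heat_kernel \<tau> (x - z)) \<partial>torus_lebesgue)"
    by (intro nn_integral_eq_integral[symmetric] integrable_torus prob_space_torus_lebesgue sets_torus_lebesgue
        continuous_on_heat_kernel_diff assms AE_I2 less_imp_le heat_kernel_pos)
  then show ?thesis using nn_integral_heat_kernel[OF assms] by (metis ennreal_eq_1)
qed

lemma integrable_torus_lebesgue:
  "continuous_on UNIV f \<Longrightarrow> integrable torus_lebesgue (f :: 'n::finite torus \<Rightarrow> real)"
  by (intro integrable_torus prob_space_torus_lebesgue sets_torus_lebesgue)

lemma integrable_heat_kernel_mult:
  assumes "\<tau> > 0" "continuous_on UNIV u"
  shows "integrable torus_lebesgue (\<lambda>z. heat_kernel \<tau> (x - z) * u z)"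
  by (intro integrable_torus_lebesgue continuous_intros continuous_on_heat_kernel_diff assms)

text \<open>The operator \<open>u \<mapsto> \<eta>\<^sup>\<tau> * u - \<delta> \<integral> u\<close> has the nonnegative kernel \<open>\<eta>\<^sup>\<tau> - \<delta>\<close> of total mass \<open>1 - \<delta>\<close>.\<close>

lemma heat_conv_contraction:
  fixes u v :: "'n::finite torus \<Rightarrow> real"
  assumes "\<tau> > 0" "continuous_on UNIV u" "continuous_on UNIV v" "\<And>z. u z - v z \<le> B"
    and \<delta>: "\<And>z :: 'n torus. \<delta> \<le> heat_kernel \<tau> z"
  shows "heat_conv \<tau> u y - heat_conv \<tau> v y - \<delta> * (\<integral>z. u z \<partial>torus_lebesgue) + \<delta> * (\<integral>z. v z \<partial>torus_lebesgue)
    \<le> (1 - \<delta>) * B"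
proof -
  note [simp] = integrable_heat_kernel_mult[OF assms(1)] integrable_torus_lebesgue
  have [simp]: "integrable torus_lebesgue (\<lambda>z. heat_kernel \<tau> (y - z))"
    by (intro integrable_torus_lebesgue continuous_on_heat_kernel_diff assms)
  have "heat_conv \<tau> u y - heat_conv \<tau> v y - \<delta> * (\<integral>z. u z \<partial>torus_lebesgue) + \<delta> * (\<integral>z. v z \<partial>torus_lebesgue) =
      (\<integral>z. (heat_kernel \<tau> (y - z) - \<delta>) * (u z - v z) \<partial>torus_lebesgue)"
    using assms(2,3) by (simp add: heat_conv_def left_diff_distrib right_diff_distrib)
  also have "\<dots> \<le> (\<integral>z. (heat_kernel \<tau> (y - z) - \<delta>) * B \<partial>torus_lebesgue)"
    using assms by (intro integral_mono integrable_torus_lebesgue continuous_intros continuous_on_heat_kernel_diff mult_left_mono) auto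
  also have "\<dots> = (1 - \<delta>) * B"
    using integral_heat_kernel[OF assms(1), of y] by simp
  finally show ?thesis .
qed

lemma heat_conv_le:
  fixes u v :: "'n::finite torus \<Rightarrow> real"
  assumes "\<tau> > 0" "continuous_on UNIV u" "continuous_on UNIV v" "\<And>z. u z - v z \<le> B"
  shows "heat_conv \<tau> u y - heat_conv \<tau> v y \<le> B"
  \<comment> \<open>The case \<delta> = 0 of the contraction estimate.\<close>
  using heat_conv_contraction[OF assms less_imp_le[OF heat_kernel_pos[OF assms(1)]], of y] by simp

lemma heat_conv_const: 
  assumes "\<tau> > 0" shows "heat_conv \<tau> (\<lambda>_. c) y = c"
  using integral_heat_kernel[OF assms, of y] by (simp add: heat_conv_def)

lemma abs_heat_conv_le:
  assumes "\<tau> > 0" "continuous_on UNIV u" "\<And>x. \<bar>u x\<bar> \<le> B"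
  shows "\<bar>heat_conv \<tau> u y\<bar> \<le> B"
  using heat_conv_le[OF assms(1,2), of "\<lambda>_. 0" B y] heat_conv_le[OF assms(1) _ assms(2), of "\<lambda>_. 0" B y]
    assms(3) heat_conv_const[OF assms(1), of 0 y]
  by (simp add: abs_le_iff)

lemma continuous_heat_conv:
  fixes u :: "'n::finite torus \<Rightarrow> real"
  assumes "\<tau> > 0" "continuous_on UNIV u"
  shows "continuous_on UNIV (heat_conv \<tau> u)"
  unfolding continuous_on_iff
proof (intro ballI allI impI)
  fix x :: "'n torus" and e :: real assume e: "e > 0"
  obtain B where B: "B > 0" "\<And>x. \<bar>u x\<bar> \<le> B" using torus_bounded[OF assms(2)] by blast
  obtain d where d: "d > 0" "\<And>x y z w :: 'n torus. dist x y < d \<Longrightarrow> dist z w < d \<Longrightarrow>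
    \<bar>heat_kernel \<tau> (x - z) - heat_kernel \<tau> (y - w)\<bar> < e / (2 * B)"
    using heat_kernel_diff_uniform[OF assms(1), of "e / (2 * B)"] e B by (metis divide_pos_pos mult_pos_pos zero_less_numeral)
  have "dist (heat_conv \<tau> u y) (heat_conv \<tau> u x) < e" if "dist y x < d" for y
  proof -
    have "heat_conv \<tau> u y - heat_conv \<tau> u x = (\<integral>z. (heat_kernel \<tau> (y - z) - heat_kernel \<tau> (x - z)) * u z \<partial>torus_lebesgue)"
      using integrable_heat_kernel_mult[OF assms] by (simp add: heat_conv_def algebra_simps)
    then have "\<bar>heat_conv \<tau> u y - heat_conv \<tau> u x\<bar> \<le> (\<integral>z. \<bar>(heat_kernel \<tau> (y - z) - heat_kernel \<tau> (x - z)) * u z\<bar> \<partial>torus_lebesgue)"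
      by (simp add: integral_abs_bound)
    also have "\<dots> \<le> (\<integral>z. e / (2 * B) * B \<partial>(torus_lebesgue :: 'n torus measure))"
    proof (rule integral_mono)
      show "integrable torus_lebesgue (\<lambda>z. \<bar>(heat_kernel \<tau> (y - z) - heat_kernel \<tau> (x - z)) * u z\<bar>)"
        by (intro integrable_torus_lebesgue continuous_intros continuous_on_heat_kernel_diff assms)
      fix z
      show "\<bar>(heat_kernel \<tau> (y - z) - heat_kernel \<tau> (x - z)) * u z\<bar> \<le> e / (2 * B) * B"
        unfolding abs_mult using d(2)[of y x z z] that d(1) B e by (intro mult_mono) (auto simp: less_imp_le)
    qed simp
    also have "\<dots> < e" using B e by simp
    finally show ?thesis by (simp add: dist_real_def)
  qed
  then show "\<exists>d>0. \<forall>y\<in>UNIV. dist y x < d \<longrightarrow> dist (heat_conv \<tau> u y) (heat_conv \<tau> u x) < e" using d(1) by blast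
qed

section \<open>Uniform coercivity of the Lagrangian\<close>

lemma continuous_tonelli:
  assumes "tonelli_lagrangian L"
  shows "continuous_on UNIV (\<lambda>(x, q). L x q)"
proof -
  have "Ck_on 0 UNIV (\<lambda>(x, q). L (abs_torus x) q)"
    using assms unfolding tonelli_lagrangian_def smooth_on_def by blast
  then show ?thesis by (simp add: continuous_on_torus_times_iff)
qed

text \<open>Smoothness is given for the lifted function of both variables, while
  \<open>hessian\<close> differentiates the slice \<open>L x\<close>; the chain rule along p
  \<mapsto> (y, p) connects the two.\<close>

lemma tonelli_slice_derivative:
  assumes "tonelli_lagrangian L"
  shows "(L (abs_torus y) has_derivative
    (\<lambda>v. frechet_derivative (\<lambda>(x, q). L (abs_torus x) q) (at (y, p)) (0, v))) (at p)"
proof -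
  define l where "l = (\<lambda>(x, q). L (abs_torus x) q)"
  have "Ck_on 1 UNIV l"
    using assms unfolding l_def tonelli_lagrangian_def smooth_on_def by blast
  then have "(l has_derivative frechet_derivative l (at (y, p))) (at (y, p))"
    by (simp add: frechet_derivative_works)
  moreover have "((\<lambda>p. (y, p)) has_derivative (\<lambda>v. (0, v))) (at p)"
    by (auto intro!: derivative_eq_intros)
  ultimately have "(l \<circ> (\<lambda>p. (y, p)) has_derivative frechet_derivative l (at (y, p)) \<circ> (\<lambda>v. (0, v))) (at p)"
    by (intro diff_chain_at) auto
  then show ?thesis by (simp add: o_def l_def)
qed

text \<open>Second order Taylor expansion along the segment from 0 to q with Lagrange remainder; the
  Hessian bound estimates the remainder.\<close>

lemma tonelli_taylor:
  fixes L :: "'n::finite torus \<Rightarrow> real ^ 'n \<Rightarrow> real"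
  assumes L: "tonelli_lagrangian L"
    and c: "\<And>x q v. v \<bullet> (hessian (L x) q *v v) \<ge> c * (v \<bullet> v)"
  shows "L x q \<ge> L x 0 + frechet_derivative (L x) (at 0) q + c / 2 * (q \<bullet> q)"
proof -
  let ?l = "\<lambda>(x, q). L (abs_torus x) q"
  obtain y where y: "x = abs_torus y" by (rule torus_exhaust)
  have C2: "Ck_on 2 UNIV ?l"
    using L unfolding tonelli_lagrangian_def smooth_on_def by blast
  have d1: "(L x has_derivative (\<lambda>v. frechet_derivative ?l (at (y, p)) (0, v))) (at p)" for p
    unfolding y by (rule tonelli_slice_derivative[OF L])
  then have fd1: "frechet_derivative (L x) (at p) = (\<lambda>v. frechet_derivative ?l (at (y, p)) (0, v))" for p
    by (metis frechet_derivative_at)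
  have d1': "(L x has_derivative frechet_derivative (L x) (at p)) (at p)" for p
    using d1 fd1 by simp
  define D where "D j p = frechet_derivative (L x) (at p) (axis j 1)" for j p
  have d2: "(D j has_derivative frechet_derivative (D j) (at p)) (at p)" for j p
  proof -
    let ?b = "(0, axis j 1) :: (real ^ 'n) \<times> (real ^ 'n)"
    have "?b \<in> Basis" by (auto simp: Basis_prod_def Basis_vec_def)
    then have "(\<lambda>w. frechet_derivative ?l (at w) ?b) differentiable at (y, p)"
      using C2 by (simp add: numeral_2_eq_2)
    then have "(\<lambda>w. frechet_derivative ?l (at w) ?b) \<circ> (\<lambda>p. (y, p)) differentiable at p"
      by (intro differentiable_chain_at) (auto simp: differentiable_def intro!: derivative_eq_intros exI)
    moreover have "(\<lambda>w. frechet_derivative ?l (at w) ?b) \<circ> (\<lambda>p. (y, p)) = D j"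
      by (auto simp: D_def fd1)
    ultimately show ?thesis by (simp add: frechet_derivative_works)
  qed
  have lin: "f q = (\<Sum>j\<in>UNIV. q $ j * f (axis j 1))" if "linear f" for f :: "real ^ 'n \<Rightarrow> real" and q
  proof -
    have "f q = f (\<Sum>j\<in>UNIV. (q $ j) *\<^sub>R axis j 1)" using basis_expansion[of q] by (simp add: scalar_mult_eq_scaleR)
    then show ?thesis using that by (simp add: linear_sum linear_scale)
  qed
  have hess: "hessian (L x) p $ i $ j = frechet_derivative (D j) (at p) (axis i 1)" for p i j
  proof -
    have "D j = (\<lambda>p. frechet_derivative (L x) (at p) (axis j 1))" by (auto simp: D_def)
    then show ?thesis by (simp add: hessian_def)
  qed
  \<comment> \<open>The values for m = 0, 1, 2 are t \<mapsto> L x (t q) and its first two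
    derivatives, in the shape that \<open>Maclaurin\<close> takes.\<close>
  define g where "g m t = (if m = 0 then L x (t *\<^sub>R q) else if m = 1 then (\<Sum>j\<in>UNIV. q $ j * D j (t *\<^sub>R q))
     else q \<bullet> (hessian (L x) (t *\<^sub>R q) *v q))" for m :: nat and t :: real
  have line: "((\<lambda>t. t *\<^sub>R q) has_derivative (\<lambda>s. s *\<^sub>R q)) (at t)" for t
    by (auto intro!: derivative_eq_intros)
  have g0: "(g 0 has_real_derivative g 1 t) (at t)" for t
  proof -
    have "(L x \<circ> (\<lambda>t. t *\<^sub>R q) has_derivative frechet_derivative (L x) (at (t *\<^sub>R q)) \<circ> (\<lambda>s. s *\<^sub>R q)) (at t)"
      by (rule diff_chain_at[OF line d1'])
    moreover have "frechet_derivative (L x) (at (t *\<^sub>R q)) \<circ> (\<lambda>s. s *\<^sub>R q) = (*) (g 1 t)"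
    proof
      fix s
      have l: "linear (frechet_derivative (L x) (at (t *\<^sub>R q)))" using d1' by (rule has_derivative_linear)
      show "(frechet_derivative (L x) (at (t *\<^sub>R q)) \<circ> (\<lambda>s. s *\<^sub>R q)) s = g 1 t * s"
        using lin[OF l, of q] by (simp add: linear_scale[OF l] g_def D_def)
    qed
    moreover have "L x \<circ> (\<lambda>t. t *\<^sub>R q) = g 0" by (auto simp: g_def)
    ultimately show ?thesis unfolding has_field_derivative_def by simp
  qed
  have g1: "(g 1 has_real_derivative g 2 t) (at t)" for t
  proof -
    have dj: "((\<lambda>t. D j (t *\<^sub>R q)) has_real_derivative frechet_derivative (D j) (at (t *\<^sub>R q)) q) (at t)" for j
    proof -
      have "(D j \<circ> (\<lambda>t. t *\<^sub>R q) has_derivative frechet_derivative (D j) (at (t *\<^sub>R q)) \<circ> (\<lambda>s. s *\<^sub>R q)) (at t)"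
        by (rule diff_chain_at[OF line d2])
      moreover have "linear (frechet_derivative (D j) (at (t *\<^sub>R q)))" using d2 by (rule has_derivative_linear)
      ultimately show ?thesis by (simp add: has_field_derivative_def o_def linear_scale mult.commute[of _ "frechet_derivative _ _ _"] cong: if_cong)
    qed
    have "((\<lambda>t. \<Sum>j\<in>UNIV. q $ j * D j (t *\<^sub>R q)) has_real_derivative
        (\<Sum>j\<in>UNIV. q $ j * frechet_derivative (D j) (at (t *\<^sub>R q)) q)) (at t)"
      by (rule DERIV_sum) (rule DERIV_cmult[OF dj])
    moreover have "(\<Sum>j\<in>UNIV. q $ j * frechet_derivative (D j) (at (t *\<^sub>R q)) q) = g 2 t"
    proof -
      have "q \<bullet> (hessian (L x) (t *\<^sub>R q) *v q) =
          (\<Sum>i\<in>UNIV. \<Sum>j\<in>UNIV. q $ i * (frechet_derivative (D j) (at (t *\<^sub>R q)) (axis i 1) * q $ j))"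
        by (simp add: inner_vec_def matrix_vector_mult_def hess sum_distrib_left)
      also have "\<dots> = (\<Sum>j\<in>UNIV. q $ j * (\<Sum>i\<in>UNIV. q $ i * frechet_derivative (D j) (at (t *\<^sub>R q)) (axis i 1)))"
        by (subst sum.swap) (simp add: sum_distrib_left mult_ac)
      also have "\<dots> = (\<Sum>j\<in>UNIV. q $ j * frechet_derivative (D j) (at (t *\<^sub>R q)) q)"
        by (simp add: lin[OF has_derivative_linear[OF d2], where q = q])
      finally show ?thesis by (simp add: g_def)
    qed
    moreover have "g 1 = (\<lambda>t. \<Sum>j\<in>UNIV. q $ j * D j (t *\<^sub>R q))" by (auto simp: g_def)
    ultimately show ?thesis by simp
  qed
  have "\<exists>t>0. t < 1 \<and> g 0 1 = (\<Sum>m<2. g m 0 / fact m * 1 ^ m) + g 2 t / fact 2 * 1 ^ 2"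
    using g0 g1 by (intro Maclaurin) (auto simp: less_2_cases_iff numeral_2_eq_2[symmetric])
  then obtain t where "g 0 1 = g 0 0 + g 1 0 + g 2 t / 2"
    by (auto simp: numeral_2_eq_2)
  moreover have "g 2 t \<ge> c * (q \<bullet> q)" using c by (simp add: g_def)
  moreover have "g 1 0 = frechet_derivative (L x) (at 0) q"
    by (simp add: g_def D_def lin[OF has_derivative_linear[OF d1'], where q = q])
  ultimately show ?thesis by (simp add: g_def)
qed

text \<open>The superlinearity in \<open>tonelli_lagrangian\<close> is stated for each x separately.
  A constant uniform in x comes from the quadratic lower bound of \<open>tonelli_taylor\<close>,
  whose constant and linear coefficients are bounded by compactness.\<close>

lemma tonelli_coercive:
  fixes L :: "'n::finite torus \<Rightarrow> real ^ 'n \<Rightarrow> real"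
  assumes L: "tonelli_lagrangian L" and "c > 0"
    and c: "\<And>x q v. v \<bullet> (hessian (L x) q *v v) \<ge> c * (v \<bullet> v)"
  obtains C where "\<And>x q. L x q \<ge> norm q - C"
proof -
  define l where "l = (\<lambda>(x, q). L (abs_torus x) q)"
  have C2: "Ck_on 1 UNIV l"
    using L unfolding l_def tonelli_lagrangian_def smooth_on_def by blast
  define E where "E j y = frechet_derivative l (at (y, 0)) (0, axis j 1)" for j and y :: "real ^ 'n"
  have "\<exists>B. \<forall>y\<in>cbox 0 1. \<bar>E j y\<bar> \<le> B" for j
  proof -
    have "((0, axis j 1) :: (real ^ 'n) \<times> (real ^ 'n)) \<in> Basis" by (auto simp: Basis_prod_def Basis_vec_def)
    then have "continuous_on UNIV (\<lambda>w. frechet_derivative l (at w) (0, axis j 1))"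
      using C2 by simp
    then have "continuous_on (cbox 0 1) (E j)"
      unfolding E_def by (rule continuous_on_compose2) (auto intro!: continuous_intros)
    then have "bounded (E j ` cbox 0 1)" by (intro compact_imp_bounded compact_continuous_image compact_cbox)
    then show ?thesis unfolding bounded_iff by auto
  qed
  then obtain B where B: "\<And>j y. y \<in> cbox 0 1 \<Longrightarrow> \<bar>E j y\<bar> \<le> B j" by metis
  define C1 where "C1 = (\<Sum>j\<in>UNIV. B j)"
  have "continuous_on UNIV (\<lambda>x. L x 0)"
    using continuous_on_compose2[OF continuous_tonelli[OF L], of UNIV "\<lambda>x. (x, 0)"] by (simp add: continuous_on_Pair continuous_on_id)
  then obtain C0 where C0: "\<And>x. \<bar>L x 0\<bar> \<le> C0" using torus_bounded by blast
  have "L x q \<ge> norm q - (C0 + (C1 + 1)\<^sup>2 / (2 * c))" for x q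
  proof -
    obtain y where y: "x = abs_torus y" "y \<in> cbox 0 1" by (rule torus_exhaust_cbox)
    have d1: "(L x has_derivative (\<lambda>v. frechet_derivative l (at (y, 0)) (0, v))) (at 0)"
      unfolding y(1) l_def by (rule tonelli_slice_derivative[OF L])
    have lin: "linear (\<lambda>v. frechet_derivative l (at (y, 0)) (0, v))"
      by (rule has_derivative_linear[OF d1])
    have "frechet_derivative (L x) (at 0) q = frechet_derivative l (at (y, 0)) (0, \<Sum>j\<in>UNIV. (q $ j) *\<^sub>R axis j 1)"
      using frechet_derivative_at[OF d1] basis_expansion[of q] by (simp add: scalar_mult_eq_scaleR fun_eq_iff)
    also have "\<dots> = (\<Sum>j\<in>UNIV. q $ j * E j y)"
      by (simp add: E_def linear_sum[OF lin] linear_scale[OF lin])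
    finally have "\<bar>frechet_derivative (L x) (at 0) q\<bar> \<le> (\<Sum>j\<in>UNIV. \<bar>q $ j * E j y\<bar>)" by simp
    also have "\<dots> \<le> (\<Sum>j\<in>UNIV. norm q * B j)"
      unfolding abs_mult using B[OF y(2)] by (intro sum_mono mult_mono component_le_norm_cart) auto
    finally have 1: "\<bar>frechet_derivative (L x) (at 0) q\<bar> \<le> norm q * C1" by (simp add: C1_def sum_distrib_left)
    \<comment> \<open>Completing the square: the quadratic term beats the slope C1 + 1, of which C1
      covers the linear Taylor term and 1 is left as the growth rate claimed.\<close>
    have "0 \<le> (c * norm q - (C1 + 1))\<^sup>2 / (2 * c)" using \<open>c > 0\<close> by simp
    also have "\<dots> = c / 2 * (norm q)\<^sup>2 - (C1 + 1) * norm q + (C1 + 1)\<^sup>2 / (2 * c)"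
      using \<open>c > 0\<close> by (simp add: power2_eq_square field_simps)
    finally show ?thesis
      using tonelli_taylor[OF L c, of x q] 1 C0[of x]
      by (simp add: power2_norm_eq_inner algebra_simps abs_le_iff)
  qed
  then show ?thesis by (rule that)
qed

section \<open>The Lax operator and the ergodic problem\<close>

locale discrete_mfg =
  fixes \<tau> c :: real and L :: "'n::finite torus \<Rightarrow> real ^ 'n \<Rightarrow> real"
  assumes tau_pos: "\<tau> > 0"
    and tonelli: "tonelli_lagrangian L"
    and c_pos: "c > 0"
    and convex: "\<And>x q v. v \<bullet> (hessian (L x) q *v v) \<ge> c * (v \<bullet> v)"
begin

definition payoff :: "('n torus \<Rightarrow> real) \<Rightarrow> 'n torus \<Rightarrow> real ^ 'n \<Rightarrow> real" where
  "payoff u x q = heat_conv \<tau> u (x + abs_torus (\<tau> *\<^sub>R q)) - \<tau> * L x q"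

lemma coercive: obtains C where "\<And>x q. L x q \<ge> norm q - C"
  using tonelli_coercive[OF tonelli c_pos convex] by blast

lemma continuous_L: "continuous_on UNIV (\<lambda>(x, q). L x q)"
  by (rule continuous_tonelli[OF tonelli])

lemma continuous_heat_conv_shift:
  assumes "continuous_on UNIV u"
  shows "continuous_on UNIV (\<lambda>(x, q). heat_conv \<tau> u (x + abs_torus (\<tau> *\<^sub>R q)))"
  using continuous_on_compose2[OF continuous_heat_conv[OF tau_pos assms] continuous_on_torus_shift[of \<tau>]]
  by (simp add: case_prod_beta)

lemma continuous_payoff:
  assumes "continuous_on UNIV u"
  shows "continuous_on UNIV (\<lambda>(x, q). payoff u x q)"
  using continuous_heat_conv_shift[OF assms] continuous_L
  unfolding payoff_def case_prod_beta by (intro continuous_intros)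

text \<open>The heat convolution of u is bounded, so a control at least as good as 0 has running
  cost at most L x 0 + 2 B / \<tau>; coercivity then confines it to a ball that does not depend on
  x.\<close>

lemma payoff_le_payoff_0:
  assumes "continuous_on UNIV u"
  obtains R where "R > 0" "\<And>x q. payoff u x 0 \<le> payoff u x q \<Longrightarrow> norm q \<le> R"
proof -
  obtain C where C: "\<And>x q. L x q \<ge> norm q - C" using coercive by blast
  obtain B where B: "\<And>x. \<bar>heat_conv \<tau> u x\<bar> \<le> B"
    using torus_bounded[OF continuous_heat_conv[OF tau_pos assms]] by blast
  have "continuous_on UNIV (\<lambda>x. L x 0)"
    using continuous_on_compose2[OF continuous_L, of UNIV "\<lambda>x. (x, 0)"]
    by (simp add: continuous_on_Pair continuous_on_id)
  then obtain B0 where B0: "\<And>x. \<bar>L x 0\<bar> \<le> B0" using torus_bounded by blast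
  define R where "R = max 1 (C + B0 + 2 * B / \<tau>)"
  have "norm q \<le> R" if "payoff u x 0 \<le> payoff u x q" for x q
  proof -
    have "\<tau> * L x q \<le> \<tau> * L x 0 + 2 * B"
      using that B[of x] B[of "x + abs_torus (\<tau> *\<^sub>R q)"]
      by (simp add: payoff_def abs_le_iff zero_torus.abs_eq[symmetric])
    then have "\<tau> * L x q / \<tau> \<le> (\<tau> * L x 0 + 2 * B) / \<tau>"
      using tau_pos by (intro divide_right_mono) auto
    then have "L x q \<le> L x 0 + 2 * B / \<tau>"
      using tau_pos by (simp add: add_divide_distrib)
    then show ?thesis using C[where x = x and q = q] B0[of x] unfolding R_def abs_le_iff by linarith
  qed
  then show ?thesis using that[of R] by (simp add: R_def)
qed

text \<open>Justifies the \<open>GREATEST\<close> in \<open>lax\<close>: the maximum over a large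
  ball is global, since controls outside the ball lose against 0.\<close>

lemma lax_attained_aux:
  assumes "continuous_on UNIV u"
  shows "\<exists>q. lax \<tau> L u x = payoff u x q \<and> (\<forall>p. payoff u x p \<le> lax \<tau> L u x)"
proof -
  obtain R where R: "R > 0" "\<And>x q. payoff u x 0 \<le> payoff u x q \<Longrightarrow> norm q \<le> R"
    using payoff_le_payoff_0[OF assms] by blast
  have "continuous_on UNIV (payoff u x)"
    using continuous_on_compose2[OF continuous_payoff[OF assms], of UNIV "\<lambda>q. (x, q)"]
    by (simp add: continuous_on_Pair continuous_on_id)
  then have "\<exists>q\<in>cball 0 R. \<forall>p\<in>cball 0 R. payoff u x p \<le> payoff u x q"
    using R(1) by (intro continuous_attains_sup) (auto intro: continuous_on_subset)
  then obtain q where q: "\<And>p. norm p \<le> R \<Longrightarrow> payoff u x p \<le> payoff u x q"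
    unfolding Bex_def Ball_def mem_cball_0 by blast
  have max: "payoff u x p \<le> payoff u x q" for p
    using R(2)[of x p] q[of p] q[of 0] R(1) by (cases "norm p \<le> R"; cases "payoff u x 0 \<le> payoff u x p") auto
  then have "lax \<tau> L u x = payoff u x q"
    unfolding lax_def payoff_def[symmetric] by (intro Greatest_equality) auto
  then show ?thesis using max by auto
qed

lemma lax_ge: "continuous_on UNIV u \<Longrightarrow> payoff u x q \<le> lax \<tau> L u x"
  using lax_attained_aux by blast

lemma lax_attained: "continuous_on UNIV u \<Longrightarrow> \<exists>q. lax \<tau> L u x = payoff u x q"
  using lax_attained_aux by blast

text \<open>All maximisers lie in one ball, over which the payoff is uniformly continuous; the
  maximiser at one point serves as competitor at a nearby one.\<close>

lemma continuous_lax: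
  assumes u: "continuous_on UNIV u"
  shows "continuous_on UNIV (lax \<tau> L u)"
  unfolding continuous_on_iff
proof (intro ballI allI impI)
  fix x :: "'n torus" and e :: real assume "e > 0"
  obtain R where R: "R > 0" "\<And>x q. payoff u x 0 \<le> payoff u x q \<Longrightarrow> norm q \<le> R"
    using payoff_le_payoff_0[OF u] by blast
  have "uniformly_continuous_on (UNIV \<times> cball 0 R) (\<lambda>(x, q). payoff u x q)"
    by (intro compact_uniformly_continuous continuous_on_subset[OF continuous_payoff[OF u]]
        compact_Times compact_UNIV_torus) auto
  then obtain d where d: "d > 0" and D: "\<And>p p'. p \<in> UNIV \<times> cball 0 R \<Longrightarrow> p' \<in> UNIV \<times> cball 0 R \<Longrightarrow>
      dist p' p < d \<Longrightarrow> dist (case p' of (x, q) \<Rightarrow> payoff u x q) (case p of (x, q) \<Rightarrow> payoff u x q) < e"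
    using \<open>e > 0\<close> unfolding uniformly_continuous_on_def by meson
  have le: "lax \<tau> L u y < lax \<tau> L u z + e" if "dist y z < d" for y z
  proof -
    obtain q where q: "lax \<tau> L u y = payoff u y q" using lax_attained[OF u] by blast
    then have "norm q \<le> R" using R(2)[of y q] lax_ge[OF u, of y 0] by simp
    then have "dist (payoff u y q) (payoff u z q) < e"
      using D[of "(z, q)" "(y, q)"] that by (simp add: dist_Pair_Pair)
    then show ?thesis using lax_ge[OF u, of z q] q by (simp add: dist_real_def)
  qed
  show "\<exists>d>0. \<forall>y\<in>UNIV. dist y x < d \<longrightarrow> dist (lax \<tau> L u y) (lax \<tau> L u x) < e"
  proof (intro exI conjI ballI impI)
    fix y assume "dist y x < d"
    then have "lax \<tau> L u y < lax \<tau> L u x + e" "lax \<tau> L u x < lax \<tau> L u y + e"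
      using le[of y x] le[of x y] by (simp_all add: dist_commute)
    then show "dist (lax \<tau> L u y) (lax \<tau> L u x) < e" by (simp add: dist_real_def)
  qed (rule d)
qed

text \<open>The maximiser for u competes in the problem for v; the running costs cancel and the
  estimate reduces to heat convolutions at the same point.\<close>

lemma lax_contraction:
  assumes "continuous_on UNIV u" "continuous_on UNIV v" "\<And>z. u z - v z \<le> B"
    and "\<And>z :: 'n torus. \<delta> \<le> heat_kernel \<tau> z"
  shows "lax \<tau> L u x - lax \<tau> L v x - \<delta> * (\<integral>z. u z \<partial>torus_lebesgue) + \<delta> * (\<integral>z. v z \<partial>torus_lebesgue)
    \<le> (1 - \<delta>) * B"
proof -
  obtain q where q: "lax \<tau> L u x = payoff u x q" using lax_attained[OF assms(1)] by blast
  show ?thesis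
    using heat_conv_contraction[OF tau_pos assms, of "x + abs_torus (\<tau> *\<^sub>R q)"] lax_ge[OF assms(2), of x q] q
    by (simp add: payoff_def)
qed

text \<open>Strong maximum principle: at a maximum point of \<open>u - v\<close> the contraction forces the mean of
  \<open>u - v\<close> to be at least its maximum.\<close>

lemma lax_unique:
  assumes u: "continuous_on UNIV u" and v: "continuous_on UNIV v"
    and eq: "\<And>x. lax \<tau> L u x - u x = lax \<tau> L v x - v x"
  shows "\<exists>k. \<forall>x. v x = u x + k"
proof -
  obtain \<delta> where \<delta>: "\<delta> > 0" "\<And>z :: 'n torus. \<delta> \<le> heat_kernel \<tau> z"
    using heat_kernel_bounds[OF tau_pos, where 'n = 'n] by metis
  have mean: "u x - v x \<le> (\<integral>z. u z \<partial>torus_lebesgue) - (\<integral>z. v z \<partial>torus_lebesgue)"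
    if u: "continuous_on UNIV u" and v: "continuous_on UNIV v"
    and eq: "\<And>x. lax \<tau> L u x - u x = lax \<tau> L v x - v x" for u v x
  proof -
    have "continuous_on UNIV (\<lambda>x. u x - v x)" by (intro continuous_intros u v)
    then have "\<exists>x\<in>UNIV. \<forall>y\<in>UNIV. u y - v y \<le> u x - v x"
      by (rule continuous_attains_sup[OF compact_UNIV_torus UNIV_not_empty])
    then obtain x0 where x0: "\<And>y. u y - v y \<le> u x0 - v x0" by blast
    have "\<delta> * (u x0 - v x0) \<le> \<delta> * ((\<integral>z. u z \<partial>torus_lebesgue) - (\<integral>z. v z \<partial>torus_lebesgue))"
      using lax_contraction[OF u v x0 \<delta>(2), of x0] eq[of x0]
      unfolding left_diff_distrib right_diff_distrib mult_1 by linarith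
    then show ?thesis using \<delta>(1) x0[of x] by simp
  qed
  \<comment> \<open>Used in both orders, \<open>mean\<close> bounds u - v by its own mean from above
    and from below.\<close>
  have "v x = u x + ((\<integral>z. v z \<partial>torus_lebesgue) - (\<integral>z. u z \<partial>torus_lebesgue))" for x
    using mean[OF u v eq, of x] mean[OF v u eq[symmetric], of x] by simp
  then show ?thesis by blast
qed

text \<open>The gap in the dynamic programming equation with coupling f and constant \<rho>. When
  (u, \<rho>) solves that equation it is nonnegative and vanishes exactly at the maximising
  controls.\<close>

definition slack :: "('n torus \<Rightarrow> real) \<Rightarrow> ('n torus \<Rightarrow> real) \<Rightarrow> real \<Rightarrow> 'n torus \<Rightarrow> real ^ 'n \<Rightarrow> real" where
  "slack f u \<rho> x q = u x + \<tau> * f x + \<tau> * \<rho> - payoff u x q"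

text \<open>Banach's theorem for u \<mapsto> lax u - \<delta> \<integral> u - \<tau> f. The radius
  \<open>K\<close> depends on f only through the bound \<open>B\<close>, so one compact set of
  controls serves all couplings; slack up to 1 leaves room for controls that are merely almost
  optimal.\<close>

lemma ergodic_ex:
  obtains K where "\<And>f. continuous_on UNIV f \<Longrightarrow> (\<And>x. \<bar>f x\<bar> \<le> B) \<Longrightarrow>
    \<exists>u \<rho>. continuous_on UNIV u \<and> (\<forall>x. lax \<tau> L u x = u x + \<tau> * f x + \<tau> * \<rho>) \<and>
      (\<forall>x q. slack f u \<rho> x q \<le> 1 \<longrightarrow> norm q \<le> K)"
proof -
  obtain \<delta> where \<delta>: "\<delta> > 0" "\<delta> \<le> 1" "\<And>z :: 'n torus. \<delta> \<le> heat_kernel \<tau> z"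
    using heat_kernel_bounds[OF tau_pos, where 'n = 'n] by metis
  obtain C where C: "\<And>x q. L x q \<ge> norm q - C" using coercive by blast
  have c0: "continuous_on UNIV (\<lambda>_ :: 'n torus. 0 :: real)" by simp
  obtain B0 where B0: "\<And>x. \<bar>lax \<tau> L (\<lambda>_. 0) x\<bar> \<le> B0"
    using torus_bounded[OF continuous_lax[OF c0]] by blast
  \<comment> \<open>Comparing the fixed point with 0 gives |u| \<le> (1 - \<delta>) |u| + B0 +
    \<tau> B at a point where |u| is largest; \<open>U\<close> is the resulting sup-norm
    bound.\<close>
  define U where "U = (B0 + \<tau> * B) / \<delta>"
  \<comment> \<open>Slack at most 1 gives \<tau> L \<le> 1 + 3 U + \<tau> B, with one
    \<open>U\<close> each for u, its heat convolution and \<tau> \<rho>.\<close>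
  define K where "K = C + (1 + 3 * U + \<tau> * B) / \<tau>"
  show ?thesis
  proof (rule that)
    fix f :: "'n torus \<Rightarrow> real" assume f: "continuous_on UNIV f" "\<And>x. \<bar>f x\<bar> \<le> B"
    define M where "M u x = lax \<tau> L u x - \<delta> * (\<integral>z. u z \<partial>torus_lebesgue) - \<tau> * f x" for u x
    have contM: "continuous_on UNIV (M u)" if "continuous_on UNIV u" for u
      unfolding M_def by (intro continuous_intros continuous_lax that f)
    have Mle: "M u x - M v x \<le> (1 - \<delta>) * B'"
      if "continuous_on UNIV u" "continuous_on UNIV v" "\<And>z. u z - v z \<le> B'" for u v B' x
      using lax_contraction[OF that \<delta>(3), of x] by (simp add: M_def)
    define T :: "('n torus \<Rightarrow>\<^sub>C real) \<Rightarrow> ('n torus \<Rightarrow>\<^sub>C real)" where "T w = Bcontfun (M (apply_bcontfun w))" for w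
    have bc: "h \<in> bcontfun" if h: "continuous_on UNIV h" for h :: "'n torus \<Rightarrow> real"
    proof -
      obtain D where "\<And>x. \<bar>h x\<bar> \<le> D" using torus_bounded[OF h] by blast
      then show ?thesis using h by (intro bcontfun_normI[of _ D]) auto
    qed
    have T: "apply_bcontfun (T w) = M (apply_bcontfun w)" for w
      unfolding T_def by (intro Bcontfun_inverse bc contM) simp
    have "dist (T v) (T w) \<le> (1 - \<delta>) * dist v w" for v w
    proof (rule dist_bound)
      fix x
      have "\<bar>apply_bcontfun v z - apply_bcontfun w z\<bar> \<le> dist v w" for z
        using dist_bounded[of v z w] by (simp add: dist_real_def)
      then have "apply_bcontfun v z - apply_bcontfun w z \<le> dist v w"
        "apply_bcontfun w z - apply_bcontfun v z \<le> dist v w" for z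
        by (simp_all add: abs_le_iff)
      then have "M v x - M w x \<le> (1 - \<delta>) * dist v w" "M w x - M v x \<le> (1 - \<delta>) * dist v w"
        by (auto intro!: Mle)
      then show "dist (apply_bcontfun (T v) x) (apply_bcontfun (T w) x) \<le> (1 - \<delta>) * dist v w"
        by (simp add: T dist_real_def)
    qed
    then have "\<exists>!w. T w = w" using \<delta> by (intro banach_fix_type[of "1 - \<delta>"]) auto
    then obtain w where w: "T w = w" by blast
    define u where "u = apply_bcontfun w"
    have u: "continuous_on UNIV u" by (simp add: u_def)
    have fix_u: "u x = M u x" for x using T[of w] w by (simp add: u_def)
    obtain x1 where "\<And>x. \<bar>u x\<bar> \<le> \<bar>u x1\<bar>"
    proof -
      have "continuous_on UNIV (\<lambda>x. \<bar>u x\<bar>)" by (intro continuous_intros u)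
      then have "\<exists>x\<in>UNIV. \<forall>y\<in>UNIV. \<bar>u y\<bar> \<le> \<bar>u x\<bar>"
        by (rule continuous_attains_sup[OF compact_UNIV_torus UNIV_not_empty])
      then show ?thesis using that by blast
    qed
    then have x1: "u x \<le> \<bar>u x1\<bar>" "- u x \<le> \<bar>u x1\<bar>" for x
      by (metis abs_le_iff)+
    have M0: "\<bar>M (\<lambda>_. 0) x\<bar> \<le> B0 + \<tau> * B" for x
    proof -
      have "\<bar>M (\<lambda>_. 0) x\<bar> \<le> \<bar>lax \<tau> L (\<lambda>_. 0) x\<bar> + \<bar>\<tau> * f x\<bar>" by (simp add: M_def)
      also have "\<bar>\<tau> * f x\<bar> \<le> \<tau> * B" using f(2)[of x] tau_pos by (simp add: abs_mult)
      finally show ?thesis using B0[of x] by simp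
    qed
    have "\<bar>u x1\<bar> \<le> (1 - \<delta>) * \<bar>u x1\<bar> + (B0 + \<tau> * B)"
      using Mle[OF u c0, of "\<bar>u x1\<bar>" x1] Mle[OF c0 u, of "\<bar>u x1\<bar>" x1] x1 M0[of x1] fix_u[of x1]
      by (simp add: abs_le_iff abs_real_def split: if_splits)
    then have "\<bar>u x1\<bar> \<le> U" using \<delta>(1) by (simp add: U_def field_simps)
    then have uU: "\<bar>u x\<bar> \<le> U" for x using x1[of x] by linarith
    \<comment> \<open>The mean subtracted to obtain a contraction reappears as the ergodic
      constant.\<close>
    define \<rho> where "\<rho> = \<delta> * (\<integral>z. u z \<partial>torus_lebesgue) / \<tau>"
    have eq: "lax \<tau> L u x = u x + \<tau> * f x + \<tau> * \<rho>" for x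
      using fix_u[of x] tau_pos by (simp add: M_def \<rho>_def)
    have "\<bar>\<integral>z. u z \<partial>torus_lebesgue\<bar> \<le> (\<integral>z. \<bar>u z\<bar> \<partial>torus_lebesgue)" by (rule integral_abs_bound)
    also have "\<dots> \<le> (\<integral>z. U \<partial>(torus_lebesgue :: 'n torus measure))"
      using uU u by (intro integral_mono integrable_torus_lebesgue continuous_intros) auto
    also have "\<dots> = U" by simp
    finally have iU: "\<bar>\<integral>z. u z \<partial>torus_lebesgue\<bar> \<le> U" .
    have "\<bar>\<tau> * \<rho>\<bar> = \<delta> * \<bar>\<integral>z. u z \<partial>torus_lebesgue\<bar>" using tau_pos \<delta> by (simp add: \<rho>_def abs_mult)
    also have "\<dots> \<le> 1 * U" using iU \<delta> by (intro mult_mono) auto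
    finally have rU: "\<bar>\<tau> * \<rho>\<bar> \<le> U" by simp
    have "norm q \<le> K" if "slack f u \<rho> x q \<le> 1" for x q
    proof -
      have "\<bar>\<tau> * f x\<bar> \<le> \<tau> * B" using f(2)[of x] tau_pos by (simp add: abs_mult)
      then have "\<tau> * L x q \<le> 1 + 3 * U + \<tau> * B"
        using that uU[of x] rU abs_heat_conv_le[OF tau_pos u uU, of "x + abs_torus (\<tau> *\<^sub>R q)"]
        unfolding slack_def payoff_def by linarith
      then have "L x q \<le> (1 + 3 * U + \<tau> * B) / \<tau>" using tau_pos by (simp add: pos_le_divide_eq mult.commute)
      then show ?thesis using C[where x = x and q = q] by (simp add: K_def)
    qed
    then show "\<exists>u \<rho>. continuous_on UNIV u \<and> (\<forall>x. lax \<tau> L u x = u x + \<tau> * f x + \<tau> * \<rho>) \<and>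
      (\<forall>x q. slack f u \<rho> x q \<le> 1 \<longrightarrow> norm q \<le> K)" using u eq by blast
  qed
qed

end

section \<open>Weak sequential compactness\<close>

instance torus :: (finite) complete_space
proof
  fix X :: "nat \<Rightarrow> 'a torus" assume "Cauchy X"
  moreover have "Topological_Spaces.complete (UNIV :: 'a torus set)" by (rule compact_imp_complete[OF compact_UNIV_torus])
  ultimately show "convergent X" by (metis UNIV_I completeE convergent_def)
qed

text \<open>At the first index i where the sequences differ the digit contributes (1/3)^i, and the
  tail at most half of that. Base 3 rather than 2 leaves this gap, which rules out ambiguous
  expansions.\<close>

lemma ternary_expansion_separates:
  fixes a b :: "nat \<Rightarrow> bool"
  assumes "\<bar>(\<Sum>k. of_bool (a k) * (1/3) ^ k) - (\<Sum>k. of_bool (b k) * (1/3) ^ k)\<bar> < (1/3 :: real) ^ K / 2"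
    and "j \<le> K"
  shows "a j = b j"
proof (rule ccontr)
  assume ne: "a j \<noteq> b j"
  define i where "i = (LEAST i. a i \<noteq> b i)"
  have i: "a i \<noteq> b i" "i \<le> j" unfolding i_def using ne by (rule LeastI, rule Least_le)
  have less: "a k = b k" if "k < i" for k using not_less_Least[of k "\<lambda>i. a i \<noteq> b i"] that by (auto simp: i_def)
  have geo: "summable (\<lambda>k. (1/3 :: real) ^ k)" by (rule summable_geometric) simp
  have sm: "summable (\<lambda>k. of_bool (c k) * (1/3 :: real) ^ k)" for c :: "nat \<Rightarrow> bool"
    by (rule summable_comparison_test'[OF geo, of 0]) simp
  define d where "d k = (of_bool (a k) - of_bool (b k)) * (1/3 :: real) ^ k" for k
  have sd: "summable d" using summable_diff[OF sm[of a] sm[of b]] by (simp add: d_def[abs_def] left_diff_distrib)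
  have "(\<Sum>k. of_bool (a k) * (1/3) ^ k) - (\<Sum>k. of_bool (b k) * (1/3) ^ k) = (\<Sum>k. d k)"
    by (subst suminf_diff[OF sm sm]) (auto intro!: suminf_cong simp: d_def left_diff_distrib)
  also have "\<dots> = (\<Sum>k. d (k + Suc i)) + sum d {..<Suc i}" by (rule suminf_split_initial_segment[OF sd])
  also have "sum d {..<Suc i} = d i" using less by (simp add: d_def)
  finally have eq: "(\<Sum>k. of_bool (a k) * (1/3) ^ k) - (\<Sum>k. of_bool (b k) * (1/3) ^ k) = (\<Sum>k. d (k + Suc i)) + d i" .
  have di: "\<bar>d i\<bar> = (1/3) ^ i" using i(1) by (auto simp: d_def)
  have "\<bar>\<Sum>k. d (k + Suc i)\<bar> \<le> (\<Sum>k. (1/3) ^ (k + Suc i))"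
  proof -
    have s1: "summable (\<lambda>k. (1/3 :: real) ^ (k + Suc i))" using geo summable_iff_shift[of "\<lambda>k. (1/3 :: real) ^ k" "Suc i"] by blast
    have "norm (\<Sum>k. d (k + Suc i)) \<le> (\<Sum>k. (1/3) ^ (k + Suc i))"
      by (rule norm_suminf_le[OF _ s1]) (auto simp: d_def abs_mult)
    then show ?thesis by simp
  qed
  also have "\<dots> = (1/3) ^ Suc i * (\<Sum>k. (1/3 :: real) ^ k)"
    unfolding power_add by (subst suminf_mult[OF geo, symmetric]) (simp add: mult.commute)
  also have "(\<Sum>k. (1/3 :: real) ^ k) = 3 / 2" by (subst suminf_geometric) auto
  finally have "\<bar>\<Sum>k. d (k + Suc i)\<bar> \<le> (1/3) ^ i / 2" by simp
  then have "(1/3) ^ i / 2 \<le> \<bar>(\<Sum>k. of_bool (a k) * (1/3 :: real) ^ k) - (\<Sum>k. of_bool (b k) * (1/3) ^ k)\<bar>"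
    unfolding eq using di by linarith
  moreover have "(1/3 :: real) ^ K \<le> (1/3) ^ i" using i(2) assms(2) by (intro power_decreasing) auto
  ultimately show False using assms(1) by linarith
qed

text \<open>A compact metric space embeds into the real line by a Borel map with uniformly continuous inverse:
  record in base 3 which members of a countable base contain the point.\<close>

lemma compact_borel_embedding:
  fixes X :: "'a::{complete_space, second_countable_topology} set"
  assumes "compact X"
  obtains h :: "'a \<Rightarrow> real" where "h \<in> borel_measurable borel" "\<And>x. 0 \<le> h x" "\<And>x. h x \<le> 2"
    "\<And>e. e > 0 \<Longrightarrow> \<exists>d>0. \<forall>x\<in>X. \<forall>y\<in>X. \<bar>h x - h y\<bar> < d \<longrightarrow> dist x y < e"
proof -
  obtain B :: "'a set set" where B: "countable B" "topological_basis B" using ex_countable_basis by blast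
  define A where "A k = from_nat_into B k" for k
  have Bne: "B \<noteq> {}" using B(2) topological_basisE[OF B(2) open_UNIV UNIV_I] by blast
  have A: "A k \<in> B" for k unfolding A_def by (rule from_nat_into[OF Bne])
  have AB: "\<exists>k. A k = b" if "b \<in> B" for b unfolding A_def using from_nat_into_surj[OF B(1) that] by blast
  have oA: "open (A k)" for k using A topological_basis_open[OF B(2)] by blast
  define h where "h x = (\<Sum>k. of_bool (x \<in> A k) * (1/3 :: real) ^ k)" for x
  have geo: "summable (\<lambda>k. (1/3 :: real) ^ k)" by (rule summable_geometric) simp
  have sm: "summable (\<lambda>k. of_bool (x \<in> A k) * (1/3 :: real) ^ k)" for x
    by (rule summable_comparison_test'[OF geo, of 0]) simp
  show ?thesis
  proof (rule that)
    have [measurable]: "A k \<in> sets borel" for k using oA by simp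
    have "(\<lambda>x. of_bool (x \<in> A k) * (1/3 :: real) ^ k) \<in> borel_measurable borel" for k
      unfolding of_bool_def by measurable
    then show "h \<in> borel_measurable borel" unfolding h_def by (rule borel_measurable_suminf)
    show "0 \<le> h x" for x unfolding h_def by (intro suminf_nonneg sm) auto
    show "h x \<le> 2" for x
    proof -
      have "h x \<le> (\<Sum>k. (1/3) ^ k)" unfolding h_def by (intro suminf_le sm geo) auto
      also have "\<dots> = 3 / 2" by (subst suminf_geometric) auto
      finally show ?thesis by simp
    qed
  next
    fix e :: real assume "e > 0"
    \<comment> \<open>Basic sets of diameter at most \<open>e\<close>. Finitely many cover
      \<open>X\<close>; if \<open>K\<close> bounds their indices, points with equal digits up to
      \<open>K\<close> lie in a common one.\<close>
    define S where "S = {b \<in> B. \<forall>x\<in>b. \<forall>y\<in>b. dist x y < e}"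
    have "X \<subseteq> \<Union> S"
    proof
      fix x assume "x \<in> X"
      obtain b where "b \<in> B" "x \<in> b" "b \<subseteq> ball x (e / 2)"
        using topological_basisE[OF B(2), of "ball x (e / 2)" x] \<open>e > 0\<close> by auto
      moreover have "dist y z < e" if "y \<in> ball x (e / 2)" "z \<in> ball x (e / 2)" for y z
        using that dist_triangle_half_r[of x y e z] by simp
      ultimately have "b \<in> S" unfolding S_def by blast
      then show "x \<in> \<Union> S" using \<open>x \<in> b\<close> by blast
    qed
    moreover have "\<forall>b\<in>S. open b" using topological_basis_open[OF B(2)] by (auto simp: S_def)
    ultimately obtain S' where S': "S' \<subseteq> S" "finite S'" "X \<subseteq> \<Union> S'"
      using compactE[OF assms] by metis
    have "\<forall>b\<in>S'. \<exists>k. A k = b" using AB S'(1) by (auto simp: S_def)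
    then obtain n where n: "\<And>b. b \<in> S' \<Longrightarrow> A (n b) = b" by metis
    obtain K where K: "\<And>b. b \<in> S' \<Longrightarrow> n b \<le> K" using finite_nat_set_iff_bounded_le[of "n ` S'"] S'(2) by auto
    show "\<exists>d>0. \<forall>x\<in>X. \<forall>y\<in>X. \<bar>h x - h y\<bar> < d \<longrightarrow> dist x y < e"
    proof (intro exI[of _ "(1/3) ^ K / 2"] conjI ballI impI)
      fix x y assume "x \<in> X" "y \<in> X" "\<bar>h x - h y\<bar> < (1/3) ^ K / 2"
      obtain b where b: "b \<in> S'" "x \<in> b" using S'(3) \<open>x \<in> X\<close> by blast
      have "(x \<in> A (n b)) = (y \<in> A (n b))"
        using ternary_expansion_separates[of "\<lambda>k. x \<in> A k" "\<lambda>k. y \<in> A k" K "n b"] K[OF b(1)]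
          \<open>\<bar>h x - h y\<bar> < _\<close> by (simp add: h_def)
      then have "y \<in> b" using n b by simp
      then show "dist x y < e" using b S'(1) by (auto simp: S_def)
    qed simp
  qed
qed

text \<open>The measures are pushed to the line by the Borel embedding, where all lie in a bounded
  interval and Helly selection applies, and the limit is pulled back by the inverse. The embedding
  may be discontinuous; the uniform continuity of its inverse is what turns continuous test
  functions on \<open>X\<close> into continuous functions on the line.\<close>

theorem weak_sequential_compactness:
  fixes X :: "'a::{complete_space, second_countable_topology} set" and \<mu> :: "nat \<Rightarrow> 'a measure"
  assumes X: "compact X"
    and prob: "\<And>n. prob_space (\<mu> n)" and sets: "\<And>n. sets (\<mu> n) = sets borel"
    and supp: "\<And>n. AE x in \<mu> n. x \<in> X"
  obtains r M where "strict_mono (r :: nat \<Rightarrow> nat)" "prob_space M" "sets M = sets borel" "AE x in M. x \<in> X"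
    "\<And>\<phi> :: 'a \<Rightarrow> real. continuous_on UNIV \<phi> \<Longrightarrow> (\<lambda>n. \<integral>x. \<phi> x \<partial>\<mu> (r n)) \<longlonglongrightarrow> (\<integral>x. \<phi> x \<partial>M)"
proof -
  obtain h :: "'a \<Rightarrow> real" where h [measurable]: "h \<in> borel_measurable borel" and h0: "\<And>x. 0 \<le> h x" "\<And>x. h x \<le> 2"
    and hinv: "\<And>e. e > 0 \<Longrightarrow> \<exists>d>0. \<forall>x\<in>X. \<forall>y\<in>X. \<bar>h x - h y\<bar> < d \<longrightarrow> dist x y < e"
    using compact_borel_embedding[OF X] by metis
  note [measurable_cong] = sets
  have "X \<noteq> {}"
  proof
    assume "X = {}"
    then have "AE x in \<mu> 0. False" using supp[of 0] by simp
    then show False using prob[of 0] by (simp add: prob_space.AE_False)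
  qed
  then obtain x0 where "x0 \<in> X" by blast
  have inj: "inj_on h X"
  proof (rule inj_onI, rule ccontr)
    fix x y assume "x \<in> X" "y \<in> X" "h x = h y" "x \<noteq> y"
    moreover obtain d where "d > 0" "\<And>x' y'. x' \<in> X \<Longrightarrow> y' \<in> X \<Longrightarrow> \<bar>h x' - h y'\<bar> < d \<Longrightarrow> dist x' y' < dist x y"
      using hinv[of "dist x y"] \<open>x \<noteq> y\<close> by auto
    ultimately show False by fastforce
  qed
  define C where "C = closure (h ` X)"
  have "uniformly_continuous_on (h ` X) (inv_into X h)"
    unfolding uniformly_continuous_on_def
  proof (intro allI impI)
    fix e :: real assume "e > 0"
    from hinv[OF this] obtain d where d: "d > 0" "\<And>x y. x \<in> X \<Longrightarrow> y \<in> X \<Longrightarrow> \<bar>h x - h y\<bar> < d \<Longrightarrow> dist x y < e" by blast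
    show "\<exists>d>0. \<forall>s\<in>h ` X. \<forall>t\<in>h ` X. dist t s < d \<longrightarrow> dist (inv_into X h t) (inv_into X h s) < e"
      using d by (intro exI[of _ d]) (auto simp: inv_into_f_f[OF inj] dist_real_def)
  qed
  then obtain g where "uniformly_continuous_on C g" and gh': "\<And>t. t \<in> h ` X \<Longrightarrow> inv_into X h t = g t"
    unfolding C_def using uniformly_continuous_on_extension_on_closure by metis
  then have g: "continuous_on C g" by (blast intro: uniformly_continuous_imp_continuous)
  have gh: "g (h x) = x" if "x \<in> X" for x using gh'[of "h x"] that inv_into_f_f[OF inj that] by simp
  have hC: "h x \<in> C" if "x \<in> X" for x using that closure_subset[of "h ` X"] by (auto simp: C_def)
  have gC: "g t \<in> X" if "t \<in> C" for t
  proof -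
    have "g ` closure (h ` X) \<subseteq> X"
      using g gh compact_imp_closed[OF X] by (intro image_closure_subset) (auto simp: C_def)
    then show ?thesis using that by (auto simp: C_def)
  qed
  have closC: "closed C" by (simp add: C_def)
  have Cne: "C \<noteq> {}" using hC[OF \<open>x0 \<in> X\<close>] by auto
  define N where "N n = distr (\<mu> n) borel h" for n
  have rd: "real_distribution (N n)" for n
    unfolding N_def by (rule prob_space.real_distribution_distr[OF prob]) measurable
  have "tight N"
    unfolding tight_def
  proof (intro conjI allI impI rd)
    fix e :: real assume "e > 0"
    have "measure (N n) {-1<..3} = 1" for n
    proof -
      have "h x \<in> {-1<..3}" for x using h0[of x] by simp
      then have "h -` {-1<..3} \<inter> space (\<mu> n) = space (\<mu> n)" by auto
      then show ?thesis unfolding N_def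
        by (subst measure_distr) (auto simp: prob_space.prob_space[OF prob])
    qed
    then show "\<exists>a b. a < b \<and> (\<forall>n. 1 - e < measure (N n) {a<..b})"
      using \<open>e > 0\<close> by (intro exI[of _ "-1"] exI[of _ 3]) auto
  qed
  then obtain r M where r: "strict_mono r" and M: "real_distribution M" and wc: "weak_conv_m (N \<circ> id \<circ> r) M"
    using tight_imp_convergent_subsubsequence[of N id] strict_mono_id by (auto simp: strict_mono_def)
  interpret M: real_distribution M by fact
  have lim: "(\<lambda>n. \<integral>t. \<psi> t \<partial>N (r n)) \<longlonglongrightarrow> (\<integral>t. \<psi> t \<partial>M)"
    if "continuous_on UNIV \<psi>" "\<And>t. \<bar>\<psi> t\<bar> \<le> B" for \<psi> :: "real \<Rightarrow> real" and B
    using weak_conv_imp_integral_bdd_continuous_conv[of "N \<circ> id \<circ> r" M \<psi> B] rd M wc that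
    by (simp add: continuous_on_eq_continuous_at)
  have intN: "(\<integral>t. \<psi> t \<partial>N n) = (\<integral>x. \<psi> (h x) \<partial>\<mu> n)" if "continuous_on UNIV \<psi>" for \<psi> :: "real \<Rightarrow> real" and n
    unfolding N_def using borel_measurable_continuous_onI[OF that] by (intro integral_distr) measurable
  have AEC: "AE t in M. t \<in> C"
  proof -
    \<comment> \<open>A bounded continuous function vanishing exactly on \<open>C\<close>: its
      integrals are 0 along the sequence, hence also in the limit.\<close>
    define \<psi> where "\<psi> t = min 1 (infdist t C)" for t
    have c: "continuous_on UNIV \<psi>" unfolding \<psi>_def by (intro continuous_intros)
    have b: "\<bar>\<psi> t\<bar> \<le> 1" for t using infdist_nonneg[of t C] by (simp add: \<psi>_def)
    have "(\<integral>t. \<psi> t \<partial>N (r n)) = 0" for n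
    proof -
      note [measurable] = borel_measurable_continuous_onI[OF c]
      have m: "(\<lambda>x. \<psi> (h x)) \<in> borel_measurable (\<mu> (r n))" by measurable
      have "(\<integral>x. \<psi> (h x) \<partial>\<mu> (r n)) = (\<integral>x. 0 \<partial>\<mu> (r n))"
        using supp[of "r n"] by (intro integral_cong_AE m) (auto elim!: eventually_mono simp: \<psi>_def hC)
      then show ?thesis by (simp add: intN[OF c])
    qed
    then have "(\<integral>t. \<psi> t \<partial>M) = 0" using lim[OF c b] by (simp add: LIMSEQ_const_iff)
    moreover have "integrable M \<psi>"
      using b borel_measurable_continuous_onI[OF c] by (intro M.integrable_const_bound[of _ 1]) auto
    ultimately have "AE t in M. \<psi> t = 0"
      using infdist_nonneg by (subst (asm) integral_nonneg_eq_0_iff_AE) (auto simp: \<psi>_def)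
    then show ?thesis
    proof eventually_elim
      case (elim t)
      then have "infdist t C = 0" by (auto simp: \<psi>_def min_def split: if_splits)
      then show ?case using in_closed_iff_infdist_zero[OF closC Cne] by blast
    qed
  qed
  \<comment> \<open>The default \<open>x0\<close> is used only off \<open>C\<close>, a null set of
    the limit.\<close>
  define k where "k t = (if t \<in> C then g t else x0)" for t
  have [measurable]: "C \<in> sets borel" using closC by simp
  have k [measurable]: "k \<in> borel_measurable borel"
    unfolding k_def using borel_measurable_continuous_on_if[OF _ g, of "\<lambda>_. x0"] by simp
  define \<nu> where "\<nu> = distr M borel k"
  show ?thesis
  proof (rule that[OF r])
    show "prob_space \<nu>" unfolding \<nu>_def by (rule M.prob_space_distr) measurable
    show "sets \<nu> = sets borel" by (simp add: \<nu>_def)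
    have "X \<in> sets borel" using compact_imp_closed[OF X] by simp
    then show "AE x in \<nu>. x \<in> X"
      unfolding \<nu>_def using gC \<open>x0 \<in> X\<close> by (subst AE_distr_iff) (auto simp: k_def)
  next
    fix \<phi> :: "'a \<Rightarrow> real" assume \<phi>: "continuous_on UNIV \<phi>"
    note m [measurable] = borel_measurable_continuous_onI[OF \<phi>]
    have "bounded (\<phi> ` X)" by (intro compact_imp_bounded compact_continuous_image X continuous_on_subset[OF \<phi>]) auto
    then obtain B where B: "B > 0" "\<And>x. x \<in> X \<Longrightarrow> \<bar>\<phi> x\<bar> \<le> B" unfolding bounded_pos by auto
    have "continuous_on C (\<phi> \<circ> g)"
      using continuous_on_compose[OF g continuous_on_subset[OF \<phi>]] by auto
    \<comment> \<open>Tietze extends the test function from \<open>C\<close> to the line with the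
      same bound, as weak convergence there needs bounded continuous functions.\<close>
    then obtain \<psi> where \<psi>: "continuous_on UNIV \<psi>" "\<And>t. t \<in> C \<Longrightarrow> \<psi> t = (\<phi> \<circ> g) t" "\<And>t. \<bar>\<psi> t\<bar> \<le> B"
      using Tietze[of C "\<phi> \<circ> g" UNIV B] closC B gC by (auto simp: closed_closedin[symmetric])
    have "(\<integral>t. \<psi> t \<partial>N n) = (\<integral>x. \<phi> x \<partial>\<mu> n)" for n
      unfolding intN[OF \<psi>(1)] using supp[of n] borel_measurable_continuous_onI[OF \<psi>(1)]
      by (intro integral_cong_AE) (auto elim!: eventually_mono simp: \<psi>(2) hC gh)
    moreover have "(\<integral>t. \<psi> t \<partial>M) = (\<integral>x. \<phi> x \<partial>\<nu>)"
    proof -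
      have "(\<integral>x. \<phi> x \<partial>\<nu>) = (\<integral>t. \<phi> (k t) \<partial>M)" unfolding \<nu>_def by (intro integral_distr) measurable
      also have "\<dots> = (\<integral>t. \<psi> t \<partial>M)"
      proof (rule integral_cong_AE)
        show "(\<lambda>t. \<phi> (k t)) \<in> borel_measurable M" by measurable
      qed (use AEC borel_measurable_continuous_onI[OF \<psi>(1)] in \<open>auto elim!: eventually_mono simp: \<psi>(2) k_def\<close>)
      finally show ?thesis by simp
    qed
    ultimately show "(\<lambda>n. \<integral>x. \<phi> x \<partial>\<mu> (r n)) \<longlonglongrightarrow> (\<integral>x. \<phi> x \<partial>\<nu>)"
      using lim[OF \<psi>(1,3)] by simp
  qed
qed

section \<open>Minty's variational inequality\<close>

text \<open>Minimise \<open>\<Sum>\<^sub>s (max 0 (B s (e - s)))\<^sup>2\<close> over the convex hull; the first order condition in the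
  direction of the barycentre weighted by the positive parts contradicts monotonicity unless all
  positive parts vanish.\<close>

lemma minty_finite:
  fixes S :: "'a::real_normed_vector set" and B :: "'a \<Rightarrow> 'a \<Rightarrow> real"
  assumes S: "finite S" "S \<noteq> {}"
    and lin: "\<And>s. s \<in> S \<Longrightarrow> linear (B s)"
    and cont: "\<And>s. s \<in> S \<Longrightarrow> continuous_on (convex hull S) (B s)"
    and mono: "\<And>s r. s \<in> S \<Longrightarrow> r \<in> S \<Longrightarrow> B r (s - r) \<le> B s (s - r)"
  shows "\<exists>e\<in>convex hull S. \<forall>s\<in>S. 0 \<le> B s (s - e)"
proof -
  define \<Phi> where "\<Phi> e = (\<Sum>s\<in>S. (max 0 (B s e - B s s))\<^sup>2)" for e
  have "compact (convex hull S)" by (rule finite_imp_compact_convex_hull[OF S(1)])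
  moreover have "convex hull S \<noteq> {}" using S(2) by simp
  moreover have "continuous_on (convex hull S) \<Phi>"
    unfolding \<Phi>_def using cont by (intro continuous_intros) auto
  ultimately obtain e where e: "e \<in> convex hull S" "\<And>e'. e' \<in> convex hull S \<Longrightarrow> \<Phi> e \<le> \<Phi> e'"
    using continuous_attains_inf[of "convex hull S" \<Phi>] by blast
  define p where "p s = max 0 (B s e - B s s)" for s
  define P where "P = sum p S"
  have p0: "0 \<le> p s" for s by (simp add: p_def)
  have "P = 0"
  proof (rule ccontr)
    assume "P \<noteq> 0"
    then have P: "P > 0" unfolding P_def using sum_nonneg[of S p] p0 by fastforce
    define w where "w = (\<Sum>s\<in>S. (p s / P) *\<^sub>R s)"
    have w: "w \<in> convex hull S"
      unfolding w_def using p0 P S(1)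
      by (intro convex_sum convex_convex_hull hull_inc) (auto simp: P_def sum_divide_distrib[symmetric])
    define b where "b s = B s (w - e)" for s
    \<comment> \<open>Minimality of \<open>e\<close> along the segment towards \<open>w\<close>,
      divided by t: since max 0 (a + b) is at most |max 0 a + b|, the squared positive parts are
      dominated by a quadratic in t.\<close>
    have quad: "0 \<le> 2 * (\<Sum>s\<in>S. p s * b s) + t * (\<Sum>s\<in>S. (b s)\<^sup>2)" if t: "0 < t" "t \<le> 1" for t
    proof -
      have "(1 - t) *\<^sub>R e + t *\<^sub>R w \<in> convex hull S"
        using t e(1) w by (intro convexD_alt[OF convex_convex_hull]) auto
      then have "\<Phi> e \<le> \<Phi> ((1 - t) *\<^sub>R e + t *\<^sub>R w)" by (rule e(2))
      also have "\<dots> \<le> (\<Sum>s\<in>S. (p s + t * b s)\<^sup>2)"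
        unfolding \<Phi>_def
      proof (rule sum_mono)
        fix s assume s: "s \<in> S"
        have "B s ((1 - t) *\<^sub>R e + t *\<^sub>R w) = B s e + t * b s"
          using lin[OF s] by (simp add: b_def linear_add linear_scale linear_diff algebra_simps)
        then have "\<bar>max 0 (B s ((1 - t) *\<^sub>R e + t *\<^sub>R w) - B s s)\<bar> \<le> \<bar>p s + t * b s\<bar>"
          by (auto simp: p_def max_def)
        then show "(max 0 (B s ((1 - t) *\<^sub>R e + t *\<^sub>R w) - B s s))\<^sup>2 \<le> (p s + t * b s)\<^sup>2"
          by (rule abs_le_square_iff[THEN iffD1])
      qed
      also have "\<dots> = \<Phi> e + t * (2 * (\<Sum>s\<in>S. p s * b s) + t * (\<Sum>s\<in>S. (b s)\<^sup>2))"
        by (simp add: \<Phi>_def p_def[symmetric] power2_sum sum.distrib sum_distrib_left power2_eq_square algebra_simps)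
      finally have "0 \<le> t * (2 * (\<Sum>s\<in>S. p s * b s) + t * (\<Sum>s\<in>S. (b s)\<^sup>2))" by simp
      then show ?thesis using t(1) by (simp add: zero_le_mult_iff)
    qed
    have nonneg: "0 \<le> (\<Sum>s\<in>S. p s * b s)"
    proof (rule ccontr)
      define q where "q = (\<Sum>s\<in>S. (b s)\<^sup>2)"
      assume "\<not> ?thesis"
      then have neg: "(\<Sum>s\<in>S. p s * b s) < 0" by simp
      have "0 \<le> q" unfolding q_def by (intro sum_nonneg) simp
      \<comment> \<open>Small enough that the quadratic term cannot outweigh the negative linear
        one; adding 1 to q avoids division by 0.\<close>
      define t where "t = min 1 (- (\<Sum>s\<in>S. p s * b s) / (q + 1))"
      have t: "0 < t" "t \<le> 1" using neg \<open>0 \<le> q\<close> by (auto simp: t_def divide_neg_pos)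
      have "t * q \<le> (- (\<Sum>s\<in>S. p s * b s) / (q + 1)) * (q + 1)"
        using \<open>0 \<le> q\<close> t by (intro mult_mono) (auto simp: t_def)
      also have "\<dots> = - (\<Sum>s\<in>S. p s * b s)" using \<open>0 \<le> q\<close> by simp
      finally show False using quad[OF t] neg by (simp add: q_def)
    qed
    have 1: "(\<Sum>s\<in>S. p s * B s e) \<le> (\<Sum>s\<in>S. p s * B s w)"
    proof -
      have "(\<Sum>s\<in>S. p s * b s) = (\<Sum>s\<in>S. p s * B s w) - (\<Sum>s\<in>S. p s * B s e)"
        by (simp add: b_def linear_diff[OF lin] right_diff_distrib sum_subtractf)
      then show ?thesis using nonneg by simp
    qed
    have 2: "(\<Sum>s\<in>S. p s * (B s e - B s s)) > 0"
    proof -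
      have eq: "p s * (B s e - B s s) = (p s)\<^sup>2" for s by (simp add: p_def max_def power2_eq_square)
      obtain s where "s \<in> S" "p s \<noteq> 0" using \<open>P \<noteq> 0\<close> unfolding P_def by (meson sum.neutral)
      then show ?thesis unfolding eq by (intro sum_pos2[OF S(1), of s]) auto
    qed
    have "(\<Sum>s\<in>S. p s * (B s w - B s s)) = (\<Sum>s\<in>S. \<Sum>r\<in>S. p s * p r * B s (r - s)) / P"
    proof -
      have "B s w - B s s = (\<Sum>r\<in>S. p r * B s (r - s)) / P" if s: "s \<in> S" for s
      proof -
        have "B s w = (\<Sum>r\<in>S. p r / P * B s r)"
          using lin[OF s] by (simp add: w_def linear_sum linear_scale)
        moreover have "B s s = (\<Sum>r\<in>S. p r / P * B s s)"
          using P by (simp add: sum_distrib_right[symmetric] sum_divide_distrib[symmetric] P_def)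
        ultimately have "B s w - B s s = (\<Sum>r\<in>S. p r / P * B s r) - (\<Sum>r\<in>S. p r / P * B s s)"
          by linarith
        then show ?thesis
          by (simp add: sum_subtractf linear_diff[OF lin[OF s]] right_diff_distrib sum_divide_distrib diff_divide_distrib)
      qed
      then show ?thesis by (simp add: sum_divide_distrib sum_distrib_left mult.assoc)
    qed
    moreover have "(\<Sum>s\<in>S. \<Sum>r\<in>S. p s * p r * B s (r - s)) \<le> 0"
    proof -
      \<comment> \<open>Exchanging s and r symmetrises the double sum; each symmetrised term is
        nonpositive by monotonicity.\<close>
      define T where "T = (\<Sum>s\<in>S. \<Sum>r\<in>S. p s * p r * B s (r - s))"
      have "T = (\<Sum>s\<in>S. \<Sum>r\<in>S. p s * p r * B r (s - r))"
        unfolding T_def by (subst sum.swap) (simp add: mult.commute)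
      then have "2 * T = (\<Sum>s\<in>S. \<Sum>r\<in>S. p s * p r * (B s (r - s) + B r (s - r)))"
        by (simp add: T_def distrib_left sum.distrib)
      also have "\<dots> \<le> 0"
      proof (intro sum_nonpos mult_nonneg_nonpos mult_nonneg_nonneg p0)
        fix s r assume s: "s \<in> S" and r: "r \<in> S"
        have "B s (r - s) = - B s (s - r)" using lin[OF s] by (simp add: linear_diff)
        then show "B s (r - s) + B r (s - r) \<le> 0" using mono[OF s r] by simp
      qed
      finally show ?thesis by (simp add: T_def)
    qed
    ultimately have "(\<Sum>s\<in>S. p s * (B s w - B s s)) \<le> 0" using P by (simp add: divide_nonpos_pos)
    then show False using 1 2 by (simp add: right_diff_distrib sum_subtractf)
  qed
  then have "p s = 0" if "s \<in> S" for s
    using that p0 S(1) unfolding P_def by (simp add: sum_nonneg_eq_0_iff)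
  then have "B s e - B s s \<le> 0" if "s \<in> S" for s
    using that unfolding p_def by (metis max.cobounded2)
  then show ?thesis using e(1) by (intro bexI[of _ e]) (auto simp: linear_diff[OF lin])
qed

text \<open>Each s cuts out a closed subset of the compact set, and \<open>minty_finite\<close> says
  that finitely many of them meet. A common point satisfies the inequality with the form taken at s;
  inserting s = e + t (r - e), dividing by t and letting t tend to 0 moves the form to e.\<close>

theorem minty_variational_inequality:
  fixes E :: "'a::real_normed_vector set" and B :: "'a \<Rightarrow> 'a \<Rightarrow> real"
  assumes E: "compact E" "convex E" "E \<noteq> {}"
    and lin: "\<And>s. s \<in> E \<Longrightarrow> linear (B s)"
    and cont: "\<And>s. s \<in> E \<Longrightarrow> continuous_on E (B s)"
    and mono: "\<And>s r. s \<in> E \<Longrightarrow> r \<in> E \<Longrightarrow> B r (s - r) \<le> B s (s - r)"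
    and hemi: "\<And>s r. s \<in> E \<Longrightarrow> r \<in> E \<Longrightarrow> ((\<lambda>t. B (s + t *\<^sub>R (r - s)) (r - s)) \<longlongrightarrow> B s (r - s)) (at_right 0)"
  obtains e where "e \<in> E" "\<And>s. s \<in> E \<Longrightarrow> 0 \<le> B e (s - e)"
proof -
  define F where "F s = {e \<in> E. B s e \<le> B s s}" for s
  have clF: "closed (F s)" if "s \<in> E" for s
  proof -
    have "F s = E \<inter> B s -` {..B s s}" by (auto simp: F_def)
    then show ?thesis
      using continuous_closed_preimage[OF cont[OF that] compact_imp_closed[OF E(1)] closed_atMost] by simp
  qed
  have "E \<inter> \<Inter> (F ` E) \<noteq> {}"
  proof (rule compact_imp_fip[OF E(1)])
    fix G assume "finite G" "G \<subseteq> F ` E"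
    then obtain S where S: "S \<subseteq> E" "finite S" "G = F ` S" by (meson finite_subset_image)
    show "E \<inter> \<Inter> G \<noteq> {}"
    proof (cases "S = {}")
      case True
      then show ?thesis using E(3) S by simp
    next
      case False
      have hull: "convex hull S \<subseteq> E" using S(1) E(2) by (rule hull_minimal)
      have "\<exists>e\<in>convex hull S. \<forall>s\<in>S. 0 \<le> B s (s - e)"
      proof (rule minty_finite)
        fix s r assume "s \<in> S" "r \<in> S"
        then have "s \<in> E" "r \<in> E" using S(1) by auto
        then show "linear (B s)" "continuous_on (convex hull S) (B s)" "B r (s - r) \<le> B s (s - r)"
          using lin mono continuous_on_subset[OF cont hull] by auto
      qed (use S False in auto)
      then obtain e where e: "e \<in> convex hull S" "\<And>s. s \<in> S \<Longrightarrow> 0 \<le> B s (s - e)" by blast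
      have "e \<in> F s" if "s \<in> S" for s
        using e(2)[OF that] that S(1) e(1) hull linear_diff[OF lin, of s s e] by (auto simp: F_def)
      then show ?thesis using e(1) hull S(3) by auto
    qed
  qed (use clF in auto)
  then obtain e where e: "e \<in> E" "\<And>s. s \<in> E \<Longrightarrow> B s e \<le> B s s" by (auto simp: F_def)
  have "0 \<le> B e (r - e)" if r: "r \<in> E" for r
  proof (rule tendsto_lowerbound[OF hemi[OF e(1) r]])
    show "\<forall>\<^sub>F t in at_right 0. 0 \<le> B (e + t *\<^sub>R (r - e)) (r - e)"
      unfolding eventually_at_right_field
    proof (intro exI[of _ 1] conjI allI impI)
      fix t :: real assume t: "0 < t" "t < 1"
      let ?s = "e + t *\<^sub>R (r - e)"
      have "?s = (1 - t) *\<^sub>R e + t *\<^sub>R r" by (simp add: algebra_simps)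
      then have s: "?s \<in> E" using t e(1) r E(2) by (auto intro: convexD_alt)
      have "B ?s e \<le> B ?s ?s" by (rule e(2)[OF s])
      also have "B ?s ?s = B ?s e + t * B ?s (r - e)"
        using lin[OF s] by (simp add: linear_add linear_scale)
      finally show "0 \<le> B ?s (r - e)" using t by (simp add: zero_le_mult_iff)
    qed simp
  qed simp
  then show ?thesis using that e(1) by blast
qed

section \<open>Borel probability measures are determined by continuous functions\<close>

lemma measure_eqI_continuous:
  fixes M N :: "'a::metric_space measure"
  assumes M: "prob_space M" "sets M = sets borel" and N: "prob_space N" "sets N = sets borel"
    and eq: "\<And>\<phi> :: 'a \<Rightarrow> real. continuous_on UNIV \<phi> \<Longrightarrow> (\<And>x. \<bar>\<phi> x\<bar> \<le> 1) \<Longrightarrow> (\<integral>x. \<phi> x \<partial>M) = (\<integral>x. \<phi> x \<partial>N)"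
  shows "M = N"
proof -
  \<comment> \<open>These tent functions are continuous, bounded by 1, and decrease to the indicator
    of the closed set.\<close>
  have lim: "(\<lambda>n. \<integral>x. max 0 (1 - real n * infdist x C) \<partial>K) \<longlonglongrightarrow> measure K C"
    if "closed C" "C \<noteq> {}" "prob_space K" "sets K = sets borel" for C :: "'a set" and K
  proof -
    interpret K: prob_space K by fact
    note [measurable_cong] = that(4)
    have [measurable]: "C \<in> sets K" using that by simp
    have m: "(\<lambda>x. max 0 (1 - real n * infdist x C)) \<in> borel_measurable K" for n
      unfolding measurable_cong_sets[OF that(4) refl]
      by (intro borel_measurable_continuous_onI continuous_intros)
    have "(\<lambda>n. \<integral>x. max 0 (1 - real n * infdist x C) \<partial>K) \<longlonglongrightarrow> (\<integral>x. indicator C x \<partial>K)"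
    proof (rule integral_dominated_convergence[where w = "\<lambda>_. 1"])
      show "AE x in K. (\<lambda>n. max 0 (1 - real n * infdist x C)) \<longlonglongrightarrow> indicator C x"
      proof (rule AE_I2)
        fix x
        show "(\<lambda>n. max 0 (1 - real n * infdist x C)) \<longlonglongrightarrow> indicator C x"
        proof (cases "x \<in> C")
          case True
          then show ?thesis by simp
        next
          case False
          then have "infdist x C \<noteq> 0"
            using in_closed_iff_infdist_zero[OF that(1,2)] by blast
          then have pos: "infdist x C > 0" using infdist_nonneg[of x C] by linarith
          obtain k :: nat where k: "1 < real k * infdist x C" using reals_Archimedean3[OF pos] by blast
          have "max 0 (1 - real n * infdist x C) = 0" if "n \<ge> k" for n
          proof -
            have "real k * infdist x C \<le> real n * infdist x C" using that pos by (intro mult_right_mono) auto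
            then show ?thesis using k by simp
          qed
          then have "\<forall>\<^sub>F n in sequentially. max 0 (1 - real n * infdist x C) = 0"
            unfolding eventually_sequentially by blast
          then show ?thesis using False by (simp add: tendsto_eventually)
        qed
      qed
    qed (use m in \<open>auto simp: infdist_nonneg\<close>)
    then show ?thesis by simp
  qed
  have closed_eq: "emeasure M C = emeasure N C" if "closed C" for C
  proof (cases "C = {}")
    case False
    have "(\<lambda>n. \<integral>x. max 0 (1 - real n * infdist x C) \<partial>M) = (\<lambda>n. \<integral>x. max 0 (1 - real n * infdist x C) \<partial>N)"
      by (intro ext eq continuous_intros) (auto simp: infdist_nonneg)
    then have "measure M C = measure N C"
      using lim[OF that False M] lim[OF that False N] LIMSEQ_unique by metis
    then show ?thesis
      using finite_measure.emeasure_eq_measure[OF prob_space.finite_measure[OF M(1)]]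
        finite_measure.emeasure_eq_measure[OF prob_space.finite_measure[OF N(1)]] by simp
  qed simp
  show ?thesis
  proof (rule measure_eqI_generator_eq[where E = "Collect closed" and \<Omega> = UNIV and A = "\<lambda>_. UNIV"])
    show "sets M = sigma_sets UNIV (Collect closed)" "sets N = sigma_sets UNIV (Collect closed)"
      using M(2) N(2) by (simp_all add: borel_eq_closed)
    show "emeasure M UNIV \<noteq> \<infinity>" for i :: nat
      using finite_measure.emeasure_finite[OF prob_space.finite_measure[OF M(1)]] by simp
  qed (use closed_eq in \<open>auto simp: Int_stable_def\<close>)
qed

section \<open>Holonomic measures\<close>

text \<open>Mixtures over a \<open>pmf\<close> cover two uses: the uniform average over the times of
  a chain, and the convex combination of two measures.\<close>

lemma
  fixes N :: "'i \<Rightarrow> 'a::topological_space measure" and p :: "'i pmf"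
  assumes N: "\<And>i. prob_space (N i)" "\<And>i. sets (N i) = sets borel"
  shows prob_space_mixture: "prob_space (measure_pmf p \<bind> N)"
    and sets_mixture: "sets (measure_pmf p \<bind> N) = sets borel"
    and AE_mixture: "\<And>A. A \<in> sets borel \<Longrightarrow> (\<And>i. AE x in N i. x \<in> A) \<Longrightarrow> AE x in measure_pmf p \<bind> N. x \<in> A"
    and integral_mixture: "\<And>(f :: 'a \<Rightarrow> real) B. f \<in> borel_measurable borel \<Longrightarrow> (\<And>x. \<bar>f x\<bar> \<le> B) \<Longrightarrow>
      (\<integral>x. f x \<partial>(measure_pmf p \<bind> N)) = (\<integral>i. (\<integral>x. f x \<partial>N i) \<partial>measure_pmf p)"
proof -
  have sub: "N i \<in> space (subprob_algebra borel)" for i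
    using N by (simp add: space_subprob_algebra prob_space_imp_subprob_space)
  then have meas [measurable]: "N \<in> measurable (measure_pmf p) (subprob_algebra borel)" by simp
  show sets: "sets (measure_pmf p \<bind> N) = sets borel"
    by (rule sets_bind) (auto simp: N)
  show "prob_space (measure_pmf p \<bind> N)"
    by (rule prob_space.prob_space_bind[OF prob_space_measure_pmf _ meas]) (simp add: N)
  show "AE x in measure_pmf p \<bind> N. x \<in> A" if [measurable]: "A \<in> sets borel" and "\<And>i. AE x in N i. x \<in> A" for A
    using that(2) by (subst AE_bind[OF meas]) auto
  show "(\<integral>x. f x \<partial>(measure_pmf p \<bind> N)) = (\<integral>i. (\<integral>x. f x \<partial>N i) \<partial>measure_pmf p)"
    if "f \<in> borel_measurable borel" "\<And>x. \<bar>f x\<bar> \<le> B" for f :: "'a \<Rightarrow> real" and B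
  proof (rule integral_bind[OF that(1) _ meas, where B' = 1 and B = B])
    show "AE i in measure_pmf p. emeasure (N i) (space (N i)) \<le> ennreal 1"
      by (rule AE_I2) (simp add: prob_space.emeasure_space_1 N)
  qed (use that measure_pmf.finite_measure_axioms in auto)
qed

lemma integrable_compact_support:
  fixes \<phi> :: "'a::t2_space \<Rightarrow> real"
  assumes "prob_space M" "sets M = sets borel" "compact X" "AE x in M. x \<in> X" "continuous_on UNIV \<phi>"
  shows "integrable M \<phi>"
proof -
  interpret prob_space M by fact
  have "bounded (\<phi> ` X)"
    by (intro compact_imp_bounded compact_continuous_image continuous_on_subset[OF assms(5)] assms(3)) auto
  then obtain B where "\<And>x. x \<in> X \<Longrightarrow> \<bar>\<phi> x\<bar> \<le> B" unfolding bounded_iff by auto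
  moreover have "\<phi> \<in> borel_measurable M"
    using borel_measurable_continuous_onI[OF assms(5)] by (simp add: measurable_cong_sets[OF assms(2) refl])
  ultimately show ?thesis using assms(4) by (intro integrable_const_bound[of _ B]) auto
qed

text \<open>Continuous integrands such as \<open>L\<close> are unbounded in q; cutting them off
  outside the common compact support changes no integral and makes them bounded.\<close>

lemma integral_mixture_compact_support:
  fixes N :: "'i \<Rightarrow> 'a::t2_space measure" and \<phi> :: "'a \<Rightarrow> real"
  assumes N: "\<And>i. prob_space (N i)" "\<And>i. sets (N i) = sets borel"
    and X: "compact X" "\<And>i. AE x in N i. x \<in> X" and \<phi>: "continuous_on UNIV \<phi>"
  shows "(\<integral>x. \<phi> x \<partial>(measure_pmf p \<bind> N)) = (\<integral>i. (\<integral>x. \<phi> x \<partial>N i) \<partial>measure_pmf p)"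
proof -
  have [measurable]: "X \<in> sets borel" using compact_imp_closed[OF X(1)] by simp
  note [measurable] = borel_measurable_continuous_onI[OF \<phi>]
  have "bounded (\<phi> ` X)"
    by (intro compact_imp_bounded compact_continuous_image continuous_on_subset[OF \<phi>] X) auto
  then obtain B where B: "B > 0" "\<And>x. x \<in> X \<Longrightarrow> \<bar>\<phi> x\<bar> \<le> B" unfolding bounded_pos by auto
  define h where "h x = indicator X x * \<phi> x" for x
  have h: "h \<in> borel_measurable borel" "\<And>x. \<bar>h x\<bar> \<le> B" unfolding h_def using B by (auto simp: indicator_def)
  have eq: "(\<integral>x. \<phi> x \<partial>M) = (\<integral>x. h x \<partial>M)" if "sets M = sets borel" "AE x in M. x \<in> X" for M
  proof (rule integral_cong_AE)
    show "AE x in M. \<phi> x = h x" using that(2) by eventually_elim (simp add: h_def)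
  qed (use h(1) borel_measurable_continuous_onI[OF \<phi>] in \<open>auto simp: measurable_cong_sets[OF that(1) refl]\<close>)
  show ?thesis
    using integral_mixture[where N = N, OF N h, of p] eq[OF sets_mixture[where N = N, OF N] AE_mixture[where N = N, OF N _ X(2)]]
      eq[OF N(2) X(2)] by simp
qed

definition smoothed :: "real \<Rightarrow> 'n::finite torus measure \<Rightarrow> 'n torus \<Rightarrow> real" where
  "smoothed \<tau> m z = (\<integral>y. heat_kernel \<tau> (y - z) \<partial>m)"

text \<open>The law of the position after the drift step and before diffusion; smoothing it gives
  \<open>holonomic_density\<close>.\<close>

definition transported :: "real \<Rightarrow> ('n::finite torus \<times> (real ^ 'n)) measure \<Rightarrow> 'n torus measure" where
  "transported \<tau> \<nu> = distr \<nu> borel (\<lambda>(x, q). x + abs_torus (\<tau> *\<^sub>R q))"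

context
  fixes \<tau> :: real and m :: "'n::finite torus measure"
  assumes tau: "\<tau> > 0" and prob: "prob_space m" and sets: "sets m = sets borel"
begin

interpretation prob_space m by (rule prob)

lemma integrable_kernel: "integrable m (\<lambda>y. heat_kernel \<tau> (y - z))"
  by (intro integrable_torus prob sets continuous_on_heat_kernel_diff tau)

lemma smoothed_bounds:
  shows "(\<And>z :: 'n torus. \<delta> \<le> heat_kernel \<tau> z) \<Longrightarrow> \<delta> \<le> smoothed \<tau> m z"
    and "(\<And>z :: 'n torus. heat_kernel \<tau> z \<le> M) \<Longrightarrow> smoothed \<tau> m z \<le> M"
  unfolding smoothed_def using integrable_kernel[of z]
  by (auto intro!: integral_ge_const integral_le_const)

lemma smoothed_pos: "smoothed \<tau> m z > 0"
proof -
  obtain \<delta> where "\<delta> > 0" "\<And>z :: 'n torus. \<delta> \<le> heat_kernel \<tau> z"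
    using heat_kernel_bounds[OF tau, where 'n = 'n] by metis
  then show ?thesis using smoothed_bounds(1)[of \<delta> z] by simp
qed

lemma smoothed_equicontinuous:
  assumes "\<And>y. \<bar>heat_kernel \<tau> (y - z) - heat_kernel \<tau> (y - w)\<bar> < e"
  shows "\<bar>smoothed \<tau> m z - smoothed \<tau> m w\<bar> \<le> e"
proof -
  have "\<bar>smoothed \<tau> m z - smoothed \<tau> m w\<bar> = \<bar>\<integral>y. heat_kernel \<tau> (y - z) - heat_kernel \<tau> (y - w) \<partial>m\<bar>"
    unfolding smoothed_def using integrable_kernel by simp
  also have "\<dots> \<le> (\<integral>y. \<bar>heat_kernel \<tau> (y - z) - heat_kernel \<tau> (y - w)\<bar> \<partial>m)" by (rule integral_abs_bound)
  also have "\<dots> \<le> e"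
    using integrable_kernel assms by (intro integral_le_const) (auto intro: less_imp_le)
  finally show ?thesis .
qed

lemma continuous_smoothed: "continuous_on UNIV (smoothed \<tau> m)"
  unfolding continuous_on_iff
proof (intro ballI allI impI)
  fix x :: "'n torus" and e :: real assume "e > 0"
  then obtain d where d: "d > 0" "\<And>x y z w :: 'n torus. dist x y < d \<Longrightarrow> dist z w < d \<Longrightarrow>
    \<bar>heat_kernel \<tau> (x - z) - heat_kernel \<tau> (y - w)\<bar> < e / 2"
    using heat_kernel_diff_uniform[OF tau, of "e / 2"] by (metis half_gt_zero)
  have "dist (smoothed \<tau> m y) (smoothed \<tau> m x) < e" if "dist y x < d" for y
  proof -
    have "\<bar>smoothed \<tau> m y - smoothed \<tau> m x\<bar> \<le> e / 2"
      by (rule smoothed_equicontinuous) (use d that in auto)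
    then show ?thesis using \<open>e > 0\<close> by (simp add: dist_real_def)
  qed
  then show "\<exists>d>0. \<forall>y\<in>UNIV. dist y x < d \<longrightarrow> dist (smoothed \<tau> m y) (smoothed \<tau> m x) < e"
    using d(1) by blast
qed

text \<open>Fubini: smoothing of measures is the adjoint of the heat convolution of
  functions.\<close>

lemma smoothed_test:
  assumes \<phi>: "continuous_on UNIV \<phi>"
  shows "(\<integral>z. smoothed \<tau> m z * \<phi> z \<partial>torus_lebesgue) = (\<integral>y. heat_conv \<tau> \<phi> y \<partial>m)"
proof -
  interpret P: pair_prob_space torus_lebesgue m
    by (intro pair_prob_space.intro pair_sigma_finite.intro prob_space_imp_sigma_finite
        torus_lebesgue.prob_space_axioms prob)
  obtain B where B: "B > 0" "\<And>x. \<bar>\<phi> x\<bar> \<le> B" using torus_bounded[OF \<phi>] by blast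
  obtain M where M: "M > 0" "\<And>z :: 'n torus. \<bar>heat_kernel \<tau> z\<bar> \<le> M"
    using torus_bounded[OF continuous_heat_kernel[OF tau, where 'n = 'n]] by blast
  have "continuous_on UNIV (\<lambda>p. heat_kernel \<tau> (snd p - fst p) * \<phi> (fst p))"
    using continuous_on_compose2[OF continuous_on_torus_diff continuous_on_swap]
    by (intro continuous_intros continuous_on_compose2[OF continuous_heat_kernel[OF tau]] continuous_on_compose2[OF \<phi>])
       (auto simp: prod.swap_def case_prod_beta)
  from borel_measurable_continuous_onI[OF this]
  have meas: "(\<lambda>p. heat_kernel \<tau> (snd p - fst p) * \<phi> (fst p)) \<in> borel_measurable (torus_lebesgue \<Otimes>\<^sub>M m)"
    by (simp add: measurable_cong_sets[OF trans[OF sets_pair_measure_cong[OF sets_torus_lebesgue sets] borel_prod[THEN arg_cong[where f = sets]]] refl])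
  have "integrable (torus_lebesgue \<Otimes>\<^sub>M m) (\<lambda>(z, y). heat_kernel \<tau> (y - z) * \<phi> z)"
  proof (rule integrable_bounded_real)
    show "prob_space (torus_lebesgue \<Otimes>\<^sub>M m)" by (rule P.prob_space_axioms)
    show "(\<lambda>(z, y). heat_kernel \<tau> (y - z) * \<phi> z) \<in> borel_measurable (torus_lebesgue \<Otimes>\<^sub>M m)"
      using meas by (simp add: case_prod_beta')
    show "\<bar>case p of (z, y) \<Rightarrow> heat_kernel \<tau> (y - z) * \<phi> z\<bar> \<le> M * B" for p
      using M B by (auto simp: case_prod_beta abs_mult intro!: mult_mono)
  qed
  from P.Fubini_integral[OF this]
  show ?thesis by (simp add: smoothed_def heat_conv_def)
qed

lemma integral_smoothed: "(\<integral>z. smoothed \<tau> m z \<partial>torus_lebesgue) = 1"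
  using smoothed_test[of "\<lambda>_. 1"] prob_space by (simp add: heat_conv_const[OF tau])

end

text \<open>Weak convergence gives convergence at each point, and the modulus of continuity of the
  kernel is shared by all smoothed measures. A finite net then makes the convergence uniform, at the
  price of three errors e/4.\<close>

lemma smoothed_uniform_limit:
  fixes m :: "nat \<Rightarrow> 'n::finite torus measure"
  assumes tau: "\<tau> > 0" and prob: "\<And>n. prob_space (m n)" "\<And>n. sets (m n) = sets borel"
    and prob': "prob_space \<Lambda>" "sets \<Lambda> = sets borel"
    and lim: "\<And>\<phi> :: 'n torus \<Rightarrow> real. continuous_on UNIV \<phi> \<Longrightarrow> (\<lambda>n. \<integral>x. \<phi> x \<partial>m n) \<longlonglongrightarrow> (\<integral>x. \<phi> x \<partial>\<Lambda>)"
  shows "uniform_limit UNIV (\<lambda>n. smoothed \<tau> (m n)) (smoothed \<tau> \<Lambda>) sequentially"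
proof (rule uniform_limitI)
  fix e :: real assume e: "e > 0"
  then obtain d where d: "d > 0" "\<And>x y z w :: 'n torus. dist x y < d \<Longrightarrow> dist z w < d \<Longrightarrow>
    \<bar>heat_kernel \<tau> (x - z) - heat_kernel \<tau> (y - w)\<bar> < e / 4"
    using heat_kernel_diff_uniform[OF tau, of "e / 4"] by (metis divide_pos_pos zero_less_numeral)
  obtain C :: "'n torus set" where C: "finite C" "UNIV \<subseteq> (\<Union>x\<in>C. ball x d)"
    using compactE_image[OF compact_UNIV_torus, of UNIV "\<lambda>x. ball x d"] d(1)
    by (metis UNIV_I UN_I centre_in_ball open_ball subsetI)
  have "\<forall>x\<in>C. \<forall>\<^sub>F n in sequentially. dist (smoothed \<tau> (m n) x) (smoothed \<tau> \<Lambda> x) < e / 4"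
  proof
    fix x
    have "(\<lambda>n. smoothed \<tau> (m n) x) \<longlonglongrightarrow> smoothed \<tau> \<Lambda> x"
      unfolding smoothed_def by (intro lim continuous_on_heat_kernel_diff tau)
    then show "\<forall>\<^sub>F n in sequentially. dist (smoothed \<tau> (m n) x) (smoothed \<tau> \<Lambda> x) < e / 4"
      using e by (metis tendsto_iff divide_pos_pos zero_less_numeral)
  qed
  then have "\<forall>\<^sub>F n in sequentially. \<forall>x\<in>C. dist (smoothed \<tau> (m n) x) (smoothed \<tau> \<Lambda> x) < e / 4"
    using C(1) by (simp add: eventually_ball_finite)
  then show "\<forall>\<^sub>F n in sequentially. \<forall>x\<in>UNIV. dist (smoothed \<tau> (m n) x) (smoothed \<tau> \<Lambda> x) < e"
  proof eventually_elim
    case (elim n)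
    show ?case
    proof
      fix z :: "'n torus"
      have "z \<in> (\<Union>x\<in>C. ball x d)" using C(2) by blast
      then obtain x where x: "x \<in> C" "dist x z < d" by auto
      have "\<bar>smoothed \<tau> (m n) x - smoothed \<tau> (m n) z\<bar> \<le> e / 4"
        by (rule smoothed_equicontinuous[OF tau prob]) (use d x in auto)
      moreover have "\<bar>smoothed \<tau> \<Lambda> x - smoothed \<tau> \<Lambda> z\<bar> \<le> e / 4"
        by (rule smoothed_equicontinuous[OF tau prob']) (use d x in auto)
      moreover have "\<bar>smoothed \<tau> (m n) x - smoothed \<tau> \<Lambda> x\<bar> < e / 4" using elim x(1) by (simp add: dist_real_def)
      ultimately show "dist (smoothed \<tau> (m n) z) (smoothed \<tau> \<Lambda> z) < e" using e unfolding dist_real_def by linarith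
    qed
  qed
qed

lemma borel_measurable_shift [measurable]:
  "(\<lambda>(x, q). x + abs_torus (\<tau> *\<^sub>R q)) \<in> borel_measurable borel"
  by (rule borel_measurable_continuous_onI[OF continuous_on_torus_shift])

lemma transported_prob:
  assumes "prob_space \<nu>" "sets \<nu> = sets borel"
  shows "prob_space (transported \<tau> \<nu>)" "sets (transported \<tau> \<nu>) = sets borel"
  unfolding transported_def using assms(2)
  by (auto intro!: prob_space.prob_space_distr[OF assms(1)] simp: measurable_cong_sets[OF assms(2) refl])

lemma integral_transported:
  fixes f :: "'n::finite torus \<Rightarrow> real"
  assumes "sets \<nu> = sets borel" "continuous_on UNIV f"
  shows "(\<integral>y. f y \<partial>transported \<tau> \<nu>) = (\<integral>(x, q). f (x + abs_torus (\<tau> *\<^sub>R q)) \<partial>\<nu>)"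
  unfolding transported_def using borel_measurable_continuous_onI[OF assms(2)]
  by (subst integral_distr) (auto simp: measurable_cong_sets[OF assms(1) refl] case_prod_beta'
      borel_measurable_shift[unfolded case_prod_beta'])

lemma holonomic_density_eq_smoothed:
  assumes "\<tau> > 0" "sets \<nu> = sets borel"
  shows "holonomic_density \<tau> \<nu> = smoothed \<tau> (transported \<tau> \<nu>)"
  unfolding holonomic_density_def smoothed_def 
  by (intro ext integral_transported[OF assms(2), symmetric] continuous_on_heat_kernel_diff assms)

lemma sets_Pr1 [simp]: "sets (Pr1 \<nu>) = sets borel" by (simp add: Pr1_def)

lemma
  assumes "prob_space \<nu>" "sets \<nu> = sets borel"
  shows prob_space_Pr1: "prob_space (Pr1 \<nu>)"
    and integral_Pr1: "\<And>f :: 'n::finite torus \<Rightarrow> real. f \<in> borel_measurable borel \<Longrightarrow> (\<integral>x. f x \<partial>Pr1 \<nu>) = (\<integral>(x, q). f x \<partial>\<nu>)"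
proof -
  have fst: "fst \<in> measurable \<nu> borel"
    unfolding measurable_cong_sets[OF assms(2) refl] by (intro borel_measurable_continuous_onI continuous_intros)
  show "prob_space (Pr1 \<nu>)" unfolding Pr1_def by (rule prob_space.prob_space_distr[OF assms(1) fst])
  show "(\<integral>x. f x \<partial>Pr1 \<nu>) = (\<integral>(x, q). f x \<partial>\<nu>)" if "f \<in> borel_measurable borel" for f :: "'n torus \<Rightarrow> real"
    unfolding Pr1_def using that by (subst integral_distr[OF fst]) (auto simp: case_prod_beta')
qed

lemma holonomic_prob:
  assumes "\<nu> \<in> holonomic \<tau>"
  shows "prob_space \<nu>" "sets \<nu> = sets borel"
  using assms by (auto simp: holonomic_def P_ell_def space_prob_algebra)

lemma density_smoothed:
  fixes m :: "'n::finite torus measure"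
  assumes "\<tau> > 0" "prob_space m" "sets m = sets borel"
  defines "M \<equiv> density torus_lebesgue (\<lambda>z. ennreal (smoothed \<tau> m z))"
  shows "prob_space M" "sets M = sets borel"
    and "\<And>f :: 'n torus \<Rightarrow> real. f \<in> borel_measurable borel \<Longrightarrow> (\<integral>x. f x \<partial>M) = (\<integral>z. smoothed \<tau> m z * f z \<partial>torus_lebesgue)"
    and "\<And>A. A \<in> sets borel \<Longrightarrow> measure M A = (LINT z:A|torus_lebesgue. smoothed \<tau> m z)"
proof -
  note c = continuous_smoothed[OF assms(1-3)] and pos = less_imp_le[OF smoothed_pos[OF assms(1-3)]]
  have meas [measurable]: "smoothed \<tau> m \<in> borel_measurable torus_lebesgue"
    using borel_measurable_continuous_onI[OF c] by (simp add: measurable_cong_sets[OF sets_torus_lebesgue refl])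
  show "sets M = sets borel" by (simp add: M_def sets_torus_lebesgue)
  show I: "(\<integral>x. f x \<partial>M) = (\<integral>z. smoothed \<tau> m z * f z \<partial>torus_lebesgue)"
    if "f \<in> borel_measurable borel" for f :: "'n torus \<Rightarrow> real"
    unfolding M_def using that pos
    by (subst integral_density) (auto simp: measurable_cong_sets[OF sets_torus_lebesgue refl])
  have "emeasure M (space M) = (\<integral>\<^sup>+z. ennreal (smoothed \<tau> m z) \<partial>torus_lebesgue)"
    unfolding M_def by (simp add: emeasure_density)
  also have "\<dots> = ennreal (\<integral>z. smoothed \<tau> m z \<partial>torus_lebesgue)"
    using pos by (intro nn_integral_eq_integral integrable_torus_lebesgue c) auto
  also have "\<dots> = 1" using integral_smoothed[OF assms(1-3)] by simp
  finally show p: "prob_space M" by (rule prob_spaceI)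
  show "measure M A = (LINT z:A|torus_lebesgue. smoothed \<tau> m z)" if "A \<in> sets borel" for A
  proof -
    have "measure M A = (\<integral>x. indicator A x \<partial>M)" using that by (simp add: M_def sets_torus_lebesgue)
    also have "\<dots> = (\<integral>z. smoothed \<tau> m z * indicator A z \<partial>torus_lebesgue)" using that by (intro I) simp
    finally show ?thesis by (simp add: set_lebesgue_integral_def mult.commute)
  qed
qed

text \<open>Turns the identity on Borel sets into an equality of measures, so that first marginals
  can be integrated and compared through their densities.\<close>

lemma holonomic_iff_density:
  assumes "\<tau> > 0"
  shows "\<nu> \<in> holonomic \<tau> \<longleftrightarrow> \<nu> \<in> P_ell \<and> Pr1 \<nu> = density torus_lebesgue (\<lambda>z. ennreal (holonomic_density \<tau> \<nu> z))"
proof (cases "\<nu> \<in> P_ell")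
  case True
  then have \<nu>: "prob_space \<nu>" "sets \<nu> = sets borel" by (auto simp: P_ell_def space_prob_algebra)
  note s = transported_prob[OF \<nu>, of \<tau>]
  let ?M = "density torus_lebesgue (\<lambda>z. ennreal (smoothed \<tau> (transported \<tau> \<nu>) z))"
  interpret M: prob_space ?M by (rule density_smoothed(1)[OF assms s])
  interpret Pr: prob_space "Pr1 \<nu>" by (rule prob_space_Pr1[OF \<nu>])
  have "(\<forall>A\<in>sets borel. measure (Pr1 \<nu>) A = (LINT z:A|torus_lebesgue. smoothed \<tau> (transported \<tau> \<nu>) z)) \<longleftrightarrow>
      (\<forall>A\<in>sets borel. measure (Pr1 \<nu>) A = measure ?M A)"
    using density_smoothed(4)[OF assms s] by simp
  also have "\<dots> \<longleftrightarrow> Pr1 \<nu> = ?M"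
  proof
    assume "\<forall>A\<in>sets borel. measure (Pr1 \<nu>) A = measure ?M A"
    then show "Pr1 \<nu> = ?M"
      by (intro measure_eqI) (auto simp: sets_torus_lebesgue Pr.emeasure_eq_measure M.emeasure_eq_measure)
  qed simp
  finally show ?thesis
    using True by (simp add: holonomic_def holonomic_density_eq_smoothed[OF assms \<nu>(2)])
qed (simp add: holonomic_def)

text \<open>The weak form of holonomy: the first marginal is preserved by drift followed by
  diffusion. In this form the condition is linear in the measure and passes to weak limits.\<close>

lemma holonomic_iff_test:
  fixes \<nu> :: "('n::finite torus \<times> (real ^ 'n)) measure"
  assumes tau: "\<tau> > 0"
  shows "\<nu> \<in> holonomic \<tau> \<longleftrightarrow> \<nu> \<in> P_ell \<and> (\<forall>\<phi>. continuous_on UNIV \<phi> \<longrightarrow>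
    (\<integral>(x, q). \<phi> x \<partial>\<nu>) = (\<integral>(x, q). heat_conv \<tau> \<phi> (x + abs_torus (\<tau> *\<^sub>R q)) \<partial>\<nu>))"
proof (cases "\<nu> \<in> P_ell")
  case True
  then have \<nu>: "prob_space \<nu>" "sets \<nu> = sets borel" by (auto simp: P_ell_def space_prob_algebra)
  note s = transported_prob[OF \<nu>, of \<tau>]
  let ?M = "density torus_lebesgue (\<lambda>z. ennreal (smoothed \<tau> (transported \<tau> \<nu>) z))"
  have M: "(\<integral>x. \<phi> x \<partial>?M) = (\<integral>(x, q). heat_conv \<tau> \<phi> (x + abs_torus (\<tau> *\<^sub>R q)) \<partial>\<nu>)"
    if "continuous_on UNIV \<phi>" for \<phi>
    using density_smoothed(3)[OF tau s borel_measurable_continuous_onI[OF that]] smoothed_test[OF tau s that]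
      integral_transported[OF \<nu>(2) continuous_heat_conv[OF tau that]] by simp
  have Pr: "(\<integral>x. \<phi> x \<partial>Pr1 \<nu>) = (\<integral>(x, q). \<phi> x \<partial>\<nu>)" if "continuous_on UNIV \<phi>" for \<phi> :: "'n torus \<Rightarrow> real"
    using integral_Pr1[OF \<nu> borel_measurable_continuous_onI[OF that]] .
  have "\<nu> \<in> holonomic \<tau> \<longleftrightarrow> Pr1 \<nu> = ?M"
    using True by (simp add: holonomic_iff_density[OF tau] holonomic_density_eq_smoothed[OF tau \<nu>(2)])
  also have "\<dots> \<longleftrightarrow> (\<forall>\<phi> :: 'n torus \<Rightarrow> real. continuous_on UNIV \<phi> \<longrightarrow> (\<integral>x. \<phi> x \<partial>Pr1 \<nu>) = (\<integral>x. \<phi> x \<partial>?M))"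
    by (auto intro!: measure_eqI_continuous[OF prob_space_Pr1[OF \<nu>] sets_Pr1 density_smoothed(1,2)[OF tau s]])
  finally show ?thesis using True M Pr by simp
qed (simp add: holonomic_def)

lemma holonomic_integral_fst:
  fixes f :: "'n::finite torus \<Rightarrow> real"
  assumes "\<tau> > 0" "\<nu> \<in> holonomic \<tau>" "f \<in> borel_measurable borel"
  shows "(\<integral>(x, q). f x \<partial>\<nu>) = (\<integral>z. holonomic_density \<tau> \<nu> z * f z \<partial>torus_lebesgue)"
proof -
  note \<nu> = holonomic_prob[OF assms(2)]
  have "(\<integral>(x, q). f x \<partial>\<nu>) = (\<integral>x. f x \<partial>Pr1 \<nu>)" using integral_Pr1[OF \<nu> assms(3)] by simp
  also have "Pr1 \<nu> = density torus_lebesgue (\<lambda>z. ennreal (smoothed \<tau> (transported \<tau> \<nu>) z))"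
    using assms(2) by (simp add: holonomic_iff_density[OF assms(1)] holonomic_density_eq_smoothed[OF assms(1) \<nu>(2)])
  finally show ?thesis
    using density_smoothed(3)[OF assms(1) transported_prob[OF \<nu>] assms(3)] by (simp add: holonomic_density_eq_smoothed[OF assms(1) \<nu>(2)])
qed

lemma continuous_fst_torus:
  fixes f :: "'n::finite torus \<Rightarrow> real"
  shows "continuous_on UNIV f \<Longrightarrow> continuous_on UNIV (\<lambda>(x, q :: real ^ 'n). f x)"
  unfolding case_prod_beta by (erule continuous_on_compose2) (auto intro!: continuous_intros)

lemma integrable_fst_torus:
  fixes f :: "'n::finite torus \<Rightarrow> real" and \<nu> :: "('n torus \<times> (real ^ 'n)) measure"
  assumes "prob_space \<nu>" "sets \<nu> = sets borel" "continuous_on UNIV f"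
  shows "integrable \<nu> (\<lambda>(x, q). f x)"
proof -
  obtain B where "\<And>x. \<bar>f x\<bar> \<le> B" using torus_bounded[OF assms(3)] by blast
  then show ?thesis
    using borel_measurable_continuous_onI[OF continuous_fst_torus[OF assms(3)]]
    by (intro integrable_bounded_real[OF assms(1), of _ B]) (auto simp: measurable_cong_sets[OF assms(2) refl])
qed

text \<open>The Krylov-Bogolyubov construction. For the chain driven by the feedback
  \<open>s\<close>, the defect of invariance of the average over N times telescopes to the
  difference of the first and the last law, divided by N. Since \<open>s\<close> is only Borel, weak
  limits of these averages may leave its graph, so the estimate is phrased for joint laws of
  position and control.\<close>

lemma markov_average:
  fixes s :: "'n::finite torus \<Rightarrow> real ^ 'n"
  assumes tau: "\<tau> > 0" and s: "s \<in> borel_measurable borel" and N: "N > 0"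
  obtains \<nu> :: "('n torus \<times> (real ^ 'n)) measure" where "prob_space \<nu>" "sets \<nu> = sets borel"
    "\<And>A. A \<in> sets borel \<Longrightarrow> (\<And>x. (x, s x) \<in> A) \<Longrightarrow> AE p in \<nu>. p \<in> A"
    "\<And>\<phi> B. continuous_on UNIV \<phi> \<Longrightarrow> (\<And>x. \<bar>\<phi> x\<bar> \<le> B) \<Longrightarrow>
      \<bar>(\<integral>(x, q). \<phi> x \<partial>\<nu>) - (\<integral>(x, q). heat_conv \<tau> \<phi> (x + abs_torus (\<tau> *\<^sub>R q)) \<partial>\<nu>)\<bar> \<le> 2 * B / real N"
proof -
  have graph [measurable]: "(\<lambda>x. (x, s x)) \<in> borel_measurable borel"
    using s by (intro borel_measurable_Pair) auto
  define T where "T m = distr m borel (\<lambda>x. (x, s x))" for m :: "'n torus measure"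
  \<comment> \<open>The law at time k of the chain started from Lebesgue measure: move from x by
    \<tau> times s x, then diffuse.\<close>
  define m where "m k = ((\<lambda>m. density torus_lebesgue (\<lambda>z. ennreal (smoothed \<tau> (transported \<tau> (T m)) z))) ^^ k) torus_lebesgue" for k
  have m_Suc: "m (Suc k) = density torus_lebesgue (\<lambda>z. ennreal (smoothed \<tau> (transported \<tau> (T (m k))) z))" for k
    by (simp add: m_def)
  have T: "prob_space (T m)" "sets (T m) = sets borel" if "prob_space m" "sets m = sets borel" for m
    unfolding T_def using graph that(2)
    by (auto intro!: prob_space.prob_space_distr[OF that(1)] simp: measurable_cong_sets[OF that(2) refl])
  have m: "prob_space (m k) \<and> sets (m k) = sets borel" for k
  proof (induction k)
    case 0
    then show ?case using prob_space_torus_lebesgue by (simp add: m_def sets_torus_lebesgue)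
  next
    case (Suc k)
    then show ?case unfolding m_Suc using density_smoothed(1,2)[OF tau transported_prob[OF T]] by blast
  qed
  define \<nu> where "\<nu> = measure_pmf (pmf_of_set {..<N}) \<bind> (\<lambda>k. T (m k))"
  have Tm: "\<And>k. prob_space (T (m k))" "\<And>k. sets (T (m k)) = sets borel" using T m by auto
  have avg: "(\<integral>p. g p \<partial>\<nu>) = (\<Sum>k<N. \<integral>p. g p \<partial>T (m k)) / real N"
    if "g \<in> borel_measurable borel" "\<And>p. \<bar>g p\<bar> \<le> B" for g :: "_ \<Rightarrow> real" and B
    unfolding \<nu>_def using N
    by (subst integral_mixture[where N = "\<lambda>k. T (m k)", OF Tm that]) (auto simp: integral_pmf_of_set lessThan_empty_iff)
  show ?thesis
  proof (rule that)
    show "prob_space \<nu>" "sets \<nu> = sets borel"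
      unfolding \<nu>_def using prob_space_mixture[where N = "\<lambda>k. T (m k)", OF Tm]
        sets_mixture[where N = "\<lambda>k. T (m k)", OF Tm] by auto
    show "AE p in \<nu>. p \<in> A" if "A \<in> sets borel" "\<And>x. (x, s x) \<in> A" for A
      unfolding \<nu>_def
    proof (rule AE_mixture[where N = "\<lambda>k. T (m k)", OF Tm that(1)])
      fix k
      show "AE p in T (m k). p \<in> A"
        unfolding T_def using that m[of k] graph
        by (subst AE_distr_iff) (auto simp: measurable_cong_sets[of "m k" borel borel borel])
    qed
  next
    fix \<phi> :: "'n torus \<Rightarrow> real" and B assume \<phi>: "continuous_on UNIV \<phi>" and B: "\<And>x. \<bar>\<phi> x\<bar> \<le> B"
    note c = continuous_heat_conv[OF tau \<phi>]
    have hB: "\<bar>heat_conv \<tau> \<phi> y\<bar> \<le> B" for y by (rule abs_heat_conv_le[OF tau \<phi> B])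
    have c2: "continuous_on UNIV (\<lambda>(x, q). heat_conv \<tau> \<phi> (x + abs_torus (\<tau> *\<^sub>R q :: real ^ 'n)))"
      using continuous_on_compose2[OF c continuous_on_torus_shift[of \<tau>]] by (simp add: case_prod_beta)
    note c1 = continuous_fst_torus[OF \<phi>]
    have i1: "(\<integral>(x, q). \<phi> x \<partial>T (m k)) = (\<integral>x. \<phi> x \<partial>m k)" for k
      unfolding T_def using m[of k] graph borel_measurable_continuous_onI[OF c1]
      by (subst integral_distr) (auto simp: measurable_cong_sets[of "m k" borel borel borel])
    have i2: "(\<integral>(x, q). heat_conv \<tau> \<phi> (x + abs_torus (\<tau> *\<^sub>R q)) \<partial>T (m k)) = (\<integral>x. \<phi> x \<partial>m (Suc k))" for k
      unfolding m_Suc density_smoothed(3)[OF tau transported_prob[OF Tm] borel_measurable_continuous_onI[OF \<phi>]]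
        smoothed_test[OF tau transported_prob[OF Tm] \<phi>] integral_transported[OF Tm(2) c] ..
    have "(\<integral>(x, q). \<phi> x \<partial>\<nu>) - (\<integral>(x, q). heat_conv \<tau> \<phi> (x + abs_torus (\<tau> *\<^sub>R q)) \<partial>\<nu>) =
        ((\<Sum>k<N. \<integral>x. \<phi> x \<partial>m k) - (\<Sum>k<N. \<integral>x. \<phi> x \<partial>m (Suc k))) / real N"
      by (subst (1 2) avg[where B = B])
         (auto simp: i1 i2 diff_divide_distrib B hB borel_measurable_continuous_onI[OF c1] borel_measurable_continuous_onI[OF c2])
    also have "(\<Sum>k<N. \<integral>x. \<phi> x \<partial>m k) - (\<Sum>k<N. \<integral>x. \<phi> x \<partial>m (Suc k)) = (\<integral>x. \<phi> x \<partial>m 0) - (\<integral>x. \<phi> x \<partial>m N)"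
      unfolding sum_subtractf[symmetric] by (rule sum_lessThan_telescope')
    finally have eq: "(\<integral>(x, q). \<phi> x \<partial>\<nu>) - (\<integral>(x, q). heat_conv \<tau> \<phi> (x + abs_torus (\<tau> *\<^sub>R q)) \<partial>\<nu>) =
        ((\<integral>x. \<phi> x \<partial>m 0) - (\<integral>x. \<phi> x \<partial>m N)) / real N" .
    have bd: "\<bar>\<integral>x. \<phi> x \<partial>m k\<bar> \<le> B" for k
    proof -
      interpret prob_space "m k" using m by blast
      have i: "integrable (m k) \<phi>" using m \<phi> by (intro integrable_torus) auto
      have "\<bar>\<integral>x. \<phi> x \<partial>m k\<bar> \<le> (\<integral>x. \<bar>\<phi> x\<bar> \<partial>m k)" by (rule integral_abs_bound)
      also have "\<dots> \<le> B" using i B by (intro integral_le_const) auto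
      finally show ?thesis .
    qed
    have "\<bar>(\<integral>x. \<phi> x \<partial>m 0) - (\<integral>x. \<phi> x \<partial>m N)\<bar> \<le> 2 * B" using bd[of 0] bd[of N] by linarith
    then show "\<bar>(\<integral>(x, q). \<phi> x \<partial>\<nu>) - (\<integral>(x, q). heat_conv \<tau> \<phi> (x + abs_torus (\<tau> *\<^sub>R q)) \<partial>\<nu>)\<bar> \<le> 2 * B / real N"
      unfolding eq abs_divide using N by (simp add: divide_right_mono)
  qed
qed

context discrete_mfg
begin

text \<open>A common compact support gives weak sequential compactness and turns the unbounded
  \<open>L\<close> into a legitimate test function.\<close>

definition admissible :: "real \<Rightarrow> ('n torus \<times> (real ^ 'n)) measure set" where
  "admissible K = {\<nu> \<in> holonomic \<tau>. AE p in \<nu>. p \<in> UNIV \<times> cball 0 K}"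

lemma compact_bundle: "compact ((UNIV :: 'n torus set) \<times> cball (0 :: real ^ 'n) K)"
  by (intro compact_Times compact_UNIV_torus) simp

lemma P_ell_bundle:
  fixes \<nu> :: "('n torus \<times> (real ^ 'n)) measure"
  assumes "prob_space \<nu>" "sets \<nu> = sets borel" "AE p in \<nu>. p \<in> UNIV \<times> cball 0 K"
  shows "\<nu> \<in> P_ell"
proof -
  have "integrable \<nu> (\<lambda>(x, q). norm q)"
    using assms compact_bundle
    by (intro integrable_compact_support[where X = "UNIV \<times> cball 0 K"]) (auto simp: case_prod_beta intro!: continuous_intros)
  then show ?thesis using assms by (simp add: P_ell_def space_prob_algebra)
qed

lemma integrable_admissible:
  assumes "\<nu> \<in> admissible K" "continuous_on UNIV g"
  shows "integrable \<nu> (g :: _ \<Rightarrow> real)"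
  using assms compact_bundle holonomic_prob[of \<nu> \<tau>]
  by (intro integrable_compact_support[where X = "UNIV \<times> cball 0 K"]) (auto simp: admissible_def)

lemma continuous_slack:
  assumes "continuous_on UNIV u" "continuous_on UNIV f"
  shows "continuous_on UNIV (\<lambda>(x, q). slack f u \<rho> x q)"
  using continuous_payoff[OF assms(1)] continuous_fst_torus[OF assms(1)] continuous_fst_torus[OF assms(2)]
  unfolding slack_def case_prod_beta by (intro continuous_intros)

text \<open>Holonomy cancels u against its heat convolution, leaving only the action, the coupling
  and \<rho>.\<close>

lemma integral_slack:
  assumes \<nu>: "\<nu> \<in> holonomic \<tau>" and L: "integrable \<nu> (\<lambda>(x, q). L x q)"
    and u: "continuous_on UNIV u" and f: "continuous_on UNIV f"
  shows "integrable \<nu> (\<lambda>(x, q). slack f u \<rho> x q)"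
    and "(\<integral>(x, q). slack f u \<rho> x q \<partial>\<nu>) = \<tau> * ((\<integral>(x, q). L x q \<partial>\<nu>) + (\<integral>(x, q). f x \<partial>\<nu>) + \<rho>)"
proof -
  note p = holonomic_prob[OF \<nu>]
  interpret prob_space \<nu> by (rule p(1))
  note b1 = integrable_fst_torus[OF p, unfolded case_prod_beta']
  have b2: "integrable \<nu> (\<lambda>p. heat_conv \<tau> u (fst p + abs_torus (\<tau> *\<^sub>R snd p)))"
  proof -
    obtain B where "\<And>x. \<bar>heat_conv \<tau> u x\<bar> \<le> B" using torus_bounded[OF continuous_heat_conv[OF tau_pos u]] by blast
    then show ?thesis
      using borel_measurable_continuous_onI[OF continuous_heat_conv_shift[OF u]]
      by (intro integrable_bounded_real[OF p(1), of _ B]) (auto simp: measurable_cong_sets[OF p(2) refl] case_prod_beta')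
  qed
  have L': "integrable \<nu> (\<lambda>p. L (fst p) (snd p))" using L by (simp add: case_prod_beta')
  note i [simp] = b1[OF u] b1[OF f] b2 L'
  have eq: "(\<lambda>p. slack f u \<rho> (fst p) (snd p)) = (\<lambda>p. u (fst p) + \<tau> * f (fst p) + \<tau> * \<rho> -
      (heat_conv \<tau> u (fst p + abs_torus (\<tau> *\<^sub>R snd p)) - \<tau> * L (fst p) (snd p)))"
    by (simp add: slack_def payoff_def)
  show "integrable \<nu> (\<lambda>(x, q). slack f u \<rho> x q)" unfolding case_prod_beta' eq by simp
  have "(\<integral>p. u (fst p) \<partial>\<nu>) = (\<integral>p. heat_conv \<tau> u (fst p + abs_torus (\<tau> *\<^sub>R snd p)) \<partial>\<nu>)"
    using \<nu> u by (simp add: holonomic_iff_test[OF tau_pos] case_prod_beta')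
  then show "(\<integral>(x, q). slack f u \<rho> x q \<partial>\<nu>) = \<tau> * ((\<integral>(x, q). L x q \<partial>\<nu>) + (\<integral>(x, q). f x \<partial>\<nu>) + \<rho>)"
    unfolding case_prod_beta' eq using prob_space by (simp add: distrib_left)
qed

lemma slack_nonneg:
  assumes "continuous_on UNIV u" "\<And>x. lax \<tau> L u x = u x + \<tau> * f x + \<tau> * \<rho>"
  shows "0 \<le> slack f u \<rho> x q"
  using lax_ge[OF assms(1), of x q] assms(2)[of x] by (simp add: slack_def)

lemma weak_duality:
  assumes \<nu>: "\<nu> \<in> holonomic \<tau>" and L: "integrable \<nu> (\<lambda>(x, q). L x q)"
    and u: "continuous_on UNIV u" and f: "continuous_on UNIV f"
    and eq: "\<And>x. lax \<tau> L u x = u x + \<tau> * f x + \<tau> * \<rho>"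
  shows "- \<rho> \<le> (\<integral>(x, q). L x q \<partial>\<nu>) + (\<integral>(x, q). f x \<partial>\<nu>)"
proof -
  have "0 \<le> (\<integral>(x, q). slack f u \<rho> x q \<partial>\<nu>)"
    using slack_nonneg[OF u eq] by (intro integral_nonneg_AE) (auto simp: case_prod_beta')
  then show ?thesis using integral_slack(2)[OF \<nu> L u f, of \<rho>] tau_pos by (simp add: zero_le_mult_iff)
qed

text \<open>Holonomy is demanded only asymptotically, so that the lemma covers both averages of
  chains, where the defect tends to 0, and sequences of measures that are already holonomic.\<close>

lemma limit_admissible:
  assumes N: "\<And>n. prob_space (N n)" "\<And>n. sets (N n) = sets borel"
    and M: "prob_space M" "sets M = sets borel" "AE p in M. p \<in> UNIV \<times> cball 0 K"
    and lim: "\<And>g :: _ \<Rightarrow> real. continuous_on UNIV g \<Longrightarrow> (\<lambda>n. \<integral>p. g p \<partial>N n) \<longlonglongrightarrow> (\<integral>p. g p \<partial>M)"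
    and hol: "\<And>\<phi>. continuous_on UNIV \<phi> \<Longrightarrow> (\<lambda>n. (\<integral>(x, q). \<phi> x \<partial>N n) -
      (\<integral>(x, q). heat_conv \<tau> \<phi> (x + abs_torus (\<tau> *\<^sub>R q)) \<partial>N n)) \<longlonglongrightarrow> 0"
  shows "M \<in> admissible K"
proof -
  have "M \<in> holonomic \<tau>"
    unfolding holonomic_iff_test[OF tau_pos]
  proof (intro conjI allI impI)
    show "M \<in> P_ell" by (rule P_ell_bundle[OF M])
    fix \<phi> :: "'n torus \<Rightarrow> real" assume \<phi>: "continuous_on UNIV \<phi>"
    have "(\<lambda>n. (\<integral>(x, q). \<phi> x \<partial>N n) - (\<integral>(x, q). heat_conv \<tau> \<phi> (x + abs_torus (\<tau> *\<^sub>R q)) \<partial>N n))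
        \<longlonglongrightarrow> (\<integral>(x, q). \<phi> x \<partial>M) - (\<integral>(x, q). heat_conv \<tau> \<phi> (x + abs_torus (\<tau> *\<^sub>R q)) \<partial>M)"
      by (intro tendsto_diff lim continuous_fst_torus continuous_heat_conv_shift \<phi>)
    then have "(\<integral>(x, q). \<phi> x \<partial>M) - (\<integral>(x, q). heat_conv \<tau> \<phi> (x + abs_torus (\<tau> *\<^sub>R q)) \<partial>M) = 0"
      using hol[OF \<phi>] LIMSEQ_unique by blast
    then show "(\<integral>(x, q). \<phi> x \<partial>M) = (\<integral>(x, q). heat_conv \<tau> \<phi> (x + abs_torus (\<tau> *\<^sub>R q)) \<partial>M)" by simp
  qed
  then show ?thesis using M(3) by (simp add: admissible_def)
qed

text \<open>The tolerance \<open>e\<close> allows controls from a countable dense set, among which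
  the least index that works is a Borel function of x.\<close>

lemma almost_optimal_selection:
  assumes u: "continuous_on UNIV u" and f: "continuous_on UNIV f"
    and eq: "\<And>x. lax \<tau> L u x = u x + \<tau> * f x + \<tau> * \<rho>" and "e > 0"
  obtains s where "s \<in> borel_measurable borel" "\<And>x. slack f u \<rho> x (s x) < e"
proof -
  obtain D :: "(real ^ 'n) set" where D: "countable D" "\<And>X. open X \<Longrightarrow> X \<noteq> {} \<Longrightarrow> \<exists>d\<in>D. d \<in> X"
    using countable_dense_setE by metis
  have Dne: "D \<noteq> {}" using D(2)[OF open_UNIV] by auto
  define p where "p i = from_nat_into D i" for i
  have ex: "\<exists>i. slack f u \<rho> x (p i) < e" for x
  proof -
    obtain q where "lax \<tau> L u x = payoff u x q" using lax_attained[OF u] by blast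
    then have q: "slack f u \<rho> x q = 0" using eq[of x] by (simp add: slack_def)
    have "continuous_on UNIV (slack f u \<rho> x)"
      using continuous_on_compose2[OF continuous_slack[OF u f, of \<rho>], of UNIV "\<lambda>q. (x, q)"]
      by (simp add: continuous_on_Pair continuous_on_id)
    then have "open (slack f u \<rho> x -` {..<e})" by (intro open_vimage) auto
    moreover have "q \<in> slack f u \<rho> x -` {..<e}" using q \<open>e > 0\<close> by simp
    ultimately obtain d where "d \<in> D" "slack f u \<rho> x d < e" using D(2) by (metis empty_iff lessThan_iff vimageE)
    then show ?thesis using from_nat_into_surj[OF D(1)] unfolding p_def by metis
  qed
  define s where "s x = p (LEAST i. slack f u \<rho> x (p i) < e)" for x
  show ?thesis
  proof (rule that)
    have "(\<lambda>x. slack f u \<rho> x (p i)) \<in> borel_measurable borel" for i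
      using continuous_on_compose2[OF continuous_slack[OF u f, of \<rho>], of UNIV "\<lambda>x. (x, p i)"]
      by (intro borel_measurable_continuous_onI) (simp add: continuous_on_Pair continuous_on_id)
    then have [measurable]: "Measurable.pred borel (\<lambda>x. slack f u \<rho> x (p i) < e)" for i by measurable
    have "(\<lambda>x. LEAST i. slack f u \<rho> x (p i) < e) \<in> measurable borel (count_space UNIV)" by measurable
    then show "s \<in> borel_measurable borel"
      unfolding s_def by (rule measurable_compose) simp
    show "slack f u \<rho> x (s x) < e" for x unfolding s_def using ex[of x] by (rule LeastI_ex)
  qed
qed

text \<open>Attainment in \<open>weak_duality\<close>: along averages of almost optimal chains both
  the slack and the holonomy defect vanish, and a weak limit inherits slack integral at most
  0.\<close>

lemma optimal_admissible:
  assumes u: "continuous_on UNIV u" and f: "continuous_on UNIV f"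
    and eq: "\<And>x. lax \<tau> L u x = u x + \<tau> * f x + \<tau> * \<rho>"
    and K: "\<And>x q. slack f u \<rho> x q \<le> 1 \<Longrightarrow> norm q \<le> K"
  obtains \<nu> where "\<nu> \<in> admissible K" "(\<integral>(x, q). L x q \<partial>\<nu>) + (\<integral>(x, q). f x \<partial>\<nu>) = - \<rho>"
proof -
  have "\<exists>\<nu> :: ('n torus \<times> (real ^ 'n)) measure. prob_space \<nu> \<and> sets \<nu> = sets borel \<and>
      (AE p in \<nu>. p \<in> UNIV \<times> cball 0 K) \<and> (\<integral>(x, q). slack f u \<rho> x q \<partial>\<nu>) \<le> 1 / real (Suc n) \<and>
      (\<forall>\<phi> B. continuous_on UNIV \<phi> \<longrightarrow> (\<forall>x. \<bar>\<phi> x\<bar> \<le> B) \<longrightarrow>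
      \<bar>(\<integral>(x, q). \<phi> x \<partial>\<nu>) - (\<integral>(x, q). heat_conv \<tau> \<phi> (x + abs_torus (\<tau> *\<^sub>R q)) \<partial>\<nu>)\<bar> \<le> 2 * B / real (Suc n))" for n
  proof -
    \<comment> \<open>The tolerance must not exceed 1, the slack up to which \<open>K\<close> bounds
      the controls.\<close>
    have e: "1 / real (Suc n) > 0" "1 / real (Suc n) \<le> 1" by auto
    obtain s where s: "s \<in> borel_measurable borel" "\<And>x. slack f u \<rho> x (s x) < 1 / real (Suc n)"
      using almost_optimal_selection[OF u f eq e(1)] by blast
    obtain \<nu> :: "('n torus \<times> (real ^ 'n)) measure" where \<nu>: "prob_space \<nu>" "sets \<nu> = sets borel"
      "\<And>A. A \<in> sets borel \<Longrightarrow> (\<And>x. (x, s x) \<in> A) \<Longrightarrow> AE p in \<nu>. p \<in> A"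
      "\<And>\<phi> B. continuous_on UNIV \<phi> \<Longrightarrow> (\<And>x. \<bar>\<phi> x\<bar> \<le> B) \<Longrightarrow>
      \<bar>(\<integral>(x, q). \<phi> x \<partial>\<nu>) - (\<integral>(x, q). heat_conv \<tau> \<phi> (x + abs_torus (\<tau> *\<^sub>R q)) \<partial>\<nu>)\<bar> \<le> 2 * B / real (Suc n)"
      using markov_average[OF tau_pos s(1), of "Suc n"] by blast
    interpret prob_space \<nu> by (rule \<nu>(1))
    have sK: "norm (s x) \<le> K" for x using K[of x "s x"] s(2)[of x] e(2) by simp
    have AE1: "AE p in \<nu>. p \<in> UNIV \<times> cball 0 K"
      using sK compact_imp_closed[OF compact_bundle] by (intro \<nu>(3)) auto
    have cl: "closed {p. (case p of (x, q) \<Rightarrow> slack f u \<rho> x q) \<le> 1 / real (Suc n)}"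
      by (intro closed_Collect_le continuous_slack u f continuous_intros)
    have AE2: "AE p in \<nu>. p \<in> {p. (case p of (x, q) \<Rightarrow> slack f u \<rho> x q) \<le> 1 / real (Suc n)}"
      using s(2) cl by (intro \<nu>(3)) (auto intro: less_imp_le)
    have "integrable \<nu> (\<lambda>(x, q). slack f u \<rho> x q)"
      by (rule integrable_compact_support[OF \<nu>(1,2) compact_bundle AE1 continuous_slack[OF u f]])
    then have "(\<integral>(x, q). slack f u \<rho> x q \<partial>\<nu>) \<le> 1 / real (Suc n)"
      using AE2 by (intro integral_le_const) auto
    then show ?thesis using \<nu> AE1 by blast
  qed
  then obtain N where N: "\<And>n. prob_space (N n)" "\<And>n. sets (N n) = sets borel"
    "\<And>n. AE p in N n. p \<in> (UNIV :: 'n torus set) \<times> cball (0 :: real ^ 'n) K"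
    "\<And>n. (\<integral>(x, q). slack f u \<rho> x q \<partial>N n) \<le> 1 / real (Suc n)"
    "\<And>n \<phi> B. continuous_on UNIV \<phi> \<Longrightarrow> (\<And>x. \<bar>\<phi> x\<bar> \<le> B) \<Longrightarrow>
      \<bar>(\<integral>(x, q). \<phi> x \<partial>N n) - (\<integral>(x, q). heat_conv \<tau> \<phi> (x + abs_torus (\<tau> *\<^sub>R q)) \<partial>N n)\<bar> \<le> 2 * B / real (Suc n)"
    by metis
  obtain r M where r: "strict_mono r" and M: "prob_space M" "sets M = sets borel" "AE p in M. p \<in> UNIV \<times> cball 0 K"
    and lim: "\<And>g :: _ \<Rightarrow> real. continuous_on UNIV g \<Longrightarrow> (\<lambda>n. \<integral>p. g p \<partial>N (r n)) \<longlonglongrightarrow> (\<integral>p. g p \<partial>M)"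
    using weak_sequential_compactness[where \<mu> = N, OF compact_bundle N(1-3)] by metis
  have inv0: "(\<lambda>n. C / real (Suc (r n))) \<longlonglongrightarrow> 0" for C
    using LIMSEQ_subseq_LIMSEQ[OF LIMSEQ_Suc[OF lim_const_over_n[of C]] r] by (simp add: o_def)
  have adm: "M \<in> admissible K"
  proof (rule limit_admissible[OF N(1,2) M lim])
    fix \<phi> :: "'n torus \<Rightarrow> real" assume \<phi>: "continuous_on UNIV \<phi>"
    obtain B where B: "\<And>x. \<bar>\<phi> x\<bar> \<le> B" using torus_bounded[OF \<phi>] by blast
    show "(\<lambda>n. (\<integral>(x, q). \<phi> x \<partial>N (r n)) - (\<integral>(x, q). heat_conv \<tau> \<phi> (x + abs_torus (\<tau> *\<^sub>R q)) \<partial>N (r n))) \<longlonglongrightarrow> 0"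
      using N(5)[OF \<phi> B] by (intro Lim_null_comparison[OF _ inv0[of "2 * B"]]) auto
  qed
  then have hol: "M \<in> holonomic \<tau>" by (simp add: admissible_def)
  have "(\<integral>(x, q). slack f u \<rho> x q \<partial>M) \<le> 0"
    by (rule LIMSEQ_le[OF lim[OF continuous_slack[OF u f]] inv0[of 1]]) (use N(4) in auto)
  then have "(\<integral>(x, q). L x q \<partial>M) + (\<integral>(x, q). f x \<partial>M) + \<rho> \<le> 0"
    using integral_slack(2)[OF hol integrable_admissible[OF adm continuous_L] u f, of \<rho>] tau_pos
    by (simp add: mult_le_0_iff)
  then have "(\<integral>(x, q). L x q \<partial>M) + (\<integral>(x, q). f x \<partial>M) = - \<rho>"
    using weak_duality[OF hol integrable_admissible[OF adm continuous_L] u f eq] by simp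
  then show ?thesis using that adm by blast
qed

end

section \<open>Monotone couplings\<close>

lemma torus_bcontfun:
  fixes f :: "'n::finite torus \<Rightarrow> real"
  assumes "continuous_on UNIV f"
  shows "apply_bcontfun (Bcontfun f) = f"
proof -
  obtain D where "\<And>x. \<bar>f x\<bar> \<le> D" using torus_bounded[OF assms] by blast
  then have "f \<in> bcontfun" using assms by (intro bcontfun_normI[of _ D]) auto
  then show ?thesis by (rule Bcontfun_inverse)
qed

lemma bounded_linear_integral_mult:
  fixes g :: "'n::finite torus \<Rightarrow> real"
  assumes g: "continuous_on UNIV g"
  shows "bounded_linear (\<lambda>w :: 'n torus \<Rightarrow>\<^sub>C real. \<integral>z. apply_bcontfun w z * g z \<partial>torus_lebesgue)"
proof -
  obtain B where B: "B > 0" "\<And>x. \<bar>g x\<bar> \<le> B" using torus_bounded[OF g] by blast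
  have i: "integrable torus_lebesgue (\<lambda>z. apply_bcontfun w z * g z)" for w :: "'n torus \<Rightarrow>\<^sub>C real"
    by (intro integrable_torus_lebesgue continuous_intros g continuous_on_apply_bcontfun)
  show ?thesis
  proof (rule bounded_linear_intro[where K = B])
    fix v w :: "'n torus \<Rightarrow>\<^sub>C real" and c :: real
    show "(\<integral>z. apply_bcontfun (v + w) z * g z \<partial>torus_lebesgue) =
        (\<integral>z. apply_bcontfun v z * g z \<partial>torus_lebesgue) + (\<integral>z. apply_bcontfun w z * g z \<partial>torus_lebesgue)"
      using i by (simp add: plus_bcontfun.rep_eq distrib_right)
    show "(\<integral>z. apply_bcontfun (c *\<^sub>R w) z * g z \<partial>torus_lebesgue) = c *\<^sub>R (\<integral>z. apply_bcontfun w z * g z \<partial>torus_lebesgue)"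
      by (simp add: scaleR_bcontfun.rep_eq mult.assoc)
    have "\<bar>\<integral>z. apply_bcontfun w z * g z \<partial>torus_lebesgue\<bar> \<le> (\<integral>z. \<bar>apply_bcontfun w z * g z\<bar> \<partial>torus_lebesgue)"
      by (rule integral_abs_bound)
    also have "\<dots> \<le> norm w * B"
    proof (rule torus_lebesgue.integral_le_const)
      show "integrable torus_lebesgue (\<lambda>z. \<bar>apply_bcontfun w z * g z\<bar>)" using i by (rule integrable_abs)
      show "AE z in torus_lebesgue. \<bar>apply_bcontfun w z * g z\<bar> \<le> norm w * B"
        using B norm_bounded[of w] by (auto simp: abs_mult intro!: mult_mono)
    qed
    finally show "norm (\<integral>z. apply_bcontfun w z * g z \<partial>torus_lebesgue) \<le> norm w * B" by simp
  qed
qed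

text \<open>All smoothed probability measures, not only the holonomic densities: this set can be
  fixed before \<open>K\<close>, whose choice depends on the bound of the coupling over it.\<close>

definition density_set :: "real \<Rightarrow> ('n::finite torus \<Rightarrow>\<^sub>C real) set" where
  "density_set \<tau> = {w. \<exists>m. prob_space m \<and> sets m = sets borel \<and> apply_bcontfun w = smoothed \<tau> m}"

lemma smoothed_in_density_set:
  assumes "\<tau> > 0" "prob_space m" "sets m = sets borel"
  shows "Bcontfun (smoothed \<tau> m) \<in> density_set \<tau>"
  unfolding density_set_def using assms torus_bcontfun[OF continuous_smoothed[OF assms]] by blast

lemma density_set_nonempty: "\<tau> > 0 \<Longrightarrow> density_set \<tau> \<noteq> {}"
  using smoothed_in_density_set[OF _ prob_space_torus_lebesgue sets_torus_lebesgue] by blast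

text \<open>Compactness is inherited from the probability measures on the torus, as smoothing turns
  weak into uniform convergence.\<close>

lemma compact_density_set:
  assumes tau: "\<tau> > 0"
  shows "compact (density_set \<tau> :: ('n::finite torus \<Rightarrow>\<^sub>C real) set)"
  unfolding compact_eq_seq_compact_metric seq_compact_def
proof (intro allI impI)
  fix w :: "nat \<Rightarrow> 'n torus \<Rightarrow>\<^sub>C real" assume "\<forall>n. w n \<in> density_set \<tau>"
  then obtain m where m: "\<And>n. prob_space (m n)" "\<And>n. sets (m n) = sets borel" "\<And>n. apply_bcontfun (w n) = smoothed \<tau> (m n)"
    unfolding density_set_def mem_Collect_eq by metis
  have AE: "AE x in m n. x \<in> UNIV" for n by simp
  obtain r M where r: "strict_mono r" and M: "prob_space M" "sets M = sets borel"
    and lim: "\<And>\<phi> :: 'n torus \<Rightarrow> real. continuous_on UNIV \<phi> \<Longrightarrow> (\<lambda>n. \<integral>x. \<phi> x \<partial>m (r n)) \<longlonglongrightarrow> (\<integral>x. \<phi> x \<partial>M)"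
    using weak_sequential_compactness[where \<mu> = m, OF compact_UNIV_torus m(1,2) AE] by metis
  have "uniform_limit UNIV (\<lambda>n. smoothed \<tau> (m (r n))) (smoothed \<tau> M) sequentially"
    by (rule smoothed_uniform_limit[OF tau m(1,2) M lim])
  then have "(\<lambda>n. w (r n)) \<longlonglongrightarrow> Bcontfun (smoothed \<tau> M)"
    by (intro uniform_limit_tendsto_bcontfun) (simp add: m(3) torus_bcontfun[OF continuous_smoothed[OF tau M]])
  then show "\<exists>l\<in>density_set \<tau>. \<exists>r. strict_mono r \<and> (w \<circ> r) \<longlonglongrightarrow> l"
    using smoothed_in_density_set[OF tau M] r by (auto simp: o_def)
qed

section \<open>The compact convex set of moments\<close>

context discrete_mfg
begin

definition dens :: "('n torus \<times> (real ^ 'n)) measure \<Rightarrow> ('n torus \<Rightarrow>\<^sub>C real)" where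
  "dens \<nu> = Bcontfun (holonomic_density \<tau> \<nu>)"

lemma
  assumes "prob_space \<nu>" "sets \<nu> = sets borel"
  shows apply_dens: "apply_bcontfun (dens \<nu>) = holonomic_density \<tau> \<nu>"
    and dens_in: "dens \<nu> \<in> density_set \<tau>"
  using torus_bcontfun[OF continuous_smoothed[OF tau_pos transported_prob[OF assms]]]
    smoothed_in_density_set[OF tau_pos transported_prob[OF assms]]
  by (auto simp: dens_def holonomic_density_eq_smoothed[OF tau_pos assms(2)])

lemma integral_dens:
  assumes "\<nu> \<in> holonomic \<tau>" "continuous_on UNIV f"
  shows "(\<integral>z. f z * apply_bcontfun (dens \<nu>) z \<partial>torus_lebesgue) = (\<integral>(x, q). f x \<partial>\<nu>)"
  using holonomic_integral_fst[OF tau_pos assms(1) borel_measurable_continuous_onI[OF assms(2)]]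
  by (simp add: apply_dens[OF holonomic_prob[OF assms(1)]] mult.commute)

text \<open>For a fixed coupling the cost \<integral> (L + f) d\<nu> depends on \<nu> only through
  this pair, and linearly. Passing to pairs places the variational inequality in a normed
  space.\<close>

definition moments :: "real \<Rightarrow> (('n torus \<Rightarrow>\<^sub>C real) \<times> real) set" where
  "moments K = (\<lambda>\<nu>. (dens \<nu>, \<integral>(x, q). L x q \<partial>\<nu>)) ` admissible K"

lemma momentsE:
  assumes "e \<in> moments K"
  obtains \<nu> where "\<nu> \<in> admissible K" "e = (dens \<nu>, \<integral>(x, q). L x q \<partial>\<nu>)"
  using assms unfolding moments_def by auto

lemma compact_moments: "compact (moments K)"
  unfolding compact_eq_seq_compact_metric seq_compact_def
proof (intro allI impI)
  fix w :: "nat \<Rightarrow> _" assume "\<forall>n. w n \<in> moments K"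
  then have "\<forall>n. \<exists>\<nu>. \<nu> \<in> admissible K \<and> w n = (dens \<nu>, \<integral>(x, q). L x q \<partial>\<nu>)"
    by (metis momentsE)
  then obtain N where N: "\<And>n. N n \<in> admissible K" "\<And>n. w n = (dens (N n), \<integral>(x, q). L x q \<partial>N n)" by metis
  have hol: "N n \<in> holonomic \<tau>" and AE: "AE p in N n. p \<in> UNIV \<times> cball 0 K" for n
    using N(1) by (auto simp: admissible_def)
  have p: "\<And>n. prob_space (N n)" "\<And>n. sets (N n) = sets borel" using holonomic_prob[OF hol] by auto
  obtain r M where r: "strict_mono r" and M: "prob_space M" "sets M = sets borel" "AE p in M. p \<in> UNIV \<times> cball 0 K"
    and lim: "\<And>g :: _ \<Rightarrow> real. continuous_on UNIV g \<Longrightarrow> (\<lambda>n. \<integral>p. g p \<partial>N (r n)) \<longlonglongrightarrow> (\<integral>p. g p \<partial>M)"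
    using weak_sequential_compactness[where \<mu> = N, OF compact_bundle p AE] by metis
  have adm: "M \<in> admissible K"
    by (rule limit_admissible[OF p M lim]) (use hol in \<open>auto simp: holonomic_iff_test[OF tau_pos]\<close>)
  have "uniform_limit UNIV (\<lambda>n. smoothed \<tau> (transported \<tau> (N (r n)))) (smoothed \<tau> (transported \<tau> M)) sequentially"
  proof (rule smoothed_uniform_limit[OF tau_pos transported_prob[OF p] transported_prob[OF M(1,2)]])
    fix \<phi> :: "'n torus \<Rightarrow> real" assume \<phi>: "continuous_on UNIV \<phi>"
    have "continuous_on UNIV (\<lambda>(x, q :: real ^ 'n). \<phi> (x + abs_torus (\<tau> *\<^sub>R q)))"
      using continuous_on_compose2[OF \<phi> continuous_on_torus_shift[of \<tau>]] by (simp add: case_prod_beta)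
    from lim[OF this]
    show "(\<lambda>n. integral\<^sup>L (transported \<tau> (N (r n))) \<phi>) \<longlonglongrightarrow> integral\<^sup>L (transported \<tau> M) \<phi>"
      by (simp add: integral_transported[OF _ \<phi>] p M)
  qed
  then have "uniform_limit UNIV (\<lambda>n. apply_bcontfun (dens (N (r n)))) (apply_bcontfun (dens M)) sequentially"
    by (simp add: apply_dens p M holonomic_density_eq_smoothed[OF tau_pos])
  then have "(\<lambda>n. dens (N (r n))) \<longlonglongrightarrow> dens M" by (rule uniform_limit_tendsto_bcontfun)
  moreover have "(\<lambda>n. \<integral>(x, q). L x q \<partial>N (r n)) \<longlonglongrightarrow> (\<integral>(x, q). L x q \<partial>M)" by (rule lim[OF continuous_L])
  ultimately have "(w \<circ> r) \<longlonglongrightarrow> (dens M, \<integral>(x, q). L x q \<partial>M)" by (simp add: o_def N(2) tendsto_Pair)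
  then show "\<exists>l\<in>moments K. \<exists>r. strict_mono r \<and> (w \<circ> r) \<longlonglongrightarrow> l" using adm r unfolding moments_def by blast
qed

lemma convex_moments: "convex (moments K)"
  unfolding convex_alt
proof (intro ballI allI impI)
  fix e e' and t :: real assume e: "e \<in> moments K" "e' \<in> moments K" and t: "0 \<le> t \<and> t \<le> 1"
  obtain \<nu> where \<nu>: "\<nu> \<in> admissible K" "e = (dens \<nu>, \<integral>(x, q). L x q \<partial>\<nu>)"
    using e(1) by (rule momentsE)
  obtain \<nu>' where \<nu>': "\<nu>' \<in> admissible K" "e' = (dens \<nu>', \<integral>(x, q). L x q \<partial>\<nu>')"
    using e(2) by (rule momentsE)
  define N where "N b = (if b then \<nu>' else \<nu>)" for b
  have "N b \<in> admissible K" for b using \<nu>(1) \<nu>'(1) by (simp add: N_def)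
  then have hol: "N b \<in> holonomic \<tau>" and AE: "AE p in N b. p \<in> UNIV \<times> cball 0 K" for b
    by (auto simp: admissible_def)
  have p: "\<And>b. prob_space (N b)" "\<And>b. sets (N b) = sets borel" using holonomic_prob[OF hol] by auto
  \<comment> \<open>The Bernoulli variable selects \<open>\<nu>'\<close> with probability t;
    holonomy, density and action are all averaged accordingly.\<close>
  define M where "M = measure_pmf (bernoulli_pmf t) \<bind> N"
  have I: "(\<integral>p. g p \<partial>M) = (1 - t) * (\<integral>p. g p \<partial>\<nu>) + t * (\<integral>p. g p \<partial>\<nu>')"
    if "continuous_on UNIV g" for g :: "_ \<Rightarrow> real"
    unfolding M_def using t integral_mixture_compact_support[where N = N, OF p compact_bundle AE that, of "bernoulli_pmf t"]
    by (simp add: N_def mult.commute)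
  have M: "prob_space M" "sets M = sets borel"
    unfolding M_def by (rule prob_space_mixture[where N = N, OF p] sets_mixture[where N = N, OF p])+
  have AEM: "AE p in M. p \<in> UNIV \<times> cball 0 K"
    unfolding M_def using compact_imp_closed[OF compact_bundle] by (intro AE_mixture[where N = N, OF p _ AE]) auto
  have "M \<in> holonomic \<tau>"
    unfolding holonomic_iff_test[OF tau_pos]
  proof (intro conjI allI impI)
    show "M \<in> P_ell" by (rule P_ell_bundle[OF M AEM])
    fix \<phi> :: "'n torus \<Rightarrow> real" assume \<phi>: "continuous_on UNIV \<phi>"
    show "(\<integral>(x, q). \<phi> x \<partial>M) = (\<integral>(x, q). heat_conv \<tau> \<phi> (x + abs_torus (\<tau> *\<^sub>R q)) \<partial>M)"
      unfolding I[OF continuous_fst_torus[OF \<phi>]] I[OF continuous_heat_conv_shift[OF \<phi>]]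
      using \<nu>(1) \<nu>'(1) \<phi> by (simp add: admissible_def holonomic_iff_test[OF tau_pos])
  qed
  then have adm: "M \<in> admissible K" using AEM by (simp add: admissible_def)
  have "holonomic_density \<tau> M z = (1 - t) * holonomic_density \<tau> \<nu> z + t * holonomic_density \<tau> \<nu>' z" for z
    unfolding holonomic_density_def
  proof (rule I)
    show "continuous_on UNIV (\<lambda>(x, q). heat_kernel \<tau> (x + abs_torus (\<tau> *\<^sub>R q) - z))"
      using continuous_on_compose2[OF continuous_on_heat_kernel_diff(1)[OF tau_pos, of z] continuous_on_torus_shift[of \<tau>]]
      by (simp add: case_prod_beta)
  qed
  then have "dens M = (1 - t) *\<^sub>R dens \<nu> + t *\<^sub>R dens \<nu>'"
    using \<nu>(1) \<nu>'(1) M holonomic_prob[of \<nu> \<tau>] holonomic_prob[of \<nu>' \<tau>]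
    by (intro bcontfun_eqI) (simp add: admissible_def apply_dens plus_bcontfun.rep_eq scaleR_bcontfun.rep_eq)
  moreover have "(\<integral>(x, q). L x q \<partial>M) = (1 - t) * (\<integral>(x, q). L x q \<partial>\<nu>) + t * (\<integral>(x, q). L x q \<partial>\<nu>')"
    by (rule I[OF continuous_L])
  ultimately have "(1 - t) *\<^sub>R e + t *\<^sub>R e' = (dens M, \<integral>(x, q). L x q \<partial>M)" by (simp add: \<nu>(2) \<nu>'(2))
  then show "(1 - t) *\<^sub>R e + t *\<^sub>R e' \<in> moments K" using adm unfolding moments_def by blast
qed

end

text \<open>Both couplings depend on a holonomic measure only through its density; the local and the nonlocal
  one are treated together as a strictly monotone continuous operator \<open>A\<close> on the compact set of smoothed densities.\<close>

locale monotone_mfg = discrete_mfg \<tau> c L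
  for \<tau> c and L :: "'n::finite torus \<Rightarrow> real ^ 'n \<Rightarrow> real" +
  fixes G :: "'n torus \<Rightarrow> ('n torus \<times> (real ^ 'n)) measure \<Rightarrow> real"
    and A :: "('n torus \<Rightarrow>\<^sub>C real) \<Rightarrow> ('n torus \<Rightarrow>\<^sub>C real)"
  assumes continuous_A: "continuous_on (density_set \<tau>) A"
    and mono_A: "\<And>w v. w \<in> density_set \<tau> \<Longrightarrow> v \<in> density_set \<tau> \<Longrightarrow> w \<noteq> v \<Longrightarrow>
      0 < (\<integral>z. apply_bcontfun (A w - A v) z * apply_bcontfun (w - v) z \<partial>torus_lebesgue)"
    and G_eq: "\<And>\<nu> x. \<nu> \<in> holonomic \<tau> \<Longrightarrow> G x \<nu> = apply_bcontfun (A (dens \<nu>)) x"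
begin

lemma solution_exists: "\<exists>\<rho> u \<nu>. mfg_solution \<tau> L G \<rho> u \<nu>"
proof -
  have "bounded (A ` density_set \<tau>)"
    by (intro compact_imp_bounded compact_continuous_image continuous_A compact_density_set tau_pos)
  then obtain b where b: "\<And>w. w \<in> density_set \<tau> \<Longrightarrow> norm (A w) \<le> b" unfolding bounded_iff by blast
  have Ab: "\<bar>apply_bcontfun (A w) x\<bar> \<le> b" if "w \<in> density_set \<tau>" for w x
    using norm_bounded[of "A w" x] b[OF that] by simp
  obtain K where K: "\<And>f. continuous_on UNIV f \<Longrightarrow> (\<And>x. \<bar>f x\<bar> \<le> b) \<Longrightarrow>
    \<exists>u \<rho>. continuous_on UNIV u \<and> (\<forall>x. lax \<tau> L u x = u x + \<tau> * f x + \<tau> * \<rho>) \<and>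
      (\<forall>x q. slack f u \<rho> x q \<le> 1 \<longrightarrow> norm q \<le> K)"
    using ergodic_ex[of b] by metis
  have opt: "\<exists>u \<rho> \<nu>. continuous_on UNIV u \<and> (\<forall>x. lax \<tau> L u x = u x + \<tau> * apply_bcontfun (A w) x + \<tau> * \<rho>) \<and>
      \<nu> \<in> admissible K \<and> (\<integral>(x, q). L x q \<partial>\<nu>) + (\<integral>(x, q). apply_bcontfun (A w) x \<partial>\<nu>) = - \<rho>"
    if w: "w \<in> density_set \<tau>" for w
  proof -
    have c: "continuous_on UNIV (apply_bcontfun (A w))" by simp
    obtain u \<rho> where u: "continuous_on UNIV u" "\<And>x. lax \<tau> L u x = u x + \<tau> * apply_bcontfun (A w) x + \<tau> * \<rho>"
      "\<And>x q. slack (apply_bcontfun (A w)) u \<rho> x q \<le> 1 \<Longrightarrow> norm q \<le> K"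
      using K[OF c Ab[OF w]] by blast
    then show ?thesis using optimal_admissible[OF u(1) c u(2,3)] by metis
  qed
  define B where "B e e' = (\<integral>z. apply_bcontfun (fst e') z * apply_bcontfun (A (fst e)) z \<partial>torus_lebesgue) + snd e'"
    for e e' :: "('n torus \<Rightarrow>\<^sub>C real) \<times> real"
  have fst_moments: "fst e \<in> density_set \<tau>" if e: "e \<in> moments K" for e
  proof -
    obtain \<nu> where "\<nu> \<in> holonomic \<tau>" "e = (dens \<nu>, \<integral>(x, q). L x q \<partial>\<nu>)"
      using momentsE[OF e] unfolding admissible_def by blast
    then show ?thesis using dens_in[OF holonomic_prob] by simp
  qed
  have bl: "bounded_linear (B e)" for e
    unfolding B_def
    by (intro bounded_linear_add bounded_linear_snd bounded_linear_compose[OF bounded_linear_integral_mult bounded_linear_fst]) simp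
  have bilinear: "B e d = (\<integral>z. apply_bcontfun (A (fst e)) z * apply_bcontfun (fst d) z \<partial>torus_lebesgue) + snd d" for e d
    by (simp add: B_def mult.commute)
  obtain e where e: "e \<in> moments K" "\<And>s. s \<in> moments K \<Longrightarrow> 0 \<le> B e (s - e)"
  proof (rule minty_variational_inequality[where E = "moments K" and B = B, OF compact_moments convex_moments])
    obtain w :: "'n torus \<Rightarrow>\<^sub>C real" where w: "w \<in> density_set \<tau>" using density_set_nonempty[OF tau_pos] by blast
    then obtain \<nu> where "\<nu> \<in> admissible K" using opt[OF w] by blast
    then show "moments K \<noteq> {}" by (auto simp: moments_def)
    show "linear (B s)" for s using bl by (rule bounded_linear.linear)
    show "continuous_on (moments K) (B s)" for s using bl by (rule linear_continuous_on)
  next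
    fix s r assume "s \<in> moments K" "r \<in> moments K"
    then have d: "fst s \<in> density_set \<tau>" "fst r \<in> density_set \<tau>" using fst_moments by auto
    have i: "integrable torus_lebesgue (\<lambda>z. apply_bcontfun v z * apply_bcontfun w z)" for v w :: "'n torus \<Rightarrow>\<^sub>C real"
      by (intro integrable_torus_lebesgue continuous_intros continuous_on_apply_bcontfun)
    have "0 \<le> (\<integral>z. apply_bcontfun (A (fst s) - A (fst r)) z * apply_bcontfun (fst s - fst r) z \<partial>torus_lebesgue)"
      using mono_A[OF d] by (cases "fst s = fst r") (auto intro: less_imp_le)
    also have "\<dots> = B s (s - r) - B r (s - r)"
      unfolding bilinear using i[of _ "fst s - fst r"] by (simp add: minus_bcontfun.rep_eq left_diff_distrib)
    finally show "B r (s - r) \<le> B s (s - r)" by simp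
  next
    fix s r assume s: "s \<in> moments K" and r: "r \<in> moments K"
    let ?p = "\<lambda>t :: real. s + t *\<^sub>R (r - s)"
    have in_mom: "?p t \<in> moments K" if "t \<in> {0..1}" for t
    proof -
      have "?p t = (1 - t) *\<^sub>R s + t *\<^sub>R r" by (simp add: algebra_simps)
      then show ?thesis using convexD_alt[OF convex_moments s r] that by simp
    qed
    \<comment> \<open>Convexity keeps the segment inside \<open>moments K\<close>, so its first
      components stay where \<open>A\<close> is continuous.\<close>
    have "continuous_on {0..1} (\<lambda>t. A (fst (?p t)))"
    proof (rule continuous_on_compose2[OF continuous_A])
      show "continuous_on {0..1} (\<lambda>t. fst (?p t))" by (intro continuous_intros)
      show "(\<lambda>t. fst (?p t)) ` {0..1} \<subseteq> density_set \<tau>" using fst_moments[OF in_mom] by blast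
    qed
    then have "continuous_on {0..1} (\<lambda>t. B (?p t) (r - s))"
      unfolding bilinear
      by (intro continuous_on_add continuous_on_const bounded_linear.continuous_on[OF bounded_linear_integral_mult]
          continuous_on_apply_bcontfun)
    then have "((\<lambda>t. B (?p t) (r - s)) \<longlongrightarrow> B (?p 0) (r - s)) (at 0 within {0..1})"
      unfolding continuous_on_def by (rule bspec) simp
    then show "((\<lambda>t. B (?p t) (r - s)) \<longlongrightarrow> B s (r - s)) (at_right 0)"
      by (simp add: at_within_Icc_at_right)
  qed blast
  obtain \<nu> where \<nu>: "\<nu> \<in> admissible K" "e = (dens \<nu>, \<integral>(x, q). L x q \<partial>\<nu>)"
    using e(1) by (rule momentsE)
  have hol: "\<nu> \<in> holonomic \<tau>" using \<nu>(1) by (simp add: admissible_def)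
  define f where "f = apply_bcontfun (A (dens \<nu>))"
  have f: "continuous_on UNIV f" by (simp add: f_def)
  obtain u \<rho> \<nu>' where u: "continuous_on UNIV u" "\<And>x. lax \<tau> L u x = u x + \<tau> * f x + \<tau> * \<rho>"
    and \<nu>': "\<nu>' \<in> admissible K" "(\<integral>(x, q). L x q \<partial>\<nu>') + (\<integral>(x, q). f x \<partial>\<nu>') = - \<rho>"
    using opt[of "dens \<nu>"] dens_in[OF holonomic_prob[OF hol]] unfolding f_def by blast
  have hol': "\<nu>' \<in> holonomic \<tau>" using \<nu>'(1) by (simp add: admissible_def)
  have Be: "B e (dens \<mu>, \<integral>(x, q). L x q \<partial>\<mu>) = (\<integral>(x, q). f x \<partial>\<mu>) + (\<integral>(x, q). L x q \<partial>\<mu>)" if "\<mu> \<in> holonomic \<tau>" for \<mu>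
    unfolding bilinear using integral_dens[OF that f] by (simp add: \<nu>(2) f_def)
  have "B e e \<le> B e (dens \<nu>', \<integral>(x, q). L x q \<partial>\<nu>')"
    using e(2)[of "(dens \<nu>', \<integral>(x, q). L x q \<partial>\<nu>')"] \<nu>'(1) bounded_linear.linear[OF bl]
    by (simp add: moments_def linear_diff)
  then have "(\<integral>(x, q). L x q \<partial>\<nu>) + (\<integral>(x, q). f x \<partial>\<nu>) \<le> - \<rho>"
    using Be[OF hol] Be[OF hol'] \<nu>(2) \<nu>'(2) by simp
  then have val: "(\<integral>(x, q). L x q \<partial>\<nu>) + (\<integral>(x, q). f x \<partial>\<nu>) = - \<rho>"
    using weak_duality[OF hol integrable_admissible[OF \<nu>(1) continuous_L] u(1) f u(2)] by simp
  have Gf: "G x \<nu> = f x" for x using G_eq[OF hol] by (simp add: f_def)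
  have "has_bochner_integral \<nu> (\<lambda>(x, q). L x q + f x) (- \<rho>)"
    using has_bochner_integral_add[OF has_bochner_integral_integrable[OF integrable_admissible[OF \<nu>(1) continuous_L]]
      has_bochner_integral_integrable[OF integrable_admissible[OF \<nu>(1) continuous_fst_torus[OF f]]]] val
    by (simp add: case_prod_beta')
  then have "mfg_solution \<tau> L G \<rho> u \<nu>"
    using u hol Gf by (simp add: mfg_solution_def)
  then show ?thesis by blast
qed

lemma solutionD:
  assumes "mfg_solution \<tau> L G \<rho> u \<nu>"
  defines "f \<equiv> apply_bcontfun (A (dens \<nu>))"
  shows "continuous_on UNIV u" "\<nu> \<in> holonomic \<tau>" "\<And>x. lax \<tau> L u x = u x + \<tau> * f x + \<tau> * \<rho>"
    "integrable \<nu> (\<lambda>(x, q). L x q)" "(\<integral>(x, q). L x q \<partial>\<nu>) + (\<integral>(x, q). f x \<partial>\<nu>) = - \<rho>"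
proof -
  show u: "continuous_on UNIV u" and hol: "\<nu> \<in> holonomic \<tau>" using assms(1) by (auto simp: mfg_solution_def)
  have Gf: "G x \<nu> = f x" for x using G_eq[OF hol] by (simp add: f_def)
  have "\<tau> * \<rho> = lax \<tau> L u x - u x - \<tau> * f x" for x using assms(1) Gf by (simp add: mfg_solution_def)
  then show "lax \<tau> L u x = u x + \<tau> * f x + \<tau> * \<rho>" for x by (simp add: algebra_simps)
  have b: "has_bochner_integral \<nu> (\<lambda>(x, q). L x q + f x) (- \<rho>)" using assms(1) Gf by (simp add: mfg_solution_def)
  have f: "continuous_on UNIV f" by (simp add: f_def)
  have fi: "integrable \<nu> (\<lambda>(x, q). f x)" by (rule integrable_fst_torus[OF holonomic_prob[OF hol] f])
  \<comment> \<open>\<open>mfg_solution\<close> provides integrability of the sum only; subtracting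
    the bounded coupling isolates \<open>L\<close>.\<close>
  have "integrable \<nu> (\<lambda>p. (case p of (x, q) \<Rightarrow> L x q + f x) - (case p of (x, q) \<Rightarrow> f x))"
    using b fi by (intro Bochner_Integration.integrable_diff) (auto simp: has_bochner_integral_iff)
  then show L: "integrable \<nu> (\<lambda>(x, q). L x q)" by (simp add: case_prod_beta')
  show "(\<integral>(x, q). L x q \<partial>\<nu>) + (\<integral>(x, q). f x \<partial>\<nu>) = - \<rho>"
    using b Bochner_Integration.integral_add[OF L fi] by (simp add: has_bochner_integral_iff case_prod_beta')
qed

text \<open>The Lasry-Lions argument: each measure is inserted into the ergodic problem of the other
  solution. Adding the two inequalities makes the monotonicity pairing nonpositive, so the densities
  coincide; then the constants, the first marginals and, by \<open>lax_unique\<close>, the functions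
  follow.\<close>

lemma solution_unique:
  assumes 1: "mfg_solution \<tau> L G \<rho> u \<nu>" and 2: "mfg_solution \<tau> L G \<rho>' u' \<nu>'"
  shows "\<rho>' = \<rho> \<and> Pr1 \<nu>' = Pr1 \<nu> \<and> (\<exists>k. \<forall>x. u' x = u x + k)"
proof -
  note s1 = solutionD[OF 1] and s2 = solutionD[OF 2]
  note h1 = s1(2) and h2 = s2(2)
  have c: "continuous_on UNIV (apply_bcontfun (A w))" for w by simp
  have d: "dens \<nu> \<in> density_set \<tau>" "dens \<nu>' \<in> density_set \<tau>" using dens_in holonomic_prob h1 h2 by blast+
  let ?f = "apply_bcontfun (A (dens \<nu>))" and ?f' = "apply_bcontfun (A (dens \<nu>'))"
  have w1: "- \<rho> \<le> (\<integral>(x, q). L x q \<partial>\<nu>') + (\<integral>(x, q). ?f x \<partial>\<nu>')" by (rule weak_duality[OF h2 s2(4) s1(1) c s1(3)])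
  have w2: "- \<rho>' \<le> (\<integral>(x, q). L x q \<partial>\<nu>) + (\<integral>(x, q). ?f' x \<partial>\<nu>)" by (rule weak_duality[OF h1 s1(4) s2(1) c s2(3)])
  have eq: "dens \<nu> = dens \<nu>'"
  proof (rule ccontr)
    assume "dens \<nu> \<noteq> dens \<nu>'"
    from mono_A[OF d this]
    have "0 < (\<integral>z. apply_bcontfun (A (dens \<nu>) - A (dens \<nu>')) z * apply_bcontfun (dens \<nu> - dens \<nu>') z \<partial>torus_lebesgue)" .
    also have "\<dots> = ((\<integral>z. ?f z * apply_bcontfun (dens \<nu>) z \<partial>torus_lebesgue) - (\<integral>z. ?f z * apply_bcontfun (dens \<nu>') z \<partial>torus_lebesgue))
      - ((\<integral>z. ?f' z * apply_bcontfun (dens \<nu>) z \<partial>torus_lebesgue) - (\<integral>z. ?f' z * apply_bcontfun (dens \<nu>') z \<partial>torus_lebesgue))"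
    proof -
      have i: "integrable torus_lebesgue (\<lambda>z. apply_bcontfun v z * apply_bcontfun w z)" for v w :: "'n torus \<Rightarrow>\<^sub>C real"
        by (intro integrable_torus_lebesgue continuous_intros continuous_on_apply_bcontfun)
      show ?thesis by (simp add: minus_bcontfun.rep_eq left_diff_distrib right_diff_distrib i)
    qed
    finally show False
      using w1 w2 s1(5) s2(5) integral_dens[OF h1 c] integral_dens[OF h2 c] by simp
  qed
  have "\<rho>' = \<rho>" using w1 w2 s1(5) s2(5) eq by simp
  moreover have "Pr1 \<nu>' = Pr1 \<nu>"
  proof -
    have "holonomic_density \<tau> \<nu> = holonomic_density \<tau> \<nu>'"
      using eq apply_dens[OF holonomic_prob[OF h1]] apply_dens[OF holonomic_prob[OF h2]] by simp
    then show ?thesis using h1 h2 by (simp add: holonomic_iff_density[OF tau_pos])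
  qed
  moreover have "\<exists>k. \<forall>x. u' x = u x + k"
    by (rule lax_unique[OF s1(1) s2(1)]) (simp add: s1(3) s2(3) eq \<open>\<rho>' = \<rho>\<close>)
  ultimately show ?thesis by blast
qed

end

section \<open>Local and nonlocal couplings\<close>

lemma torus_integral_pos:
  fixes h :: "'n::finite torus \<Rightarrow> real"
  assumes h: "continuous_on UNIV h" "\<And>z. 0 \<le> h z" and "h z0 > 0"
  shows "0 < (\<integral>z. h z \<partial>torus_lebesgue)"
proof -
  have i: "integrable torus_lebesgue h" by (rule integrable_torus_lebesgue[OF h(1)])
  have "(\<integral>z. h z \<partial>torus_lebesgue) \<noteq> 0"
  proof
    assume "(\<integral>z. h z \<partial>torus_lebesgue) = 0"
    then have "AE z in torus_lebesgue. h z = 0"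
      using i h(2) by (simp add: integral_nonneg_eq_0_iff_AE)
    then have "AE z in torus_lebesgue. z \<notin> h -` {0<..}" by (auto elim!: eventually_mono)
    moreover have o: "open (h -` {0<..})" using h(1) by (intro open_vimage) auto
    ultimately have "emeasure torus_lebesgue (h -` {0<..}) = 0"
      using AE_iff_null_sets[of "h -` {0<..}" torus_lebesgue] by (simp add: sets_torus_lebesgue null_setsD1)
    then show False using torus_lebesgue_full_support[OF o] \<open>h z0 > 0\<close> by auto
  qed
  moreover have "0 \<le> (\<integral>z. h z \<partial>torus_lebesgue)" using h(2) by simp
  ultimately show ?thesis by simp
qed

lemma density_setE:
  assumes "\<tau> > 0" "w \<in> density_set \<tau>"
  obtains m where "prob_space m" "sets m = sets borel" "apply_bcontfun w = smoothed \<tau> m"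
  using assms(2) unfolding density_set_def by blast

context discrete_mfg
begin

text \<open>All smoothed densities take values in one compact interval [\<delta>, M] inside the
  positive axis, where \<open>F\<close> is uniformly continuous. The pairing is positive because its
  integrand (F a - F b) (a - b) is continuous, nonnegative, and positive where the densities
  differ.\<close>

lemma local_monotone_mfg:
  assumes F: "local_nonlinearity F"
  shows "monotone_mfg \<tau> c L (local_term \<tau> F) (\<lambda>w. Bcontfun (\<lambda>x. F (apply_bcontfun w x)))"
proof -
  obtain \<delta> M where \<delta>: "\<delta> > 0" "\<And>z :: 'n torus. \<delta> \<le> heat_kernel \<tau> z" "\<And>z :: 'n torus. heat_kernel \<tau> z \<le> M"
    using heat_kernel_bounds[OF tau_pos, where 'n = 'n] by metis
  have Fmono: "strict_mono_on {0<..} F" and "Ck_on 0 {0<..} F"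
    using F unfolding local_nonlinearity_def smooth_on_def by blast+
  then have Fc: "continuous_on {0<..} F" by simp
  have bd: "apply_bcontfun w x \<in> {\<delta>..M}" if w: "w \<in> density_set \<tau>" for w and x :: "'n torus"
  proof -
    obtain m where m: "prob_space m" "sets m = sets borel" "apply_bcontfun w = smoothed \<tau> m"
      using density_setE[OF tau_pos w] by blast
    show ?thesis using smoothed_bounds[OF tau_pos m(1,2)] \<delta>(2,3) by (simp add: m(3))
  qed
  have pos: "apply_bcontfun w x > 0" if "w \<in> density_set \<tau>" for w and x :: "'n torus"
    using bd[OF that, of x] \<delta>(1) by simp
  define A :: "('n torus \<Rightarrow>\<^sub>C real) \<Rightarrow> ('n torus \<Rightarrow>\<^sub>C real)" where "A w = Bcontfun (\<lambda>x. F (apply_bcontfun w x))" for w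
  have A: "apply_bcontfun (A w) x = F (apply_bcontfun w x)" if "w \<in> density_set \<tau>" for w x
  proof -
    have "continuous_on UNIV (\<lambda>x. F (apply_bcontfun w x))"
      using pos[OF that] by (intro continuous_on_compose2[OF Fc]) auto
    then show ?thesis unfolding A_def by (simp add: torus_bcontfun)
  qed
  have "monotone_mfg \<tau> c L (local_term \<tau> F) A"
  proof unfold_locales
    have "uniformly_continuous_on {\<delta>..M} F"
      using \<delta>(1) by (intro compact_uniformly_continuous continuous_on_subset[OF Fc]) auto
    note uc = this[unfolded uniformly_continuous_on_def]
    show "continuous_on (density_set \<tau>) A"
      unfolding continuous_on_iff
    proof (intro ballI allI impI)
      fix w :: "'n torus \<Rightarrow>\<^sub>C real" and e :: real assume w: "w \<in> density_set \<tau>" and "e > 0"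
      then obtain d where d: "d > 0" "\<And>a b. a \<in> {\<delta>..M} \<Longrightarrow> b \<in> {\<delta>..M} \<Longrightarrow> dist a b < d \<Longrightarrow> dist (F a) (F b) < e / 2"
        using uc by (metis half_gt_zero)
      have "dist (A v) (A w) < e" if v: "v \<in> density_set \<tau>" "dist v w < d" for v
      proof -
        have "dist (A v) (A w) \<le> e / 2"
        proof (rule dist_bound)
          fix x
          have "dist (apply_bcontfun v x) (apply_bcontfun w x) < d" using dist_bounded[of v x w] v(2) by simp
          then show "dist (apply_bcontfun (A v) x) (apply_bcontfun (A w) x) \<le> e / 2"
            using d(2)[OF bd[OF v(1)] bd[OF w]] by (simp add: A v(1) w less_imp_le)
        qed
        then show ?thesis using \<open>e > 0\<close> by simp
      qed
      then show "\<exists>d>0. \<forall>v\<in>density_set \<tau>. dist v w < d \<longrightarrow> dist (A v) (A w) < e" using d(1) by blast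
    qed
  next
    fix w v :: "'n torus \<Rightarrow>\<^sub>C real" assume w: "w \<in> density_set \<tau>" and v: "v \<in> density_set \<tau>" and "w \<noteq> v"
    then obtain z0 where z0: "apply_bcontfun w z0 \<noteq> apply_bcontfun v z0" by (metis bcontfun_eqI)
    have prod_pos: "0 < (F a - F b) * (a - b)" if "a > 0" "b > 0" "a \<noteq> b" for a b
      using that strict_mono_onD[OF Fmono, of a b] strict_mono_onD[OF Fmono, of b a]
      by (cases "a < b") (auto simp: mult_neg_neg)
    show "0 < (\<integral>z. apply_bcontfun (A w - A v) z * apply_bcontfun (w - v) z \<partial>torus_lebesgue)"
    proof (rule torus_integral_pos)
      show "continuous_on UNIV (\<lambda>z. apply_bcontfun (A w - A v) z * apply_bcontfun (w - v) z)"
        by (intro continuous_intros continuous_on_apply_bcontfun)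
      show "0 \<le> apply_bcontfun (A w - A v) z * apply_bcontfun (w - v) z" for z
        using prod_pos[OF pos[OF w, of z] pos[OF v, of z]]
        by (cases "apply_bcontfun w z = apply_bcontfun v z") (auto simp: minus_bcontfun.rep_eq A w v)
      show "0 < apply_bcontfun (A w - A v) z0 * apply_bcontfun (w - v) z0"
        using prod_pos[OF pos[OF w, of z0] pos[OF v, of z0] z0] by (simp add: minus_bcontfun.rep_eq A w v)
    qed
  next
    fix \<nu> :: "('n torus \<times> (real ^ 'n)) measure" and x assume "\<nu> \<in> holonomic \<tau>"
    note p = holonomic_prob[OF this]
    show "local_term \<tau> F x \<nu> = apply_bcontfun (A (dens \<nu>)) x"
      by (simp add: local_term_def A[OF dens_in[OF p]] apply_dens[OF p])
  qed
  then show ?thesis by (simp add: A_def[abs_def])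
qed

text \<open>Passing from a density to its measure is continuous from the sup norm to the weak
  topology. The coupling is thus jointly continuous on a compact product, and uniform continuity
  makes it continuous as a map into the sup norm.\<close>

lemma nonlocal_monotone_mfg:
  assumes F: "nonlocal_coupling F"
  shows "\<exists>A. monotone_mfg \<tau> c L (nonlocal_term F) A"
proof -
  define D where "D w = density torus_lebesgue (\<lambda>z. ennreal (apply_bcontfun w z))" for w :: "'n torus \<Rightarrow>\<^sub>C real"
  have D: "prob_space (D w)" "sets (D w) = sets borel"
    "\<And>f :: 'n torus \<Rightarrow> real. f \<in> borel_measurable borel \<Longrightarrow> (\<integral>x. f x \<partial>D w) = (\<integral>z. apply_bcontfun w z * f z \<partial>torus_lebesgue)"
    if "w \<in> density_set \<tau>" for w
    using that density_smoothed[OF tau_pos] by (auto elim!: density_setE[OF tau_pos] simp: D_def)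
  have Dprob: "D w \<in> space (prob_algebra borel)" if "w \<in> density_set \<tau>" for w
    using D(1,2)[OF that] by (simp add: space_prob_algebra)
  have Fc: "continuous_map (prod_topology euclidean weak_topology) euclidean (\<lambda>(x, m). F x m)"
    and Fm: "\<And>m m'. m \<in> space (prob_algebra borel) \<Longrightarrow> m' \<in> space (prob_algebra borel) \<Longrightarrow> m \<noteq> m' \<Longrightarrow>
        (\<integral>x. F x m - F x m' \<partial>m) - (\<integral>x. F x m - F x m' \<partial>m') > 0"
    using F unfolding nonlocal_coupling_def by blast+
  let ?S = "(UNIV :: 'n torus set) \<times> density_set \<tau>"
  have "continuous_map (top_of_set ?S) weak_topology (\<lambda>p. D (snd p))"
    unfolding weak_topology_def
  proof (rule continuous_on_generated_topo)
    fix V assume "V \<in> {{m \<in> space (prob_algebra borel). (\<integral>x. \<phi> x \<partial>m) \<in> U} | (\<phi> :: 'n torus \<Rightarrow> real) U.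
      continuous_on UNIV \<phi> \<and> open U}"
    then obtain \<phi> :: "'n torus \<Rightarrow> real" and U where V: "V = {m \<in> space (prob_algebra borel). (\<integral>x. \<phi> x \<partial>m) \<in> U}"
      and \<phi>: "continuous_on UNIV \<phi>" and U: "open U" by blast
    let ?g = "\<lambda>p :: 'n torus \<times> ('n torus \<Rightarrow>\<^sub>C real). \<integral>z. apply_bcontfun (snd p) z * \<phi> z \<partial>torus_lebesgue"
    have "continuous_on ?S ?g"
      by (intro bounded_linear.continuous_on[OF bounded_linear_integral_mult[OF \<phi>]] continuous_intros)
    then have "openin (top_of_set ?S) (?S \<inter> ?g -` U)" using U by (rule continuous_openin_preimage_gen)
    moreover have "?S \<inter> ?g -` U = (\<lambda>p. D (snd p)) -` V \<inter> topspace (top_of_set ?S)"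
      using Dprob D(3)[OF _ borel_measurable_continuous_onI[OF \<phi>]] by (auto simp: V)
    ultimately show "openin (top_of_set ?S) ((\<lambda>p. D (snd p)) -` V \<inter> topspace (top_of_set ?S))" by simp
  next
    show "(\<lambda>p. D (snd p)) ` topspace (top_of_set ?S) \<subseteq>
      \<Union> {{m \<in> space (prob_algebra borel). (\<integral>x. \<phi> x \<partial>m) \<in> U} | (\<phi> :: 'n torus \<Rightarrow> real) U. continuous_on UNIV \<phi> \<and> open U}"
    proof
      fix m assume "m \<in> (\<lambda>p. D (snd p)) ` topspace (top_of_set ?S)"
      then have m: "m \<in> space (prob_algebra borel)" using Dprob by auto
      show "m \<in> \<Union> {{m \<in> space (prob_algebra borel). (\<integral>x. \<phi> x \<partial>m) \<in> U} | (\<phi> :: 'n torus \<Rightarrow> real) U. continuous_on UNIV \<phi> \<and> open U}"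
        \<comment> \<open>With the test function 0 and the open set \<open>UNIV\<close> the
          generating set is all of the probability measures, so the image lies in the
          carrier.\<close>
        by (rule UnionI[of "{m \<in> space (prob_algebra borel). (\<integral>x. (0 :: real) \<partial>m) \<in> UNIV}"])
           (use m in \<open>auto intro!: exI[of _ "\<lambda>_ :: 'n torus. 0 :: real"] exI[of _ UNIV]\<close>)
    qed
  qed
  then have "continuous_map (top_of_set ?S) (prod_topology euclidean weak_topology) (\<lambda>p. (fst p, D (snd p)))"
    by (intro continuous_map_pairedI) (auto intro!: continuous_intros)
  from continuous_map_compose[OF this Fc]
  have H: "continuous_on ?S (\<lambda>(x, w). F x (D w))" by (simp add: o_def case_prod_beta)
  have Fx: "continuous_on UNIV (\<lambda>x. F x (D w))" if "w \<in> density_set \<tau>" for w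
    using continuous_on_compose2[OF H, of UNIV "\<lambda>x. (x, w)"] that by (simp add: image_subset_iff continuous_on_Pair continuous_on_id)
  define A :: "('n torus \<Rightarrow>\<^sub>C real) \<Rightarrow> ('n torus \<Rightarrow>\<^sub>C real)" where "A w = Bcontfun (\<lambda>x. F x (D w))" for w
  have A: "apply_bcontfun (A w) = (\<lambda>x. F x (D w))" if "w \<in> density_set \<tau>" for w
    unfolding A_def by (rule torus_bcontfun[OF Fx[OF that]])
  have "monotone_mfg \<tau> c L (nonlocal_term F) A"
  proof unfold_locales
    have "uniformly_continuous_on ?S (\<lambda>(x, w). F x (D w))"
      by (intro compact_uniformly_continuous H compact_Times compact_UNIV_torus compact_density_set tau_pos)
    note uc = this[unfolded uniformly_continuous_on_def]
    show "continuous_on (density_set \<tau>) A"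
      unfolding continuous_on_iff
    proof (intro ballI allI impI)
      fix w :: "'n torus \<Rightarrow>\<^sub>C real" and e :: real assume w: "w \<in> density_set \<tau>" and "e > 0"
      then obtain d where d: "d > 0" "\<And>p p'. p \<in> ?S \<Longrightarrow> p' \<in> ?S \<Longrightarrow> dist p' p < d \<Longrightarrow>
          dist (case p' of (x, w) \<Rightarrow> F x (D w)) (case p of (x, w) \<Rightarrow> F x (D w)) < e / 2"
        using uc by (metis half_gt_zero)
      have "dist (A v) (A w) < e" if v: "v \<in> density_set \<tau>" "dist v w < d" for v
      proof -
        have "dist (A v) (A w) \<le> e / 2"
        proof (rule dist_bound)
          fix x
          show "dist (apply_bcontfun (A v) x) (apply_bcontfun (A w) x) \<le> e / 2"
            using d(2)[of "(x, w)" "(x, v)"] v w by (simp add: A dist_Pair_Pair less_imp_le)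
        qed
        then show ?thesis using \<open>e > 0\<close> by simp
      qed
      then show "\<exists>d>0. \<forall>v\<in>density_set \<tau>. dist v w < d \<longrightarrow> dist (A v) (A w) < e" using d(1) by blast
    qed
  next
    fix w v :: "'n torus \<Rightarrow>\<^sub>C real" assume w: "w \<in> density_set \<tau>" and v: "v \<in> density_set \<tau>" and ne: "w \<noteq> v"
    have i: "integrable torus_lebesgue (\<lambda>z. apply_bcontfun a z * apply_bcontfun b z)" for a b :: "'n torus \<Rightarrow>\<^sub>C real"
      by (intro integrable_torus_lebesgue continuous_intros continuous_on_apply_bcontfun)
    have expand: "(\<integral>z. apply_bcontfun a z * apply_bcontfun (w - v) z \<partial>torus_lebesgue) =
        (\<integral>x. apply_bcontfun a x \<partial>D w) - (\<integral>x. apply_bcontfun a x \<partial>D v)" for a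
      using i by (simp add: D(3)[OF w borel_measurable_continuous_onI] D(3)[OF v borel_measurable_continuous_onI]
          minus_bcontfun.rep_eq algebra_simps)
    \<comment> \<open>Strict monotonicity is assumed for distinct measures; equal measures would
      force \<integral> (w - v)^2 = 0.\<close>
    have "D w \<noteq> D v"
    proof
      assume eq: "D w = D v"
      obtain z0 where z0: "apply_bcontfun w z0 \<noteq> apply_bcontfun v z0" using ne by (metis bcontfun_eqI)
      have "0 < (\<integral>z. apply_bcontfun (w - v) z * apply_bcontfun (w - v) z \<partial>torus_lebesgue)"
        by (rule torus_integral_pos[of _ z0])
           (use z0 in \<open>auto intro!: continuous_intros continuous_on_apply_bcontfun simp: minus_bcontfun.rep_eq zero_less_mult_iff\<close>)
      then show False using expand[of "w - v"] eq by simp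
    qed
    from Fm[OF Dprob[OF w] Dprob[OF v] this]
    show "0 < (\<integral>z. apply_bcontfun (A w - A v) z * apply_bcontfun (w - v) z \<partial>torus_lebesgue)"
      unfolding expand by (simp add: minus_bcontfun.rep_eq A w v)
  next
    fix \<nu> :: "('n torus \<times> (real ^ 'n)) measure" and x assume hol: "\<nu> \<in> holonomic \<tau>"
    note p = holonomic_prob[OF hol]
    have "Pr1 \<nu> = D (dens \<nu>)"
      using hol by (simp add: D_def apply_dens[OF p] holonomic_iff_density[OF tau_pos])
    then show "nonlocal_term F x \<nu> = apply_bcontfun (A (dens \<nu>)) x"
      by (simp add: nonlocal_term_def A[OF dens_in[OF p]])
  qed
  then show ?thesis by blast
qed

end

section \<open>Extended-real action and the duality formulas for the logarithm\<close>

lemma ereal_integral_eq_integral: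
  assumes "integrable M f"
  shows "ereal_integral M f = ereal (\<integral>x. f x \<partial>M)"
proof -
  have f: "(\<integral>\<^sup>+x. ennreal (f x) \<partial>M) < \<infinity>" "(\<integral>\<^sup>+x. ennreal (- f x) \<partial>M) < \<infinity>"
    using integrableD(2,3)[OF assms] by (auto simp: less_top)
  then have "ereal_integral M f = ereal (enn2real (\<integral>\<^sup>+x. ennreal (f x) \<partial>M) - enn2real (\<integral>\<^sup>+x. ennreal (- f x) \<partial>M))"
    unfolding ereal_integral_def
    by (cases "\<integral>\<^sup>+x. ennreal (f x) \<partial>M" rule: ennreal_cases; cases "\<integral>\<^sup>+x. ennreal (- f x) \<partial>M" rule: ennreal_cases) auto
  then show ?thesis by (simp add: real_lebesgue_integral_def[OF assms])
qed

text \<open>For an integrand bounded below, integrability can fail only through an infinite positive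
  part.\<close>

lemma ereal_integral_eq_top:
  assumes "prob_space M" "f \<in> borel_measurable M" "\<And>x. - C \<le> f x" "\<not> integrable M f"
  shows "ereal_integral M f = \<infinity>"
proof -
  interpret prob_space M by fact
  have "(\<integral>\<^sup>+x. ennreal (- f x) \<partial>M) \<le> (\<integral>\<^sup>+x. ennreal C \<partial>M)"
    using assms(3) by (intro nn_integral_mono ennreal_leI) (simp add: minus_le_iff)
  also have "\<dots> = ennreal C" by (simp add: emeasure_space_1)
  finally have neg: "(\<integral>\<^sup>+x. ennreal (- f x) \<partial>M) < \<infinity>" by (simp add: le_less_trans)
  then have "(\<integral>\<^sup>+x. ennreal (f x) \<partial>M) = \<infinity>"
    using assms(2,4) by (auto simp: real_integrable_def)
  then show ?thesis
    unfolding ereal_integral_def using neg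
    by (cases "\<integral>\<^sup>+x. ennreal (- f x) \<partial>M" rule: ennreal_cases) auto
qed

context monotone_mfg
begin

context
  fixes F \<rho> u \<nu>
  assumes sol: "mfg_solution \<tau> L G \<rho> u \<nu>" and F: "log_nonlinearity F" and G: "G = local_term \<tau> F"
begin

private abbreviation (input) "m \<equiv> holonomic_density \<tau> \<nu>"

lemma hol: "\<nu> \<in> holonomic \<tau>" using solutionD(2)[OF sol] .

lemma density_facts:
  assumes "\<nu>' \<in> holonomic \<tau>"
  shows "holonomic_density \<tau> \<nu>' z > 0" "continuous_on UNIV (holonomic_density \<tau> \<nu>')"
    "continuous_on UNIV (\<lambda>z. ln (holonomic_density \<tau> \<nu>' z))"
    "(\<integral>z. holonomic_density \<tau> \<nu>' z \<partial>torus_lebesgue) = 1"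
proof -
  note p = holonomic_prob[OF assms]
  note t = transported_prob[OF p, of \<tau>]
  note eq = holonomic_density_eq_smoothed[OF tau_pos p(2)]
  show pos: "holonomic_density \<tau> \<nu>' z > 0" for z unfolding eq by (rule smoothed_pos[OF tau_pos t])
  show c: "continuous_on UNIV (holonomic_density \<tau> \<nu>')" unfolding eq by (rule continuous_smoothed[OF tau_pos t])
  show "continuous_on UNIV (\<lambda>z. ln (holonomic_density \<tau> \<nu>' z))"
    using pos by (intro continuous_intros c) (auto simp: less_imp_neq[symmetric])
  show "(\<integral>z. holonomic_density \<tau> \<nu>' z \<partial>torus_lebesgue) = 1" unfolding eq by (rule integral_smoothed[OF tau_pos t])
qed

lemma A_log: "apply_bcontfun (A (dens \<nu>)) = (\<lambda>x. ln (m x))"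
proof
  fix x
  show "apply_bcontfun (A (dens \<nu>)) x = ln (m x)"
    using G_eq[OF hol, of x] density_facts(1)[OF hol, of x] F by (simp add: G local_term_def log_nonlinearity_def)
qed

lemma lax_log: "lax \<tau> L u x = u x + \<tau> * ln (m x) + \<tau> * \<rho>"
  using solutionD(3)[OF sol, of x] by (simp add: A_log)

lemma log_value: "(\<integral>(x, q). L x q \<partial>\<nu>) + (\<integral>(x, q). ln (m x) \<partial>\<nu>) = - \<rho>"
  using solutionD(5)[OF sol] by (simp add: A_log)

lemma log_action_eq: "log_action \<tau> L \<nu> = ereal (- \<rho>)"
proof -
  have "has_bochner_integral \<nu> (\<lambda>(x, q). L x q + G x \<nu>) (- \<rho>)" using sol by (simp add: mfg_solution_def)
  moreover have "G x \<nu> = ln (m x)" for x using G_eq[OF hol, of x] by (simp add: A_log)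
  ultimately show ?thesis
    unfolding log_action_def by (simp add: ereal_integral_eq_integral has_bochner_integral_iff)
qed

text \<open>Weak duality for the coupling frozen at \<open>\<nu>\<close>, combined with nonnegativity of the relative entropy.\<close>

lemma log_action_ge:
  assumes h: "\<nu>' \<in> holonomic \<tau>"
  shows "ereal (- \<rho>) \<le> log_action \<tau> L \<nu>'"
proof -
  let ?m' = "holonomic_density \<tau> \<nu>'"
  let ?f = "\<lambda>(x, q). L x q + ln (?m' x)"
  note p = holonomic_prob[OF h]
  have c: "continuous_on UNIV ?f"
    using continuous_on_add[OF continuous_L continuous_fst_torus[OF density_facts(3)[OF h]]] by (simp add: case_prod_beta)
  note lnb = integrable_fst_torus[OF p]
  show ?thesis
  proof (cases "integrable \<nu>' ?f")
    case True
    have "integrable \<nu>' (\<lambda>p. ?f p - (case p of (x, q) \<Rightarrow> ln (?m' x)))"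
      by (intro Bochner_Integration.integrable_diff True lnb density_facts(3)[OF h])
    then have L: "integrable \<nu>' (\<lambda>(x, q). L x q)" by (simp add: case_prod_beta')
    have "- \<rho> \<le> (\<integral>(x, q). L x q \<partial>\<nu>') + (\<integral>(x, q). ln (m x) \<partial>\<nu>')"
      by (rule weak_duality[OF h L solutionD(1)[OF sol] density_facts(3)[OF hol] lax_log])
    also have "(\<integral>(x, q). ln (m x) \<partial>\<nu>') \<le> (\<integral>(x, q). ln (?m' x) \<partial>\<nu>')"
    proof -
      \<comment> \<open>Gibbs: ln r \<le> r - 1 at r = m / m'. The linear remainder integrates to 0,
        since both densities have mass 1.\<close>
      have "?m' z * ln (m z) \<le> ?m' z * ln (?m' z) + (m z - ?m' z)" for z
      proof -
        have pos: "m z > 0" "?m' z > 0" using density_facts(1) hol h by auto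
        have "ln (m z / ?m' z) \<le> m z / ?m' z - 1" using pos by (intro ln_le_minus_one) simp
        then have "?m' z * (ln (m z) - ln (?m' z)) \<le> ?m' z * (m z / ?m' z - 1)"
          using pos by (intro mult_left_mono) (auto simp: ln_div)
        then show ?thesis using pos by (simp add: right_diff_distrib)
      qed
      then have "(\<integral>z. ?m' z * ln (m z) \<partial>torus_lebesgue) \<le> (\<integral>z. ?m' z * ln (?m' z) + (m z - ?m' z) \<partial>torus_lebesgue)"
        by (intro integral_mono integrable_torus_lebesgue continuous_on_add continuous_on_mult continuous_on_diff
            density_facts(2,3) hol h)
      also have "\<dots> = (\<integral>z. ?m' z * ln (?m' z) \<partial>torus_lebesgue)"
      proof -
        have "integrable torus_lebesgue (\<lambda>z. ?m' z * ln (?m' z))" "integrable torus_lebesgue m" "integrable torus_lebesgue ?m'"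
          by (intro integrable_torus_lebesgue continuous_on_mult density_facts(2,3) hol h)+
        then show ?thesis using density_facts(4)[OF hol] density_facts(4)[OF h] by simp
      qed
      finally show ?thesis
        using holonomic_integral_fst[OF tau_pos h borel_measurable_continuous_onI[OF density_facts(3)[OF hol]]]
          holonomic_integral_fst[OF tau_pos h borel_measurable_continuous_onI[OF density_facts(3)[OF h]]] by simp
    qed
    finally have "- \<rho> \<le> (\<integral>p. ?f p \<partial>\<nu>')"
      using Bochner_Integration.integral_add[OF L lnb[OF density_facts(3)[OF h]]] by (simp add: case_prod_beta')
    then show ?thesis unfolding log_action_def ereal_integral_eq_integral[OF True] by simp
  next
    case False
    obtain C where C: "\<And>x q. L x q \<ge> norm q - C" using coercive by blast
    obtain B where B: "\<And>x. \<bar>ln (?m' x)\<bar> \<le> B" using torus_bounded[OF density_facts(3)[OF h]] by blast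
    have "- (C + B) \<le> ?f y" for y
    proof (cases y)
      case (Pair x q)
      have "- B \<le> ln (?m' x)" using B[of x] by linarith
      then show ?thesis unfolding Pair prod.case using C[where x = x and q = q] norm_ge_zero[of q] by linarith
    qed
    then have "ereal_integral \<nu>' ?f = \<infinity>"
      using False borel_measurable_continuous_onI[OF c]
      by (intro ereal_integral_eq_top[OF p(1), where C = "C + B"]) (auto simp: measurable_cong_sets[OF p(2) refl])
    then show ?thesis by (simp add: log_action_def)
  qed
qed

text \<open>The ergodic equation with coupling ln m says that the integrand is exp \<rho> times m,
  and m has mass 1.\<close>

lemma exp_functional_eq: "exp_functional \<tau> L u = exp \<rho>"
proof -
  have "exp ((lax \<tau> L u x - u x) / \<tau>) = exp \<rho> * m x" for x
    using tau_pos density_facts(1)[OF hol, of x] by (simp add: lax_log add_divide_distrib exp_add mult.commute)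
  then show ?thesis using density_facts(4)[OF hol] by (simp add: exp_functional_def)
qed

text \<open>Jensen's inequality for the density of \<open>\<nu>\<close>, through the tangent line of the exponential at \<open>\<rho>\<close>.\<close>

lemma exp_functional_ge:
  assumes \<phi>: "continuous_on UNIV \<phi>"
  shows "exp \<rho> \<le> exp_functional \<tau> L \<phi>"
proof -
  \<comment> \<open>By construction \<phi> solves the ergodic equation with coupling
    \<open>h\<close> and constant 0, so weak duality applies to it with the measure \<nu>.\<close>
  define h where "h x = (lax \<tau> L \<phi> x - \<phi> x) / \<tau>" for x
  have h: "continuous_on UNIV h"
    unfolding h_def using tau_pos by (intro continuous_intros continuous_lax \<phi>) auto
  have "- 0 \<le> (\<integral>(x, q). L x q \<partial>\<nu>) + (\<integral>(x, q). h x \<partial>\<nu>)"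
    using tau_pos by (intro weak_duality[OF hol solutionD(4)[OF sol] \<phi> h]) (simp add: h_def)
  then have ge: "\<rho> \<le> (\<integral>(x, q). h x \<partial>\<nu>) - (\<integral>(x, q). ln (m x) \<partial>\<nu>)" using log_value by simp
  have i: "integrable torus_lebesgue (\<lambda>z. m z * h z)" "integrable torus_lebesgue (\<lambda>z. m z * ln (m z))" "integrable torus_lebesgue m"
    by (intro integrable_torus_lebesgue continuous_on_mult density_facts(2,3) hol h)+
  \<comment> \<open>The tangent of exp at \<rho>, evaluated at h - ln m and multiplied by m, so that
    m times exp (h - ln m) becomes exp h.\<close>
  have "exp \<rho> * (m z * (1 - \<rho>) + (m z * h z - m z * ln (m z))) \<le> exp (h z)" for z
  proof -
    have pos: "m z > 0" by (rule density_facts(1)[OF hol])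
    have "exp \<rho> * (1 + (h z - ln (m z) - \<rho>)) \<le> exp \<rho> * exp (h z - ln (m z) - \<rho>)"
      by (intro mult_left_mono exp_ge_add_one_self) simp
    also have "\<dots> = exp (h z) / m z" using pos by (simp add: exp_diff)
    finally have "m z * (exp \<rho> * (1 + (h z - ln (m z) - \<rho>))) \<le> m z * (exp (h z) / m z)"
      using pos by (intro mult_left_mono) auto
    then show ?thesis using pos by (simp add: algebra_simps)
  qed
  note le = this
  have "exp \<rho> * 1 \<le> exp \<rho> * ((1 - \<rho>) + ((\<integral>(x, q). h x \<partial>\<nu>) - (\<integral>(x, q). ln (m x) \<partial>\<nu>)))"
    using ge by (intro mult_left_mono) auto
  also have "\<dots> = (\<integral>z. exp \<rho> * (m z * (1 - \<rho>) + (m z * h z - m z * ln (m z))) \<partial>torus_lebesgue)"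
    using i density_facts(4)[OF hol] holonomic_integral_fst[OF tau_pos hol borel_measurable_continuous_onI[OF h]]
      holonomic_integral_fst[OF tau_pos hol borel_measurable_continuous_onI[OF density_facts(3)[OF hol]]] by simp
  also have "\<dots> \<le> (\<integral>z. exp (h z) \<partial>torus_lebesgue)"
    using i le by (intro integral_mono) (auto intro!: integrable_torus_lebesgue continuous_intros h)
  finally show ?thesis by (simp add: exp_functional_def h_def)
qed

text \<open>The components \<nu> and u of a solution are themselves the two minimisers.\<close>

lemma log_duality:
  "(\<exists>\<nu>\<^sub>0. is_arg_min (log_action \<tau> L) (\<lambda>\<nu>'. \<nu>' \<in> holonomic \<tau>) \<nu>\<^sub>0 \<and> ereal (- \<rho>) = log_action \<tau> L \<nu>\<^sub>0) \<and>
   (\<exists>\<phi>\<^sub>0. is_arg_min (exp_functional \<tau> L) (continuous_on UNIV) \<phi>\<^sub>0 \<and> - \<rho> = - ln (exp_functional \<tau> L \<phi>\<^sub>0))"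
proof (intro conjI exI)
  show "is_arg_min (log_action \<tau> L) (\<lambda>\<nu>'. \<nu>' \<in> holonomic \<tau>) \<nu>"
    unfolding is_arg_min_def log_action_eq using hol log_action_ge by (auto simp: not_less)
  show "is_arg_min (exp_functional \<tau> L) (continuous_on UNIV) u"
    unfolding is_arg_min_def exp_functional_eq using solutionD(1)[OF sol] exp_functional_ge by (auto simp: not_less)
qed (simp_all add: log_action_eq exp_functional_eq)

end

end

section \<open>Existence, uniqueness and logarithmic duality together\<close>

theorem theorem1:
  fixes \<tau> c\<^sub>0 :: real
    and L :: "'n::finite torus \<Rightarrow> real ^ 'n \<Rightarrow> real"
    and G :: "'n torus \<Rightarrow> ('n torus \<times> (real ^ 'n)) measure \<Rightarrow> real"
  assumes "\<tau> > 0"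
    and "tonelli_lagrangian L"
    and "c\<^sub>0 > 0" and "\<forall>x q v. v \<bullet> (hessian (L x) q *v v) \<ge> c\<^sub>0 * (v \<bullet> v)"
    and "(\<exists>F. nonlocal_coupling F \<and> G = nonlocal_term F) \<or>
         (\<exists>F. local_nonlinearity F \<and> G = local_term \<tau> F)"
  shows "\<exists>\<rho> u \<nu>. mfg_solution \<tau> L G \<rho> u \<nu> \<and>
    (\<forall>\<rho>' u' \<nu>'. mfg_solution \<tau> L G \<rho>' u' \<nu>' \<longrightarrow>
       \<rho>' = \<rho> \<and> Pr1 \<nu>' = Pr1 \<nu> \<and> (\<exists>c. \<forall>x. u' x = u x + c)) \<and>
    ((\<exists>F. log_nonlinearity F \<and> G = local_term \<tau> F) \<longrightarrow>
       (\<exists>\<nu>\<^sub>0. is_arg_min (log_action \<tau> L) (\<lambda>\<nu>'. \<nu>' \<in> holonomic \<tau>) \<nu>\<^sub>0 \<and>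
          ereal (- \<rho>) = log_action \<tau> L \<nu>\<^sub>0) \<and>
       (\<exists>\<phi>\<^sub>0. is_arg_min (exp_functional \<tau> L) (continuous_on UNIV) \<phi>\<^sub>0 \<and>
          - \<rho> = - ln (exp_functional \<tau> L \<phi>\<^sub>0)))"
proof -
  interpret discrete_mfg \<tau> c\<^sub>0 L using assms by unfold_locales auto
  obtain A where "monotone_mfg \<tau> c\<^sub>0 L G A"
    using assms(5) nonlocal_monotone_mfg local_monotone_mfg by blast
  then interpret monotone_mfg \<tau> c\<^sub>0 L G A .
  obtain \<rho> u \<nu> where sol: "mfg_solution \<tau> L G \<rho> u \<nu>" using solution_exists by blast
  show ?thesis
    using sol solution_unique[OF sol] log_duality[OF sol]
    by (intro exI[of _ \<rho>] exI[of _ u] exI[of _ \<nu>]) blast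
qed

end
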